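(* Let $\mathfrak{t}:=1+i$. Let $b\in\mathbb{Z}[i]$ be nonzero and fourth-power-free, so that $$b=i^{s_b}\mathfrak{t}^{t_b}\mathfrak{p}_1^{r_1}\cdots\mathfrak{p}_M^{r_M}\mathfrak{q}_1^2\cdots\mathfrak{q}_N^2$$ with $s_b,t_b\in\{0,1,2,3\}$, $r_i\in\{1,3\}$, and $\mathfrak{p}_1,\dots,\mathfrak{p}_M,\mathfrak{q}_1,\dots,\mathfrak{q}_N$ distinct primary primes. Construct a matrix $L_b'$ with entries in $\mathbb{F}_2$, with rows and columns indexed by a subset of the vertex set of $G_b$, as follows: \begin{itemize} \item $L_b^{(1)}$ is the reduction mod $2$ of the Laplacian $L(G_b)$. \item $L_b^{(2)}$ is obtained from $L_b^{(1)}$ by deleting the $\mathfrak{q}_j$-th row and column for every $j$ such that $\deg^{(1,3)}(\mathfrak{q}_j)\not\equiv m_{\mathfrak{q}_j}t_b+n_{\mathfrak{q}_j}s_b \pmod 2$. \item $L_b^{(3)}$ is obtained from $L_b^{(2)}$ by adding $1$ to the $\mathfrak{p}_i$-th diagonal entry for every $i$ such that $\deg^{(2)}(\mathfrak{p}_i)\not\equiv m_{\mathfrak{p}_i}t_b+n_{\mathfrak{p}_i}s_b\pmod 2$. \item $L_b'$ is obtained from $L_b^{(3)}$ by adding $1$ to the $\mathfrak{q}_j$-th diagonal entry (for each remaining $\mathfrak{q}_j$) such that $\deg^{(1)}(\mathfrak{q}_j)+3\deg^{(3)}(\mathfrak{q}_j)\equiv m_{\mathfrak{q}_j}t_b+n_{\mathfrak{q}_j}s_b+2(n_{\mathfrak{q}_j}+1)\pmod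 4$. \end{itemize} Let $d\in\mathbb{Z}[i]$ be a square-free divisor of $b$, written $d=i^{s_d}(1+i)^{t_d}\prod_{v\in V_d}v$ with $s_d,t_d\in\{0,1\}$ and $V_d\subseteq\{\mathfrak{p}_1,\dots,\mathfrak{p}_M,\mathfrak{q}_1,\dots,\mathfrak{q}_N\}$, and let $\vec{\mathbbm{1}}^{(d)}$ be the $\mathbb{F}_2$-vector indexed by the vertices indexing the columns of $L_b'$ with $\vec{\mathbbm{1}}^{(d)}_v=1$ iff $v\mid d$. Then $d\in S^{(\varphi)}(E_b/\mathbb{Q}(i))$ if and only if both of the following hold: \begin{enumerate} \item $L_b'\cdot\vec{\mathbbm{1}}^{(d)}=\vec{y}^{(s_d,t_d)}$, where $\vec{y}^{(s_d,t_d)}_v:=m_vt_d+n_vs_d \pmod 2$ for each vertex $v$ indexing a row of $L_b'$. \item With $b_0:=b/\mathfrak{t}^{t_b}$ and $d_0:=d/\mathfrak{t}^{t_d}$, at least one of the following holds: (A) $t_b\equiv t_d\pmod 2$ and $b_0\equiv d_0(\pm1-d_0\mathfrak{t}^{4k+t_b})\pmod{\mathfrak{t}^5}$ for some $k\in\mathbb{Z}_{\ge0}$ and some choice of sign; (B) $t_d=0$ and $b_0\mathfrak{t}^{4k+t_b}\equiv d_0(\pm1-d_0)\pmod{\mathfrak{t}^5}$ for some $k\in\mathbb{Z}_{\ge0}$ and some choice of sign; (C) $t_b=2t_d$ and $b_0\equiv -d_0(d_0-\alpha_0^2\mathfrak{t}^{2k-t_d})\pmod{\mathfrak{t}^7}$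 for some $k\in\mathbb{Z}_{\ge1}$ and some $\alpha_0\in\mathbb{Z}[i]_{\mathfrak{t}}^*$. \end{enumerate}
   Context: A Gaussian integer $\alpha$ is primary if $\alpha\equiv1\pmod{(1+i)^3}$. $\mathbb{Z}[i]_{\mathfrak{t}}$ denotes the ring of integers of the completion $\mathbb{Q}(i)_{\mathfrak{t}}$, and $\mathbb{Z}[i]_{\mathfrak{t}}^*$ its units. For a primary prime $\mathfrak{p}$ and $\alpha$ a $\mathfrak{p}$-adic unit, the quartic symbol $\left[\frac{\alpha}{\mathfrak{p}}\right]_4$ is the unique element of $\{1,i,-1,-i\}$ congruent to $\alpha^{(\mathrm{Nm}(\mathfrak{p})-1)/4}$ mod $\mathfrak{p}$ (where $\mathrm{Nm}(x+yi)=x^2+y^2$); for general $\alpha\in\mathbb{Q}(i)^*$ set $\left[\frac{\alpha}{\mathfrak{p}}\right]_4:=\left[\frac{\alpha\mathfrak{p}^{-v_{\mathfrak{p}}(\alpha)}}{\mathfrak{p}}\right]_4$. $\log_i$ denotes the inverse of $k\mapsto i^k$, $\mathbb{Z}/4\mathbb{Z}\to\{\pm1,\pm i\}$. For primary $\alpha$, $(m_\alpha,n_\alpha)\in(\mathbb{Z}/8\mathbb{Z})^2$ is the unique pair with $\alpha\equiv(1-4i)^{m_\alpha}(-1-6i)^{n_\alpha}\pmod{(1+i)^9}$; $m_\alpha,n_\alpha$ also denote their reductions mod $4$ or mod $2$ as appropriate. Graph $G_b$: vertex set $V=\{\mathfrak{p}_1,\dots,\mathfrak{p}_M,\mathfrak{q}_1,\dots,\mathfrak{q}_N\}$;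 for $v\ne w$ the weight $[v,w]:=\log_i\left[\frac{w}{v}\right]_4\in\mathbb{Z}/4\mathbb{Z}$, and $[v,v]:=0$. For $v\in V$: $\deg(v)=\sum_{w\in V}[v,w]$; $\deg^{(k)}(v)=\sum[v,w]$ over those $w\in V$ whose exponent in $b$ equals $k$ ($k=1,2,3$); $\deg^{(1,3)}=\deg^{(1)}+\deg^{(3)}$; all in $\mathbb{Z}/4\mathbb{Z}$. The Laplacian $L(G_b)=\mathrm{diag}(\deg(v))_{v\in V}-A(G_b)$ with $A(G_b)_{v,w}=[v,w]$. $E_b:y^2=x^3+bx$ over $\mathbb{Q}(i)$ with the $2$-isogeny $\varphi:E_b\to E_{-4b}$, $\varphi(x,y)=(y^2/x^2,\,y(b-x^2)/x^2)$. For $d\mid 2b$ let $C_d\subset\mathbb{P}^3$ be the curve $dX_2^2=d^2X_0^2-4bX_3^2$, $X_1^2=X_0X_3$ (affine part $dw^2=d^2-4bz^4$, plus the points $[0:0:\pm2i\sqrt{b/d}:1]$). The $\varphi$-Selmer group $S^{(\varphi)}(E_b/\mathbb{Q}(i))$ is identified with the set of classes in $\mathbb{Q}(i)^*/(\mathbb{Q}(i)^* )^2$ of $d\mid 2b$ such that $C_d(\mathbb{Q}(i)_v)\neq\emptyset$ for every place $v\mid 2b$; "$d\in S^{(\varphi)}$" means the class of $d$ lies in it.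
   Formalization: Condition (1) additionally requires that no deleted vertex q_j divides d (V_d lies in the index set of L_b'); without this the equivalence fails, e.g. b=(-1+2i)(3-2i)^2, d=3-2i satisfies (1) and (2)(A) but d is not in the Selmer group. *)

theory Defs
  imports
    Complex_Main
    "HOL-Library.Z2"
    "HOL-Computational_Algebra.Polynomial_Factorial"
    "HOL-Computational_Algebra.Squarefree"
    "HOL-Number_Theory.Cong"
    "HOL-Algebra.QuotRing"
begin

section \<open>The Euclidean ring of Gaussian integers\<close>

datatype gint = GInt (gRe: int) (gIm: int)

lemma gint_eq_iff: "x = y \<longleftrightarrow> gRe x = gRe y \<and> gIm x = gIm y"
  by (cases x; cases y) simp

instantiation gint :: comm_ring_1
begin

definition zero_gint :: gint where "0 = GInt 0 0"
definition one_gint :: gint where "1 = GInt 1 0"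
definition plus_gint :: "gint \<Rightarrow> gint \<Rightarrow> gint" where
  "x + y = GInt (gRe x + gRe y) (gIm x + gIm y)"
definition uminus_gint :: "gint \<Rightarrow> gint" where
  "- x = GInt (- gRe x) (- gIm x)"
definition minus_gint :: "gint \<Rightarrow> gint \<Rightarrow> gint" where
  "x - y = GInt (gRe x - gRe y) (gIm x - gIm y)"
definition times_gint :: "gint \<Rightarrow> gint \<Rightarrow> gint" where
  "x * y = GInt (gRe x * gRe y - gIm x * gIm y) (gRe x * gIm y + gIm x * gRe y)"

lemma gRe_simps [simp]:
  "gRe 0 = 0" "gRe 1 = 1" "gRe (x + y) = gRe x + gRe y" "gRe (- x) = - gRe x"
  "gRe (x - y) = gRe x - gRe y" "gRe (x * y) = gRe x * gRe y - gIm x * gIm y"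
  by (simp_all add: zero_gint_def one_gint_def plus_gint_def uminus_gint_def
      minus_gint_def times_gint_def)

lemma gIm_simps [simp]:
  "gIm 0 = 0" "gIm 1 = 0" "gIm (x + y) = gIm x + gIm y" "gIm (- x) = - gIm x"
  "gIm (x - y) = gIm x - gIm y" "gIm (x * y) = gRe x * gIm y + gIm x * gRe y"
  by (simp_all add: zero_gint_def one_gint_def plus_gint_def uminus_gint_def
      minus_gint_def times_gint_def)

instance
  by standard (simp_all add: gint_eq_iff algebra_simps)

end

definition gi :: gint where "gi = GInt 0 1"

definition gcnj :: "gint \<Rightarrow> gint" where "gcnj x = GInt (gRe x) (- gIm x)"

definition Nm :: "gint \<Rightarrow> int" where "Nm x = (gRe x)\<^sup>2 + (gIm x)\<^sup>2"

lemma gi_simps [simp]: "gRe gi = 0" "gIm gi = 1"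
  by (simp_all add: gi_def)

lemma gcnj_simps [simp]: "gRe (gcnj x) = gRe x" "gIm (gcnj x) = - gIm x"
  by (simp_all add: gcnj_def)

lemma Nm_0 [simp]: "Nm 0 = 0"
  by (simp add: Nm_def)

lemma Nm_nonneg [simp]: "Nm x \<ge> 0"
  by (simp add: Nm_def)

lemma Nm_eq_0_iff [simp]: "Nm x = 0 \<longleftrightarrow> x = 0"
  by (simp add: Nm_def gint_eq_iff sum_power2_eq_zero_iff)

lemma Nm_pos_iff: "Nm x > 0 \<longleftrightarrow> x \<noteq> 0"
  using Nm_nonneg[of x] Nm_eq_0_iff[of x] by linarith

lemma Nm_mult: "Nm (x * y) = Nm x * Nm y"
  by (simp add: Nm_def power2_eq_square algebra_simps)

instance gint :: idom
proof
  fix x y :: gint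
  assume "x \<noteq> 0" "y \<noteq> 0"
  then have "Nm (x * y) \<noteq> 0" by (simp add: Nm_mult)
  then show "x * y \<noteq> 0" by auto
qed

text \<open>
  Division rounds the exact quotient \<open>x * gcnj y / Nm y\<close> to a nearest Gaussian integer, so it is
  exact on multiples; \<open>normalize\<close> rotates into the half-open first quadrant.
\<close>

instantiation gint :: "{normalization_euclidean_semiring, euclidean_ring}"
begin

definition divide_gint :: "gint \<Rightarrow> gint \<Rightarrow> gint" where
  "x div y = GInt ((2 * gRe (x * gcnj y) + Nm y) div (2 * Nm y))
                  ((2 * gIm (x * gcnj y) + Nm y) div (2 * Nm y))"

definition modulo_gint :: "gint \<Rightarrow> gint \<Rightarrow> gint" where
  "(x :: gint) mod y = x - x div y * y"

definition euclidean_size_gint :: "gint \<Rightarrow> nat" where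
  "euclidean_size_gint x = nat (Nm x)"

definition unit_factor_gint :: "gint \<Rightarrow> gint" where
  "unit_factor_gint x =
     (if x = 0 then 0
      else if gRe x > 0 \<and> gIm x \<ge> 0 then 1
      else if gRe x \<le> 0 \<and> gIm x > 0 then gi
      else if gRe x < 0 \<and> gIm x \<le> 0 then - 1
      else - gi)"

definition normalize_gint :: "gint \<Rightarrow> gint" where
  "normalize_gint x = x * gcnj (unit_factor x)"

lemma gint_unit_cases:
  assumes "(x :: gint) dvd 1"
  shows "x = 1 \<or> x = -1 \<or> x = gi \<or> x = - gi"
proof -
  from assms obtain y where "1 = x * y" by (elim dvdE)
  then have "Nm x * Nm y = 1" using Nm_mult[of x y] by (simp add: Nm_def)
  then have N: "(gRe x)\<^sup>2 + (gIm x)\<^sup>2 = 1"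
    using Nm_nonneg[of x] by (auto simp only: zmult_eq_1_iff Nm_def)
  then have "(gRe x)\<^sup>2 \<le> 1" "(gIm x)\<^sup>2 \<le> 1"
    using zero_le_power2[of "gRe x"] zero_le_power2[of "gIm x"] by linarith+
  then have "\<bar>gRe x\<bar> \<le> 1" "\<bar>gIm x\<bar> \<le> 1"
    by (simp_all add: abs_square_le_1)
  then have "gRe x \<in> {-1, 0, 1}" "gIm x \<in> {-1, 0, 1}" by auto
  with N show ?thesis by (auto simp: gint_eq_iff)
qed

lemma gi_mult_gi [simp]: "gi * gi = -1"
  by (simp add: gint_eq_iff)

lemma gi_dvd_1 [simp]: "gi dvd 1"
  by (rule dvdI[of _ _ "- gi"]) (simp add: gint_eq_iff)

lemma Nm_mod_less:
  assumes "(y :: gint) \<noteq> 0"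
  shows "Nm (x - x div y * y) < Nm y"
proof -
  define n where "n = Nm y"
  have n: "n > 0" using assms by (simp add: n_def Nm_pos_iff)
  define r where "r = x - x div y * y"
  have round: "\<bar>2 * (a - n * ((2 * a + n) div (2 * n)))\<bar> \<le> n" for a
  proof -
    have "(2 * n) * ((2 * a + n) div (2 * n)) + (2 * a + n) mod (2 * n) = 2 * a + n"
      by simp
    moreover have "0 \<le> (2 * a + n) mod (2 * n)" "(2 * a + n) mod (2 * n) < 2 * n"
      using n by simp_all
    ultimately show ?thesis by (simp add: algebra_simps abs_le_iff)
  qed
  have nn: "n = gRe y * gRe y + gIm y * gIm y"
    by (simp add: n_def Nm_def power2_eq_square)
  have cc: "r * gcnj y = x * gcnj y - x div y * (y * gcnj y)"
    by (simp add: r_def algebra_simps)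
  have yy: "y * gcnj y = GInt n 0"
    by (simp add: gint_eq_iff nn)
  have re: "gRe (r * gcnj y) = gRe (x * gcnj y) -
      n * ((2 * gRe (x * gcnj y) + n) div (2 * n))"
    unfolding cc yy by (simp add: divide_gint_def n_def)
  have im: "gIm (r * gcnj y) = gIm (x * gcnj y) -
      n * ((2 * gIm (x * gcnj y) + n) div (2 * n))"
    unfolding cc yy by (simp add: divide_gint_def n_def)
  have b: "(2 * gRe (r * gcnj y))\<^sup>2 \<le> n\<^sup>2" "(2 * gIm (r * gcnj y))\<^sup>2 \<le> n\<^sup>2"
  proof -
    have sq: "c\<^sup>2 \<le> n\<^sup>2" if "\<bar>c\<bar> \<le> n" for c
      using power_mono[OF that abs_ge_zero, of 2] by simp
    show "(2 * gRe (r * gcnj y))\<^sup>2 \<le> n\<^sup>2" "(2 * gIm (r * gcnj y))\<^sup>2 \<le> n\<^sup>2"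
      unfolding re im by (rule sq, rule round)+
  qed
  have "4 * Nm (r * gcnj y) \<le> 2 * n\<^sup>2"
    using b unfolding Nm_def by (simp add: power_mult_distrib del: gRe_simps gIm_simps gcnj_simps)
  moreover have "Nm (r * gcnj y) = Nm r * n"
    by (simp only: Nm_mult) (simp add: n_def Nm_def)
  ultimately have "(2 * Nm r) * n \<le> n * n"
    by (simp add: power2_eq_square mult.commute)
  then have "2 * Nm r \<le> n" using n by simp
  then show ?thesis using n by (simp add: r_def[symmetric] n_def)
qed

instance
proof
  fix a b c :: gint
  show "b \<noteq> 0 \<Longrightarrow> a * b div b = a"
  proof -
    assume b: "b \<noteq> 0"
    define n where "n = Nm b"
    have n: "n > 0" using b by (simp add: n_def Nm_pos_iff)
    have "a * b * gcnj b = GInt (n * gRe a) (n * gIm a)"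
      by (simp add: gint_eq_iff n_def Nm_def power2_eq_square algebra_simps)
    moreover have "(2 * (n * k) + n) div (2 * n) = k" for k
    proof -
      have "(2 * (n * k) + n) div (2 * n) = (n + k * (2 * n)) div (2 * n)"
        by (simp add: algebra_simps)
      also have "\<dots> = k + n div (2 * n)" using n by (subst div_mult_self1) auto
      also have "n div (2 * n) = 0" using n by simp
      finally show ?thesis by simp
    qed
    ultimately show "a * b div b = a"
      by (simp add: divide_gint_def n_def[symmetric] gint_eq_iff del: gRe_simps gIm_simps)
  qed
  show "a div 0 = 0" by (simp add: divide_gint_def zero_gint_def)
  show "a div b * b + a mod b = a" by (simp add: modulo_gint_def)
  show "euclidean_size (0 :: gint) = 0" by (simp add: euclidean_size_gint_def)
  show "b \<noteq> 0 \<Longrightarrow> euclidean_size (a mod b) < euclidean_size b"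
    using Nm_mod_less[of b a]
    by (simp add: euclidean_size_gint_def modulo_gint_def Nm_pos_iff)
  show "b \<noteq> 0 \<Longrightarrow> euclidean_size a \<le> euclidean_size (a * b)"
  proof -
    assume "b \<noteq> 0"
    then have "1 \<le> Nm b" using Nm_pos_iff[of b] by linarith
    then have "Nm a * 1 \<le> Nm a * Nm b" by (intro mult_left_mono) simp_all
    then show "euclidean_size a \<le> euclidean_size (a * b)"
      unfolding euclidean_size_gint_def Nm_mult by simp
  qed
  show "unit_factor (0 :: gint) = 0" by (simp add: unit_factor_gint_def)
  show "unit_factor a = a" if "a dvd 1"
    using gint_unit_cases[OF that]
    by (elim disjE; hypsubst) (simp_all add: unit_factor_gint_def gint_eq_iff)
  show "a \<noteq> 0 \<Longrightarrow> unit_factor a dvd 1"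
    by (simp add: unit_factor_gint_def)
  show "unit_factor (a * b) = a * unit_factor b" if "a dvd 1"
    using gint_unit_cases[OF that]
    by (elim disjE; hypsubst; cases "gRe b" "0 :: int" rule: linorder_cases;
        cases "gIm b" "0 :: int" rule: linorder_cases)
      (simp_all add: unit_factor_gint_def gint_eq_iff)
  show "unit_factor a * normalize a = a"
    by (cases "gRe a" "0 :: int" rule: linorder_cases;
        cases "gIm a" "0 :: int" rule: linorder_cases)
      (simp_all add: unit_factor_gint_def normalize_gint_def gint_eq_iff)
  show "normalize (0 :: gint) = 0" by (simp add: normalize_gint_def)
qed

end

text \<open>No library class provides \<^const>\<open>cong\<close> for the Gaussian integers.\<close>

definition gcong :: "gint \<Rightarrow> gint \<Rightarrow> gint \<Rightarrow> bool" where
  "gcong m x y \<longleftrightarrow> m dvd x - y"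

definition gt :: gint where "gt = 1 + gi"

definition primary :: "gint \<Rightarrow> bool" where
  "primary x \<longleftrightarrow> gcong (gt ^ 3) x 1"

text \<open>The exponents of a primary Gaussian integer, represented in \<open>{0..<8}\<close>.\<close>

definition mn_exponents :: "gint \<Rightarrow> nat \<times> nat" where
  "mn_exponents x = (THE mn. fst mn < 8 \<and> snd mn < 8 \<and>
     gcong (gt ^ 9) x ((1 - 4 * gi) ^ fst mn * (- 1 - 6 * gi) ^ snd mn))"

definition m_exp :: "gint \<Rightarrow> nat" where "m_exp x = fst (mn_exponents x)"

definition n_exp :: "gint \<Rightarrow> nat" where "n_exp x = snd (mn_exponents x)"


section \<open>Completions of the field of Gaussian numbers\<close>

type_synonym qi = "gint fract"

text \<open>The valuation at a prime element \<open>p\<close>; the value at \<open>0\<close> is not specified.\<close>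

definition pval :: "gint \<Rightarrow> qi \<Rightarrow> int" where
  "pval p x = (THE k. \<exists>a c. a \<noteq> 0 \<and> c \<noteq> 0 \<and> x = Fraction_Field.Fract a c \<and>
     k = int (multiplicity p a) - int (multiplicity p c))"

definition pabs :: "gint \<Rightarrow> qi \<Rightarrow> real" where
  "pabs p x = (if x = 0 then 0 else of_int (Nm p) powi (- pval p x))"

definition cauchy_seqs :: "gint \<Rightarrow> (nat \<Rightarrow> qi) set" where
  "cauchy_seqs p = {X. \<forall>e>0. \<exists>N. \<forall>m\<ge>N. \<forall>n\<ge>N. pabs p (X m - X n) < e}"

definition cauchy_ring :: "gint \<Rightarrow> (nat \<Rightarrow> qi) ring" where
  "cauchy_ring p = \<lparr>carrier = cauchy_seqs p,
     mult = (\<lambda>X Y n. X n * Y n), one = (\<lambda>n. 1),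
     zero = (\<lambda>n. 0), add = (\<lambda>X Y n. X n + Y n)\<rparr>"

definition null_seqs :: "gint \<Rightarrow> (nat \<Rightarrow> qi) set" where
  "null_seqs p = {X. (\<lambda>n. pabs p (X n)) \<longlonglongrightarrow> 0}"

definition completion :: "gint \<Rightarrow> (nat \<Rightarrow> qi) set ring" where
  "completion p = cauchy_ring p Quot null_seqs p"

definition to_completion :: "gint \<Rightarrow> qi \<Rightarrow> (nat \<Rightarrow> qi) set" where
  "to_completion p x = null_seqs p +>\<^bsub>cauchy_ring p\<^esub> (\<lambda>n. x)"

definition loc :: "gint \<Rightarrow> gint \<Rightarrow> (nat \<Rightarrow> qi) set" where
  "loc p a = to_completion p (to_fract a)"

definition completion_abs :: "gint \<Rightarrow> (nat \<Rightarrow> qi) set \<Rightarrow> real" where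
  "completion_abs p \<xi> = (THE l. \<forall>X\<in>\<xi>. (\<lambda>n. pabs p (X n)) \<longlonglongrightarrow> l)"

definition completion_ints :: "gint \<Rightarrow> (nat \<Rightarrow> qi) set ring" where
  "completion_ints p =
     (completion p)\<lparr>carrier := {\<xi> \<in> carrier (completion p). completion_abs p \<xi> \<le> 1}\<rparr>"

definition ring_cong :: "('a, 'm) ring_scheme \<Rightarrow> 'a \<Rightarrow> 'a \<Rightarrow> 'a \<Rightarrow> bool" where
  "ring_cong R m x y \<longleftrightarrow> x \<ominus>\<^bsub>R\<^esub> y \<in> PIdl\<^bsub>R\<^esub> m"


section \<open>The quartic symbol and the graph\<close>

text \<open>
  Congruence modulo \<open>p\<close> is taken in the local ring of \<open>p\<close>-integral elements of the field.
  The factor \<open>p powi (- pval p \<alpha>)\<close> is \<open>1\<close> if \<open>\<alpha>\<close> is a \<open>p\<close>-adic unit, so that the definition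
  for units and its extension to all nonzero \<open>\<alpha>\<close> are covered by one formula.
\<close>

definition quartic :: "gint \<Rightarrow> qi \<Rightarrow> gint" where
  "quartic p \<alpha> = (THE \<zeta>. \<zeta> \<in> {1, gi, - 1, - gi} \<and>
     pabs p ((\<alpha> * to_fract p powi (- pval p \<alpha>)) ^ nat ((Nm p - 1) div 4) - to_fract \<zeta>) < 1)"

text \<open>
  Classes in \<open>\<int>/4\<close> are represented by integers, with equality replaced by congruence;
  \<open>log_gi\<close> takes the representative in \<open>{0..<4}\<close>.
\<close>

definition log_gi :: "gint \<Rightarrow> int" where
  "log_gi \<zeta> = int (THE k. k < 4 \<and> gi ^ k = \<zeta>)"

definition weight :: "gint \<Rightarrow> gint \<Rightarrow> int" where
  "weight v w = (if v = w then 0 else log_gi (quartic v (to_fract w)))"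

definition deg :: "gint set \<Rightarrow> gint \<Rightarrow> int" where
  "deg V v = (\<Sum>w\<in>V. weight v w)"

definition deg_exp :: "gint set \<Rightarrow> gint \<Rightarrow> nat \<Rightarrow> gint \<Rightarrow> int" where
  "deg_exp V b k v = (\<Sum>w\<in>{w \<in> V. multiplicity w b = k}. weight v w)"

definition laplacian :: "gint set \<Rightarrow> gint \<Rightarrow> gint \<Rightarrow> int" where
  "laplacian V v w = (if v = w then deg V v else 0) - weight v w"

text \<open>
  The matrices below are indexed by vertices: \<open>P\<close> and \<open>Q\<close> are the sets of the
  primes \<open>\<pp>\<^sub>i\<close> and \<open>\<qq>\<^sub>j\<close>, \<open>s = s\<^sub>b\<close> and \<open>t = t\<^sub>b\<close>. Deleting rows and columns
  leaves the entries alone and shrinks the index set to \<open>index2\<close>; all degrees are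
  those of the full graph.
\<close>

definition L1 :: "gint set \<Rightarrow> gint \<Rightarrow> gint \<Rightarrow> bit" where
  "L1 V v w = of_int (laplacian V v w)"

definition index2 :: "gint set \<Rightarrow> gint set \<Rightarrow> gint \<Rightarrow> nat \<Rightarrow> nat \<Rightarrow> gint set" where
  "index2 P Q b s t = (P \<union> Q) -
     {q \<in> Q. \<not> [deg_exp (P \<union> Q) b 1 q + deg_exp (P \<union> Q) b 3 q
                  = int (m_exp q * t + n_exp q * s)] (mod 2)}"

definition L3 :: "gint set \<Rightarrow> gint set \<Rightarrow> gint \<Rightarrow> nat \<Rightarrow> nat \<Rightarrow> gint \<Rightarrow> gint \<Rightarrow> bit" where
  "L3 P Q b s t v w = L1 (P \<union> Q) v w +
     (if v = w \<and> v \<in> P \<and>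
         \<not> [deg_exp (P \<union> Q) b 2 v = int (m_exp v * t + n_exp v * s)] (mod 2)
      then 1 else 0)"

definition L' :: "gint set \<Rightarrow> gint set \<Rightarrow> gint \<Rightarrow> nat \<Rightarrow> nat \<Rightarrow> gint \<Rightarrow> gint \<Rightarrow> bit" where
  "L' P Q b s t v w = L3 P Q b s t v w +
     (if v = w \<and> v \<in> Q \<and>
         [deg_exp (P \<union> Q) b 1 v + 3 * deg_exp (P \<union> Q) b 3 v
            = int (m_exp v * t + n_exp v * s + 2 * (n_exp v + 1))] (mod 4)
      then 1 else 0)"


section \<open>The Selmer group\<close>

text \<open>
  Homogeneous coordinate vectors, over the completion at \<open>p\<close>, of the points of
  \<open>C\<^sub>d: d X\<^sub>2\<^sup>2 = d\<^sup>2 X\<^sub>0\<^sup>2 - 4 b X\<^sub>3\<^sup>2, X\<^sub>1\<^sup>2 = X\<^sub>0 X\<^sub>3\<close> in projective 3-space.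
\<close>

definition C_points :: "gint \<Rightarrow> gint \<Rightarrow> gint \<Rightarrow>
    ((nat \<Rightarrow> qi) set \<times> (nat \<Rightarrow> qi) set \<times> (nat \<Rightarrow> qi) set \<times> (nat \<Rightarrow> qi) set) set" where
  "C_points b d p = (let K = completion p in
     {(X0, X1, X2, X3).
        X0 \<in> carrier K \<and> X1 \<in> carrier K \<and> X2 \<in> carrier K \<and> X3 \<in> carrier K \<and>
        (X0, X1, X2, X3) \<noteq> (\<zero>\<^bsub>K\<^esub>, \<zero>\<^bsub>K\<^esub>, \<zero>\<^bsub>K\<^esub>, \<zero>\<^bsub>K\<^esub>) \<and>
        loc p d \<otimes>\<^bsub>K\<^esub> X2 [^]\<^bsub>K\<^esub> (2::nat) =
          loc p (d ^ 2) \<otimes>\<^bsub>K\<^esub> X0 [^]\<^bsub>K\<^esub> (2::nat)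
            \<ominus>\<^bsub>K\<^esub> loc p (4 * b) \<otimes>\<^bsub>K\<^esub> X3 [^]\<^bsub>K\<^esub> (2::nat) \<and>
        X1 [^]\<^bsub>K\<^esub> (2::nat) = X0 \<otimes>\<^bsub>K\<^esub> X3})"

definition square_class :: "qi \<Rightarrow> qi set" where
  "square_class x = {x * y ^ 2 | y. y \<noteq> 0}"

text \<open>
  The \<open>\<phi>\<close>-Selmer group of \<open>E\<^sub>b: y\<^sup>2 = x\<^sup>3 + b x\<close>, as a set of square classes. The
  places dividing \<open>2 b\<close> are given by the prime elements \<open>p\<close> dividing \<open>2 b\<close>, where associated
  elements \<open>p\<close> define the same place.
\<close>

definition selmer_phi :: "gint \<Rightarrow> qi set set" where
  "selmer_phi b = {square_class (to_fract d) | d.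
     d dvd 2 * b \<and> (\<forall>p. prime_elem p \<and> p dvd 2 * b \<longrightarrow> C_points b d p \<noteq> {})}"

end

(*
  As -4 = t^4 for t = 1 + i, the curve C_d is d w^2 = d^2 x^4 + b z^4 up to scaling, and by Newton
  iteration for square roots a point over the completion at p exists as soon as the equation holds
  modulo a power of p slightly higher than the one dividing d w^2. At a primary prime p this
  amounts to conditions on the valuations of b and d at p, on the quadratic characters of their
  p-free parts b' and d', and, when p^2 exactly divides b and p divides d, on the quartic character
  of -b' d'^2. The character of b' is the sum of the edge weights at p plus the contributions of i
  and t; those are the supplementary laws [i/p] = i^n and [t/p] = i^m. For prime norm the law for t
  follows from a + b = a t modulo p = a + b i together with the quartic character of rational
  integers n at p. The latter depends only on p modulo n; as in the classical proof, raising a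
  quartic Gauss sum to the power of an odd rational prime q relates it to p^2 Nm(p)
  modulo q. Comparing residues modulo 4 turns the conditions at the primary primes into the
  linear system, and the condition at t is a finite congruence computation.
*)
theory Submission
  imports Defs "HOL-Number_Theory.Number_Theory" "HOL-Algebra.Multiplicative_Group"
    "HOL-Algebra.Subrings"
begin

section \<open>Gaussian integers\<close>

text \<open>The supplement for \<open>gi\<close> is a mere power of \<open>gi\<close>; the one for
  \<open>gt\<close> is the obstacle, since \<open>gt\<close> has to be traded for rational integers.
  Their symbols rest on the Jacobi sum of the quartic character: it has the norm of
  \<open>p\<close>, is divisible by \<open>p\<close> and is 1 modulo 2. For primary \<open>p\<close>
  this determines it up to sign, and the sign disappears in the fourth power of the Gauss sum. At an
  inert prime -q Frobenius is conjugation and gives the symbol of \<open>gt\<close> directly. The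
  completion is left early: a point yields congruences of unbounded precision, one congruence with
  control over d w^2 yields a point, and everything between these two facts is divisibility in Z[i].
  A deleted vertex is a prime q with exponent 2 in b at which b' is not a square. No fourth root of
  -b' d'^2 exists there, so q cannot divide d; if it does not, the place imposes nothing. The
  equation on the remaining vertices therefore has to be read together with the requirement that all
  primes of d remain, which is \<open>Vd \<subseteq> V'\<close> in the theorem.\<close>

lemma gRe_of_int [simp]: "gRe (of_int n) = n" and gIm_of_int [simp]: "gIm (of_int n) = 0"
proof -
  have nat: "gRe (of_nat k) = int k \<and> gIm (of_nat k) = 0" for k
    by (induction k) simp_all
  have "gRe (of_int n) = n \<and> gIm (of_int n) = 0"
    by (cases n rule: int_diff_cases) (simp add: nat)
  then show "gRe (of_int n) = n" "gIm (of_int n) = 0" by simp_all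
qed

lemma gRe_of_nat [simp]: "gRe (of_nat n) = int n" and gIm_of_nat [simp]: "gIm (of_nat n) = 0"
  using gRe_of_int[of "int n"] gIm_of_int[of "int n"] by simp_all

lemma gRe_numeral [simp]: "gRe (numeral n) = numeral n" and gIm_numeral [simp]: "gIm (numeral n) = 0"
  using gRe_of_int[of "numeral n"] gIm_of_int[of "numeral n"] by simp_all

lemma gt_simps [simp]: "gRe gt = 1" "gIm gt = 1"
  by (simp_all add: gt_def)

lemma gint_decomp: "x = of_int (gRe x) + gi * of_int (gIm x)"
  by (simp add: gint_eq_iff)

lemma gt_power2: "gt ^ 2 = 2 * gi" and gt_power4: "gt ^ 4 = - 4"
  by (simp_all add: gint_eq_iff numeral_eq_Suc)

lemma two_eq_gt: "(2 :: gint) = - (gi * gt ^ 2)"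
  by (simp add: gint_eq_iff numeral_eq_Suc)

lemma of_int_dvd_gint_iff: "of_int n dvd x \<longleftrightarrow> n dvd gRe x \<and> n dvd gIm x"
proof
  assume "of_int n dvd x"
  then obtain y where "x = of_int n * y" ..
  then show "n dvd gRe x \<and> n dvd gIm x" by simp
next
  assume "n dvd gRe x \<and> n dvd gIm x"
  then obtain a b where "gRe x = n * a" "gIm x = n * b" by (auto elim!: dvdE)
  then have "x = of_int n * GInt a b" by (simp add: gint_eq_iff)
  then show "of_int n dvd x" ..
qed

lemma gcnj_mult [simp]: "gcnj (x * y) = gcnj x * gcnj y"
  and gcnj_add [simp]: "gcnj (x + y) = gcnj x + gcnj y"
  and gcnj_minus [simp]: "gcnj (- x) = - gcnj x"
  and gcnj_diff [simp]: "gcnj (x - y) = gcnj x - gcnj y"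
  and gcnj_gcnj [simp]: "gcnj (gcnj x) = x"
  and gcnj_of_int [simp]: "gcnj (of_int n) = of_int n"
  and gcnj_0 [simp]: "gcnj 0 = 0"
  and gcnj_1 [simp]: "gcnj 1 = 1"
  and gcnj_gi [simp]: "gcnj gi = - gi"
  by (simp_all add: gint_eq_iff)

lemma gcnj_power [simp]: "gcnj (x ^ n) = gcnj x ^ n"
  by (induction n) simp_all

lemma gcnj_sum: "gcnj (sum f A) = (\<Sum>x\<in>A. gcnj (f x))"
  by (induction A rule: infinite_finite_induct) simp_all

lemma mult_gcnj: "x * gcnj x = of_int (Nm x)"
  by (simp add: gint_eq_iff Nm_def power2_eq_square)

lemma Nm_of_int [simp]: "Nm (of_int n) = n\<^sup>2"
  by (simp add: Nm_def)

lemma Nm_1 [simp]: "Nm 1 = 1"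
  by (simp add: Nm_def)

lemma Nm_dvd: "x dvd y \<Longrightarrow> Nm x dvd Nm y"
  by (auto elim!: dvdE simp: Nm_mult)

lemma gint_unit_iff_Nm: "x dvd 1 \<longleftrightarrow> Nm x = 1"
proof
  assume "Nm x = 1"
  then have "1 = x * gcnj x" by (simp add: mult_gcnj)
  then show "x dvd 1" ..
qed (use Nm_dvd[of x 1] zdvd1_eq[of "Nm x"] in simp)

lemma gi_power4 [simp]: "gi ^ 4 = 1"
  by (simp add: gint_eq_iff numeral_eq_Suc)

lemma gi_power2: "gi ^ 2 = - 1"
  by (simp add: power2_eq_square)

lemma gi_power_mod: "gi ^ n = gi ^ (n mod 4)"
proof -
  have "gi ^ n = gi ^ (4 * (n div 4) + n mod 4)" by simp
  also have "\<dots> = gi ^ (n mod 4)" unfolding power_add power_mult by simp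
  finally show ?thesis .
qed

lemma gi_power_unit: "gi ^ n dvd 1"
  by (meson gi_dvd_1 is_unit_power_iff)

lemma gi_power_eq_iff: "gi ^ m = gi ^ n \<longleftrightarrow> [m = n] (mod 4)"
proof -
  have "gi ^ m = gi ^ n \<longleftrightarrow> m = n" if "m < 4" "n < 4" for m n :: nat
  proof -
    have "m \<in> {0,1,2,3}" "n \<in> {0,1,2,3}" using that by auto
    then show ?thesis by (auto simp: gint_eq_iff numeral_eq_Suc)
  qed
  from this[of "m mod 4" "n mod 4"] show ?thesis
    using gi_power_mod[of m] gi_power_mod[of n] by (simp add: unique_euclidean_semiring_class.cong_def)
qed

lemma gint_units_eq: "{u. u dvd (1::gint)} = (\<lambda>k. gi ^ k) ` {..<4::nat}"
proof -
  have "(\<lambda>k. gi ^ k) ` {..<4::nat} = {1, gi, -1, -gi}"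
    by (auto simp: numeral_eq_Suc lessThan_Suc)
  moreover have "u dvd 1 \<longleftrightarrow> u \<in> {1, gi, -1, -gi}" for u :: gint
  proof
    show "u dvd 1 \<Longrightarrow> u \<in> {1, gi, -1, -gi}" using gint_unit_cases[of u] by blast
    show "u \<in> {1, gi, -1, -gi} \<Longrightarrow> u dvd 1" by (elim insertE) simp_all
  qed
  ultimately show ?thesis by blast
qed

lemma gint_unit_power: assumes "u dvd (1::gint)" obtains k :: nat where "k < 4" "u = gi ^ k"
  using assms gint_units_eq by blast

lemma gt_nonzero [simp]: "gt \<noteq> 0"
  by (simp add: gint_eq_iff)

lemma gt_dvd_iff: "gt dvd x \<longleftrightarrow> even (gRe x + gIm x)"
proof
  assume "even (gRe x + gIm x)"
  then obtain k where "gRe x + gIm x = 2 * k" ..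
  then have "x = gt * GInt k (k - gRe x)" by (simp add: gint_eq_iff)
  then show "gt dvd x" ..
next
  assume "gt dvd x"
  then obtain y where "x = gt * y" ..
  then have "gRe x + gIm x = 2 * gRe y" by simp
  then show "even (gRe x + gIm x)" by simp
qed

lemma prime_elem_gt: "prime_elem gt"
proof (rule prime_elemI)
  show "\<not> gt dvd 1" by (simp add: gt_dvd_iff)
  fix a b assume "gt dvd a * b"
  then show "gt dvd a \<or> gt dvd b" by (auto simp: gt_dvd_iff)
qed simp

lemma gt_dvd_2: "gt dvd 2"
  by (simp add: gt_dvd_iff)

text \<open>Multiplying \<open>u\<close> by \<open>gi\<close> changes the sign of its square, so one
  may take \<open>u = 1 + gt ^ 2 * z\<close>. Then \<open>2 = - (gi * gt ^ 2)\<close> gives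
  \<open>u ^ 2 - 1 = gt ^ 4 * (z * (z - gi))\<close>, and \<open>z\<close>, \<open>z - gi\<close>
  have opposite parity.\<close>

lemma gt_odd_square:
  assumes "\<not> gt dvd u"
  obtains e where "e \<in> {1, -1}" "gt ^ 5 dvd u\<^sup>2 - e"
proof -
  have *: "gt ^ 5 dvd u\<^sup>2 - 1" if "gt ^ 2 dvd u - 1" for u
  proof -
    from that obtain z where "u - 1 = gt ^ 2 * z" ..
    then have u: "u = 1 + gt ^ 2 * z" by (simp add: algebra_simps)
    have "u\<^sup>2 - 1 = 2 * gt ^ 2 * z + gt ^ 4 * z\<^sup>2"
      unfolding u by (simp add: power2_eq_square numeral_eq_Suc algebra_simps)
    also have "\<dots> = gt ^ 4 * (z * (z - gi))"
      by (subst two_eq_gt) (simp add: power2_eq_square numeral_eq_Suc algebra_simps)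
    also have "gt dvd z * (z - gi)" by (auto simp: gt_dvd_iff)
    then have "gt ^ 4 * gt dvd gt ^ 4 * (z * (z - gi))" by (rule mult_dvd_mono[OF dvd_refl])
    finally show ?thesis by (simp add: numeral_eq_Suc algebra_simps)
  qed
  have "gt dvd u - 1" using assms by (simp add: gt_dvd_iff)
  then obtain y where y: "u - 1 = gt * y" ..
  show thesis
  proof (cases "gt dvd y")
    case True
    then have "gt ^ 2 dvd u - 1" unfolding y power2_eq_square by (rule mult_dvd_mono[OF dvd_refl])
    then show thesis by (rule that[OF insertI1 *])
  next
    case False
    then have "gt dvd y + 1" by (simp add: gt_dvd_iff)
    have "gi * u - 1 = gi * (u - 1) + (gi - 1)" by (simp add: algebra_simps)
    also have "\<dots> = gt * (gi * (y + 1))" unfolding y by (simp add: gint_eq_iff)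
    finally have "gt ^ 2 dvd gi * u - 1" using \<open>gt dvd y + 1\<close>
      by (simp add: power2_eq_square mult_dvd_mono)
    then have "gt ^ 5 dvd (gi * u)\<^sup>2 - 1" by (rule *)
    also have "(gi * u)\<^sup>2 - 1 = - (u\<^sup>2 - (-1))" by (simp add: power_mult_distrib gi_power2)
    finally show thesis by (intro that[of "-1"]) (simp_all only: dvd_minus_iff, simp)
  qed
qed

text \<open>The factors \<open>u ^ 2 - e\<close> and \<open>u ^ 2 + e\<close> differ by
  \<open>2 * e\<close>, which is \<open>gt ^ 2\<close> up to a unit: the exponent is 5 + 2.\<close>

lemma gt_odd_fourth_power:
  assumes "\<not> gt dvd u"
  shows "gt ^ 7 dvd u ^ 4 - 1"
proof -
  obtain e where e: "e \<in> {1, -1}" "gt ^ 5 dvd u\<^sup>2 - e" using gt_odd_square[OF assms] .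
  have "gt ^ 2 dvd u\<^sup>2 - e + 2 * e"
  proof (rule dvd_add)
    show "gt ^ 2 dvd u\<^sup>2 - e" using e(2) by (rule power_le_dvd) simp
    show "gt ^ 2 dvd 2 * e" by (subst two_eq_gt) simp
  qed
  then have "gt ^ 2 dvd u\<^sup>2 + e" by (simp add: algebra_simps)
  with e(2) have "gt ^ 5 * gt ^ 2 dvd (u\<^sup>2 - e) * (u\<^sup>2 + e)" by (rule mult_dvd_mono)
  moreover have "(u\<^sup>2 - e) * (u\<^sup>2 + e) = u ^ 4 - 1"
    using e(1) by (auto simp: algebra_simps power2_eq_square numeral_eq_Suc)
  ultimately show ?thesis by (simp flip: power_add)
qed

lemma int_square_mod_4: "(x :: int)\<^sup>2 mod 4 = (if even x then 0 else 1)"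
proof (cases "even x")
  case True
  then obtain y where "x = 2 * y" ..
  then have "x\<^sup>2 = 4 * y\<^sup>2" by (simp add: power2_eq_square)
  then show ?thesis using True by simp
next
  case False
  then obtain y where "x = 2 * y + 1" by (elim oddE)
  then have "x\<^sup>2 = 1 + 4 * (y * y + y)" by (simp add: power2_eq_square algebra_simps)
  also have "\<dots> mod 4 = 1" by (subst mod_mult_self2) simp
  finally show ?thesis using False by simp
qed

text \<open>\<open>p\<close> divides its norm, hence a rational prime \<open>q\<close>, and
  \<open>Nm p\<close> is \<open>q\<close> or \<open>q ^ 2\<close>. In the second case
  \<open>p\<close> is associated to \<open>q\<close>, and \<open>q mod 4 = 1\<close> is excluded by
  Euler's criterion: for a square root x of -1 modulo \<open>q\<close>, the prime \<open>q\<close>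
  would divide x + i or x - i.\<close>

lemma gint_prime_cases:
  assumes p: "prime_elem p" and odd: "\<not> gt dvd p"
  obtains (split) P where "prime P" "Nm p = P" "P mod 4 = 1"
  | (inert) q u where "prime q" "q mod 4 = 3" "u dvd 1" "p = u * of_int q" "Nm p = q\<^sup>2"
proof -
  have p0: "p \<noteq> 0" "\<not> p dvd 1" using p by auto
  have N1: "Nm p > 1" using p0 gint_unit_iff_Nm[of p] Nm_pos_iff[of p] by linarith
  have pN: "p dvd of_int (Nm p)" by (metis dvd_triv_left mult_gcnj)
  have "\<exists>q::nat. prime q \<and> p dvd of_nat q"
  proof -
    have "p dvd of_nat n \<Longrightarrow> n > 0 \<Longrightarrow> \<exists>q::nat. prime q \<and> p dvd of_nat q" for n :: nat
    proof (induction n rule: less_induct)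
      case (less n)
      show ?case
      proof (cases "n = 1")
        case True then show ?thesis using less.prems p0 by simp
      next
        case False
        then obtain q where q: "prime q" "q dvd n" using prime_factor_nat by blast
        then obtain m where m: "n = q * m" by blast
        then have "p dvd of_nat q \<or> p dvd of_nat m"
          using less.prems p by (simp add: prime_elem_dvd_mult_iff)
        moreover have "m < n" "m > 0" using less.prems prime_gt_1_nat[OF q(1)] unfolding m by simp_all
        ultimately show ?thesis using q less.IH by blast
      qed
    qed
    from this[of "nat (Nm p)"] show ?thesis using N1 pN by simp
  qed
  then obtain q0 :: nat where q0: "prime q0" "p dvd of_nat q0" by blast
  define q where "q = int q0"
  have q: "prime q" "p dvd of_int q" using q0 by (simp_all add: q_def)
  have "Nm p dvd q\<^sup>2" using Nm_dvd[OF q(2)] by simp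
  then obtain k where k: "k \<le> 2" "normalize (Nm p) = normalize (q ^ k)"
    using divides_primepow_weak[OF q(1), of "Nm p" 2] by blast
  have q_pos: "q > 0" using q(1) by (rule prime_gt_0_int)
  have k: "k \<le> 2" "Nm p = q ^ k" using k q_pos by simp_all
  have N_odd: "odd (Nm p)" using odd by (auto simp: gt_dvd_iff Nm_def)
  have N4: "Nm p mod 4 = 1"
  proof -
    have "Nm p mod 4 = ((gRe p)\<^sup>2 mod 4 + (gIm p)\<^sup>2 mod 4) mod 4"
      unfolding Nm_def by (simp add: mod_add_eq)
    then show ?thesis using odd by (auto simp: gt_dvd_iff int_square_mod_4)
  qed
  have "k = 1 \<or> k = 2" using k N1 by (cases "k = 0") auto
  then show thesis
  proof
    assume "k = 1"
    then show thesis using q k N4 by (intro split) auto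
  next
    assume k2: "k = 2"
    obtain s where s: "of_int q = p * s" using q(2) ..
    have "q\<^sup>2 = Nm p * Nm s" using arg_cong[OF s, of Nm] by (simp add: Nm_mult)
    then have "Nm s = 1" using k k2 q by auto
    then have su: "s dvd 1" by (simp add: gint_unit_iff_Nm)
    then obtain u where u: "1 = s * u" by blast
    have pu: "p = u * of_int q" using u s by (metis mult.assoc mult.commute mult_1_right)
    have uu: "u dvd 1" using u by (metis dvd_triv_right)
    have "q mod 4 = 3"
    proof (rule ccontr)
      assume "q mod 4 \<noteq> 3"
      moreover have "odd q" using N_odd k k2 by simp
      ultimately have q4: "q mod 4 = 1" by presburger
      have "q > 2" using q \<open>odd q\<close> prime_ge_2_int[of q] by (cases "q = 2") auto
      then have "[Legendre (-1) q = (-1) ^ ((nat q - 1) div 2)] (mod q)"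
        using euler_criterion[of "nat q" "-1"] q by simp
      moreover have "even ((nat q - 1) div 2)"
      proof -
        define k where "k = q div 4"
        have "q = 4 * k + 1" using q4 by (simp add: k_def) (metis mult_div_mod_eq)
        then have "(nat q - 1) div 2 = 2 * nat k" using q_pos by linarith
        then show ?thesis by simp
      qed
      ultimately have "[Legendre (-1) q = 1] (mod q)" by simp
      then have "QuadRes q (-1)" using \<open>q > 2\<close>
        by (auto simp: Legendre_def cong_iff_dvd_diff split: if_splits dest!: zdvd_imp_le)
      then obtain x where "[x\<^sup>2 = -1] (mod q)" by (auto simp: QuadRes_def)
      then have "q dvd x\<^sup>2 + 1" by (simp add: cong_iff_dvd_diff)
      then have "(of_int q :: gint) dvd of_int (x\<^sup>2 + 1)" by (simp only: of_int_dvd_gint_iff gRe_of_int gIm_of_int dvd_0_right)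
      also have "of_int (x\<^sup>2 + 1) = (of_int x + gi) * (of_int x - gi)"
        by (simp add: gint_eq_iff power2_eq_square)
      finally have "p dvd (of_int x + gi) * (of_int x - gi)" using q(2) dvd_trans by blast
      then have "p dvd of_int x + gi \<or> p dvd of_int x - gi"
        using p by (simp add: prime_elem_dvd_mult_iff)
      moreover have "of_int q dvd p" unfolding pu by simp
      ultimately have "of_int q dvd of_int x + gi \<or> of_int q dvd of_int x - gi"
        using dvd_trans by blast
      then have "q dvd 1" by (auto simp: of_int_dvd_gint_iff)
      then show False using \<open>q > 2\<close> by auto
    qed
    then show thesis using q uu pu k k2 by (intro inert) auto
  qed
qed

section \<open>Residue fields of the odd primes\<close>

lemma dvd_power_minus_1: "d dvd x ^ n - 1" if "d dvd x - 1" for d x :: "'a :: comm_ring_1"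
proof -
  have "x - 1 dvd x ^ n - 1 ^ n" by (metis dvd_triv_left power_diff_sumr2)
  then show ?thesis using that dvd_trans by auto
qed

lemma dvd_power_diff: "d dvd x ^ n - y ^ n" if "d dvd x - y" for d x y :: "'a :: comm_ring_1"
  using that by (metis dvd_triv_left power_diff_sumr2 dvd_trans)

text \<open>For p = a + b i of prime norm, b is invertible modulo the norm, and i is congruent to
  the rational integer -a / b.\<close>

lemma gint_split_residue:
  assumes p: "prime_elem p" and P: "prime (Nm p)"
  obtains n :: int where "p dvd x - of_int n"
proof -
  define P where "P = Nm p"
  have P0: "P > 0" using P by (simp add: P_def prime_gt_0_int)
  have pP: "p dvd of_int P" unfolding P_def by (metis dvd_triv_left mult_gcnj)
  have "\<not> P dvd gIm p"
  proof
    assume *: "P dvd gIm p"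
    have "(gRe p)\<^sup>2 = P - gIm p * gIm p" by (simp add: P_def Nm_def power2_eq_square)
    then have "P dvd (gRe p)\<^sup>2" using * by simp
    then have "P dvd gRe p" using P unfolding P_def by (rule prime_dvd_power[rotated])
    with * have "of_int P dvd p" by (simp add: of_int_dvd_gint_iff)
    then have "P\<^sup>2 dvd P" using Nm_dvd[of "of_int P" p] by (simp add: P_def)
    then have "P dvd 1" using P0 by (simp add: power2_eq_square)
    then show False using P unfolding P_def by (metis not_prime_unit)
  qed
  then have "coprime (gIm p) P" using P unfolding P_def by (metis coprime_commute prime_imp_coprime)
  then obtain b' where b': "[gIm p * b' = 1] (mod P)" using cong_solve_coprime_int by blast
  have i: "p dvd gi - of_int (- gRe p * b')"
  proof -
    obtain k where k: "gIm p * b' - 1 = P * k" using b' by (auto simp: cong_iff_dvd_diff)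
    have "p * of_int b' = of_int (gRe p * b') + gi * of_int (gIm p * b')"
      by (subst gint_decomp[of p]) (simp add: algebra_simps)
    also have "gIm p * b' = 1 + P * k" using k by simp
    finally have "gi - of_int (- gRe p * b') = p * of_int b' - of_int P * (gi * of_int k)"
      by (simp add: algebra_simps)
    then show ?thesis using pP by (metis dvd_diff dvd_mult2 dvd_triv_left)
  qed
  have "x - of_int (gRe x + gIm x * (- gRe p * b')) = of_int (gIm x) * (gi - of_int (- gRe p * b'))"
    by (subst (1) gint_decomp[of x]) (simp add: algebra_simps)
  then have "p dvd x - of_int (gRe x + gIm x * (- gRe p * b'))" using i by simp
  then show thesis by (rule that)
qed

lemma gint_residue_system:
  assumes p: "prime_elem p" and odd: "\<not> gt dvd p"
  obtains C where "finite C" "card C = nat (Nm p)" "\<And>x. \<exists>c\<in>C. p dvd x - c"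
    "\<And>c c'. c \<in> C \<Longrightarrow> c' \<in> C \<Longrightarrow> p dvd c - c' \<Longrightarrow> c = c'"
  using p odd
proof (cases rule: gint_prime_cases)
  case (split P)
  have P0: "P > 0" using split by (simp add: prime_gt_0_int)
  have pP: "p dvd of_int P" by (metis dvd_triv_left mult_gcnj split(2))
  define C where "C = (of_int :: int \<Rightarrow> gint) ` {0..<P}"
  have inj: "inj_on (of_int :: int \<Rightarrow> gint) A" for A by (rule inj_onI) (metis gRe_of_int)
  show thesis
  proof (rule that[of C])
    show "finite C" by (simp add: C_def)
    show "card C = nat (Nm p)" by (simp add: C_def card_image[OF inj] split(2))
    show "\<exists>c\<in>C. p dvd x - c" for x
    proof -
      have "prime (Nm p)" using split by simp
      then obtain n where "p dvd x - of_int n" by (rule gint_split_residue[OF p])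
      moreover have "p dvd of_int (n - n mod P)"
        using pP by (metis dvd_trans dvd_minus_mod of_int_dvd_gint_iff gIm_of_int gRe_of_int dvd_0_right)
      ultimately have "p dvd (x - of_int n) + of_int (n - n mod P)" by (rule dvd_add)
      then have "p dvd x - of_int (n mod P)" by simp
      moreover have "of_int (n mod P) \<in> C" using P0 by (auto simp: C_def)
      ultimately show ?thesis by blast
    qed
    fix c c' assume "c \<in> C" "c' \<in> C" "p dvd c - c'"
    then obtain k k' where k: "c = of_int k" "c' = of_int k'" "0 \<le> k" "k < P" "0 \<le> k'" "k' < P"
      by (auto simp: C_def)
    then have "p dvd of_int (k - k')" using \<open>p dvd c - c'\<close> by simp
    then have "P dvd (k - k')\<^sup>2" using Nm_dvd[of p "of_int (k - k')"] by (simp only: split(2) Nm_of_int)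
    then have "P dvd k - k'" using split(1) prime_dvd_power by blast
    then show "c = c'" using k by (metis mod_eq_dvd_iff mod_pos_pos_trivial)
  qed
next
  case (inert q u)
  have q0: "q > 0" using inert by (simp add: prime_gt_0_int)
  obtain u' where u': "1 = u * u'" using inert(3) ..
  have p_dvd: "p dvd x \<longleftrightarrow> q dvd gRe x \<and> q dvd gIm x" for x
    using inert(3,4) by (simp add: of_int_dvd_gint_iff[symmetric] mult_unit_dvd_iff')
  define C where "C = (\<lambda>(a, b). GInt a b) ` ({0..<q} \<times> {0..<q})"
  show thesis
  proof (rule that[of C])
    show "finite C" by (simp add: C_def)
    have inj: "inj_on (\<lambda>(a, b). GInt a b) A" for A by (auto simp: inj_on_def)
    show "card C = nat (Nm p)"
      using q0 unfolding C_def card_image[OF inj] inert(5)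
      by (simp add: card_cartesian_product power2_eq_square nat_mult_distrib)
    show "\<exists>c\<in>C. p dvd x - c" for x
      by (rule bexI[of _ "GInt (gRe x mod q) (gIm x mod q)"])
        (use q0 in \<open>auto simp: p_dvd C_def\<close>)
    fix c c' assume "c \<in> C" "c' \<in> C" "p dvd c - c'"
    then show "c = c'" by (auto simp: C_def p_dvd mod_eq_dvd_iff[symmetric])
  qed
qed

text \<open>Z[i] as an explicit ring record: its quotient by \<open>p\<close> is then a finite field
  to which the cyclicity of the multiplicative group applies.\<close>

definition gring :: "gint ring" where
  "gring = \<lparr>carrier = UNIV, mult = (*), one = 1, zero = 0, add = (+)\<rparr>"

lemma gring_simps [simp]:
  "carrier gring = UNIV" "x \<otimes>\<^bsub>gring\<^esub> y = x * y" "\<one>\<^bsub>gring\<^esub> = 1"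
  "\<zero>\<^bsub>gring\<^esub> = 0" "x \<oplus>\<^bsub>gring\<^esub> y = x + y"
  by (simp_all add: gring_def)

lemma cring_gring: "cring gring"
proof (rule cringI)
  show "abelian_group gring"
    by (rule abelian_groupI) (auto simp: algebra_simps intro: exI[of _ "- x" for x])
  show "Group.comm_monoid gring"
    by (rule comm_monoidI) (auto simp: algebra_simps)
qed (simp add: algebra_simps)

lemma a_inv_gring [simp]: "\<ominus>\<^bsub>gring\<^esub> y = - y"
proof -
  interpret cring gring by (rule cring_gring)
  show ?thesis by (rule minus_equality) simp_all
qed

lemma a_minus_gring [simp]: "x \<ominus>\<^bsub>gring\<^esub> y = x - y"
  by (simp add: a_minus_def)

text \<open>Cyclicity of the multiplicative group of the residue field, phrased by divisibility so
  that the quotient ring stays inside this proof.\<close>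

lemma gint_residue_generator:
  assumes p: "prime_elem p" and odd: "\<not> gt dvd p"
  obtains g where "\<And>x. \<not> p dvd x \<Longrightarrow> \<exists>k. p dvd x - g ^ k"
    "\<And>k. p dvd g ^ k - 1 \<longleftrightarrow> nat (Nm p - 1) dvd k"
proof -
  interpret Z: cring gring by (rule cring_gring)
  define J where "J = {x. p dvd x}"
  have J: "ideal J gring"
  proof (rule idealI)
    show "subgroup J (add_monoid gring)"
    proof (rule group.subgroupI)
      show "Group.group (add_monoid gring)" by (rule Z.add.is_group)
      show "J \<noteq> {}" by (auto simp: J_def)
      fix a assume "a \<in> J"
      moreover have "inv\<^bsub>add_monoid gring\<^esub> a = - a"
        using a_inv_gring[of a] unfolding a_inv_def by simp
      ultimately show "inv\<^bsub>add_monoid gring\<^esub> a \<in> J" by (simp add: J_def)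
    qed (auto simp: J_def)
  qed (auto simp: J_def Z.ring_axioms)
  interpret J: ideal J gring by (rule J)
  define Q where "Q = gring Quot J"
  define cl where "cl x = J +>\<^bsub>gring\<^esub> x" for x
  have cl_eq: "cl x = cl y \<longleftrightarrow> p dvd x - y" for x y
    using Z.quotient_eq_iff_same_a_r_cos[OF J, of x y] by (auto simp: cl_def J_def)
  have cQ: "carrier Q = range cl"
    by (auto simp: Q_def FactRing_def A_RCOSETS_def' cl_def)
  have mQ: "cl x \<otimes>\<^bsub>Q\<^esub> cl y = cl (x * y)" for x y
    unfolding Q_def cl_def FactRing_def by (simp add: J.rcoset_mult_add)
  have oQ: "\<one>\<^bsub>Q\<^esub> = cl 1" by (simp add: Q_def cl_def FactRing_def)
  have zQ: "\<zero>\<^bsub>Q\<^esub> = cl 0"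
    unfolding Q_def cl_def FactRing_def using Z.a_coset_add_zero[of J] J.a_subset
    by (simp add: Z.a_rcos_zero[OF J] J.a_subset)
  obtain C where C: "finite C" "card C = nat (Nm p)" "\<And>x. \<exists>c\<in>C. p dvd x - c"
    "\<And>c c'. c \<in> C \<Longrightarrow> c' \<in> C \<Longrightarrow> p dvd c - c' \<Longrightarrow> c = c'"
    using gint_residue_system[OF p odd] by blast
  have bij: "bij_betw cl C (carrier Q)"
  proof (rule bij_betw_imageI)
    show "inj_on cl C" by (rule inj_onI) (simp add: cl_eq C(4))
    have "cl x \<in> cl ` C" for x
      using C(3)[of x] cl_eq by blast
    then show "cl ` C = carrier Q" by (auto simp: cQ)
  qed
  have fin: "finite (carrier Q)" using bij C(1) bij_betw_finite by blast
  have card: "card (carrier Q) = nat (Nm p)" using bij C(2) bij_betw_same_card by metis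
  \<comment> \<open>Multiplication by a nonzero class is injective on a finite set, hence onto; this
    yields inverses.\<close>
  have inv: "\<exists>y. p dvd x * y - 1" if x: "\<not> p dvd x" for x
  proof -
    have "inj_on (\<lambda>c. c \<otimes>\<^bsub>Q\<^esub> cl x) (carrier Q)"
    proof (rule inj_onI)
      fix c c' assume "c \<in> carrier Q" "c' \<in> carrier Q" "c \<otimes>\<^bsub>Q\<^esub> cl x = c' \<otimes>\<^bsub>Q\<^esub> cl x"
      moreover from this obtain y y' where y: "c = cl y" "c' = cl y'" by (auto simp: cQ)
      ultimately have "c = cl y" "c' = cl y'" "p dvd (y - y') * x"
        by (auto simp: mQ cl_eq algebra_simps)
      then show "c = c'" using x prime_elem_dvd_mult_iff[OF p, of "y - y'" x] cl_eq[of y y'] by simp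
    qed
    moreover have "(\<lambda>c. c \<otimes>\<^bsub>Q\<^esub> cl x) ` carrier Q \<subseteq> carrier Q" by (auto simp: cQ mQ)
    ultimately have "(\<lambda>c. c \<otimes>\<^bsub>Q\<^esub> cl x) ` carrier Q = carrier Q"
      using fin by (simp add: endo_inj_surj)
    then have "cl 1 \<in> (\<lambda>c. c \<otimes>\<^bsub>Q\<^esub> cl x) ` carrier Q" by (simp add: cQ)
    then obtain y where "cl (y * x) = cl 1" by (auto simp: cQ mQ)
    then show ?thesis by (auto simp: cl_eq mult.commute)
  qed
  interpret Q: cring Q unfolding Q_def by (rule J.quotient_is_cring[OF cring_gring])
  interpret Q: field Q
  proof (rule Q.cring_fieldI2)
    show "\<zero>\<^bsub>Q\<^esub> \<noteq> \<one>\<^bsub>Q\<^esub>" using p by (auto simp: zQ oQ cl_eq)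
    fix a assume a: "a \<in> carrier Q" "a \<noteq> \<zero>\<^bsub>Q\<^esub>"
    then obtain x where x: "a = cl x" by (auto simp: cQ)
    then have "\<not> p dvd x" using a(2) cl_eq[of x 0] by (simp add: zQ)
    with x show "\<exists>b\<in>carrier Q. a \<otimes>\<^bsub>Q\<^esub> b = \<one>\<^bsub>Q\<^esub>"
      using inv[of x] by (auto simp: cQ mQ oQ cl_eq)
  qed
  obtain a where a: "a \<in> carrier (mult_of Q)"
    "carrier (mult_of Q) = {a [^]\<^bsub>Q\<^esub> i | i::nat. i \<in> UNIV}"
    using Q.finite_field_mult_group_has_gen[OF fin] by blast
  then obtain g where g: "a = cl g" by (auto simp: cQ carrier_mult_of)
  have pw: "a [^]\<^bsub>Q\<^esub> i = cl (g ^ i)" for i :: nat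
    by (induction i) (auto simp: oQ mQ g mult.commute)
  have cM: "carrier (mult_of Q) = {cl x | x. \<not> p dvd x}"
    using cl_eq[of _ 0] by (auto simp: carrier_mult_of cQ zQ simp del: minus_apply)
  have g1: "\<exists>k. p dvd x - g ^ k" if "\<not> p dvd x" for x
  proof -
    have "cl x \<in> carrier (mult_of Q)" using that cM by blast
    then have "\<exists>i. cl x = cl (g ^ i)" unfolding a(2) pw by blast
    then show ?thesis by (simp only: cl_eq)
  qed
  have N: "order (mult_of Q) = nat (Nm p - 1)"
    using card fin Q.order_mult_of by (simp add: order_def nat_diff_distrib)
  interpret M: Group.group "mult_of Q" by (rule Q.field_mult_group)
  have pwM: "a [^]\<^bsub>mult_of Q\<^esub> i = cl (g ^ i)" for i :: nat
    by (simp add: pw nat_pow_mult_of)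
  have N1: "nat (Nm p - 1) > 0" using N fin M.order_gt_0_iff_finite by (metis Q.finite_mult_of)
  have gN: "p dvd g ^ nat (Nm p - 1) - 1"
    using M.pow_order_eq_1[OF a(1)] by (simp add: N pwM oQ cl_eq)
  have imp: "p dvd g ^ (n * nat (Nm p - 1)) - 1" for n
    using dvd_power_minus_1[OF gN, of n] by (simp add: mult.commute flip: power_mult)
  \<comment> \<open>If \<open>g ^ j\<close> were 1, the powers of \<open>g\<close> would fill at
    most \<open>j\<close> classes, but they have to fill all nonzero ones.\<close>
  have min: "nat (Nm p - 1) \<le> j" if "j > 0" "p dvd g ^ j - 1" for j
  proof -
    have "carrier (mult_of Q) \<subseteq> (\<lambda>i. cl (g ^ i)) ` {..<j}"
    proof
      fix x assume "x \<in> carrier (mult_of Q)"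
      then obtain i where i: "x = cl (g ^ i)" unfolding a(2) pw by blast
      have "cl (g ^ i) = cl (g ^ (i mod j))"
      proof -
        have "g ^ i = (g ^ j) ^ (i div j) * g ^ (i mod j)"
          by (simp flip: power_add power_mult)
        then have "g ^ i - g ^ (i mod j) = ((g ^ j) ^ (i div j) - 1) * g ^ (i mod j)"
          by (simp add: algebra_simps)
        also have "p dvd \<dots>" using that by (simp add: dvd_power_minus_1)
        finally show ?thesis by (simp add: cl_eq)
      qed
      then show "x \<in> (\<lambda>i. cl (g ^ i)) ` {..<j}" using i that by auto
    qed
    then have "card (carrier (mult_of Q)) \<le> card {..<j}"
      by (meson card_image_le card_mono finite_imageI finite_lessThan le_trans)
    then show ?thesis using N by (simp add: order_def)
  qed
  have g2: "p dvd g ^ k - 1 \<longleftrightarrow> nat (Nm p - 1) dvd k" for k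
  proof
    assume "nat (Nm p - 1) dvd k"
    then show "p dvd g ^ k - 1" using imp by (auto elim!: dvdE simp: mult.commute)
  next
    assume k: "p dvd g ^ k - 1"
    define n where "n = nat (Nm p - 1)"
    have "g ^ k = g ^ (k div n * n) * g ^ (k mod n)" by (simp flip: power_add)
    then have "g ^ (k mod n) - 1 = g ^ k - 1 - (g ^ (k div n * n) - 1) * g ^ (k mod n)"
      by (simp add: algebra_simps)
    moreover have "p dvd g ^ k - 1 - (g ^ (k div n * n) - 1) * g ^ (k mod n)"
      by (intro dvd_diff dvd_mult2 k imp[folded n_def])
    ultimately have "p dvd g ^ (k mod n) - 1" by (simp only:)
    then have "k mod n = 0" using min[of "k mod n"] N1
      by (metis mod_less_divisor n_def neq0_conv not_le)
    then show "nat (Nm p - 1) dvd k" by (auto simp: n_def)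
  qed
  show thesis using that g1 g2 by blast
qed

lemma gint_prime_Nm_mod4:
  assumes "prime_elem p" "\<not> gt dvd p"
  shows "Nm p mod 4 = 1" "Nm p > 4"
proof -
  show "Nm p mod 4 = 1" using assms
  proof (cases rule: gint_prime_cases)
    case (inert q u)
    then have "q * q mod 4 = (3 * 3) mod 4" by (metis mod_mult_eq)
    then show ?thesis by (simp only: inert(5) power2_eq_square) simp
  next
    case (split P)
    then show ?thesis by simp
  qed
  moreover have "Nm p \<noteq> 1" using assms gint_unit_iff_Nm[of p] by auto
  ultimately show "Nm p > 4" using Nm_nonneg[of p]
    by presburger
qed

definition qexp :: "gint \<Rightarrow> nat" where "qexp p = nat ((Nm p - 1) div 4)"

lemma qexp: assumes "prime_elem p" "\<not> gt dvd p" shows "nat (Nm p - 1) = 4 * qexp p" "qexp p > 0"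
proof -
  have "Nm p - 1 = 4 * ((Nm p - 1) div 4)" "(Nm p - 1) div 4 > 0"
    using gint_prime_Nm_mod4[OF assms] by presburger+
  then show "nat (Nm p - 1) = 4 * qexp p" "qexp p > 0"
    unfolding qexp_def by linarith+
qed

lemma gint_fermat:
  assumes "prime_elem p" "\<not> gt dvd p" "\<not> p dvd x"
  shows "p dvd x ^ (4 * qexp p) - 1"
proof -
  obtain g where g: "\<And>x. \<not> p dvd x \<Longrightarrow> \<exists>k. p dvd x - g ^ k"
    "\<And>k. p dvd g ^ k - 1 \<longleftrightarrow> nat (Nm p - 1) dvd k"
    using gint_residue_generator[OF assms(1,2)] by blast
  obtain k where k: "p dvd x - g ^ k" using g(1) assms(3) by blast
  then have "p dvd x ^ (4 * qexp p) - (g ^ k) ^ (4 * qexp p)" by (rule dvd_power_diff)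
  moreover have "p dvd (g ^ k) ^ (4 * qexp p) - 1"
    unfolding power_mult[symmetric] g(2) qexp(1)[OF assms(1,2)] by simp
  ultimately show ?thesis by (metis dvd_add diff_add_cancel add_diff_eq)
qed

text \<open>For a primitive root \<open>g\<close> and \<open>x = g ^ k\<close>, the assumption on
  \<open>x ^ m\<close> says that \<open>m * e\<close> divides \<open>k * m\<close>, so
  \<open>e\<close> divides \<open>k\<close>.\<close>

lemma gint_root_exists:
  assumes "prime_elem p" "\<not> gt dvd p" "\<not> p dvd x" "m * e = 4 * qexp p" "p dvd x ^ m - 1"
  obtains y where "p dvd y ^ e - x"
proof -
  obtain g where g: "\<And>x. \<not> p dvd x \<Longrightarrow> \<exists>k. p dvd x - g ^ k"
    "\<And>k. p dvd g ^ k - 1 \<longleftrightarrow> nat (Nm p - 1) dvd k"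
    using gint_residue_generator[OF assms(1,2)] by blast
  obtain k where k: "p dvd x - g ^ k" using g(1) assms(3) by blast
  then have "p dvd x ^ m - (g ^ k) ^ m" by (rule dvd_power_diff)
  with assms(5) have "p dvd (x ^ m - 1) - (x ^ m - (g ^ k) ^ m)" by (rule dvd_diff)
  then have "p dvd g ^ (k * m) - 1" by (simp add: power_mult)
  then have "m * e dvd m * k" using g(2) qexp(1)[OF assms(1,2)] assms(4) by (simp add: mult.commute)
  moreover have "m > 0" using assms(4) qexp(2)[OF assms(1,2)] by (cases m) auto
  ultimately have "e dvd k" by simp
  then obtain l where "k = e * l" ..
  then have "k = l * e" by simp
  then show thesis using that[of "g ^ l"] k by (simp add: power_mult dvd_diff_commute)
qed

lemma gint_inverse_mod:
  assumes "prime_elem p" "\<not> gt dvd p" "\<not> p dvd x"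
  obtains y where "p dvd x * y - 1"
  proof -
  have "x * x ^ (4 * qexp p - 1) = x ^ (4 * qexp p)"
    using qexp(2)[OF assms(1,2)] by (metis mult_eq_0_iff neq0_conv power_eq_if zero_neq_numeral)
  then show thesis using that[of "x ^ (4 * qexp p - 1)"] gint_fermat[OF assms] by simp
qed

section \<open>Valuations and completions\<close>

lemma qi_common_denom2:
  fixes x y :: qi
  obtains a b c where "c \<noteq> 0" "x = to_fract a / to_fract c" "y = to_fract b / to_fract c"
proof -
  obtain a c where x: "x = Fraction_Field.Fract a c" "c \<noteq> 0" by (cases x)
  obtain b d where y: "y = Fraction_Field.Fract b d" "d \<noteq> 0" by (cases y)
  show thesis
    by (rule that[of "c * d" "a * d" "b * c"]) (use x y in \<open>simp_all add: Fract_conv_to_fract\<close>)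
qed

lemma qi_common_denom3:
  fixes x y z :: qi
  obtains a b e c where "c \<noteq> 0" "x = to_fract a / to_fract c" "y = to_fract b / to_fract c"
    "z = to_fract e / to_fract c"
proof -
  obtain a b c where xy: "c \<noteq> 0" "x = to_fract a / to_fract c" "y = to_fract b / to_fract c"
    by (rule qi_common_denom2)
  obtain e d where z: "z = Fraction_Field.Fract e d" "d \<noteq> 0" by (cases z)
  show thesis
    by (rule that[of "c * d" "a * d" "b * d" "e * c"]) (use xy z in \<open>simp_all add: Fract_conv_to_fract\<close>)
qed

text \<open>The valuation is at least \<open>n\<close>, with an infinite value at 0, where
  \<open>pval\<close> is unspecified. This relation replaces the real absolute value in all
  estimates.\<close>

definition ple :: "gint \<Rightarrow> int \<Rightarrow> qi \<Rightarrow> bool" where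
  "ple p n x \<longleftrightarrow> x = 0 \<or> n \<le> pval p x"

locale gprime =
  fixes p :: gint
  assumes prime: "prime_elem p"
begin

lemma p_nz: "p \<noteq> 0" and p_nu: "\<not> p dvd 1"
  using prime by auto

lemma pval_Fract:
  assumes "a \<noteq> 0" "c \<noteq> 0"
  shows "pval p (Fraction_Field.Fract a c) = int (multiplicity p a) - int (multiplicity p c)"
  unfolding pval_def
proof (rule the_equality)
  fix k
  assume "\<exists>a' c'. a' \<noteq> 0 \<and> c' \<noteq> 0 \<and> Fraction_Field.Fract a c = Fraction_Field.Fract a' c' \<and>
    k = int (multiplicity p a') - int (multiplicity p c')"
  then obtain a' c' where *: "a' \<noteq> 0" "c' \<noteq> 0"
    "Fraction_Field.Fract a c = Fraction_Field.Fract a' c'"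
    "k = int (multiplicity p a') - int (multiplicity p c')" by blast
  then have "a * c' = a' * c" using assms by (simp add: eq_fract)
  then have "multiplicity p a + multiplicity p c' = multiplicity p a' + multiplicity p c"
    using assms * prime by (metis prime_elem_multiplicity_mult_distrib)
  then show "k = int (multiplicity p a) - int (multiplicity p c)" using *(4) by linarith
qed (use assms in blast)

lemma pval_to_fract: "a \<noteq> 0 \<Longrightarrow> pval p (to_fract a) = int (multiplicity p a)"
  by (simp add: to_fract_def pval_Fract)

lemma pval_mult:
  assumes "x \<noteq> 0" "y \<noteq> 0" shows "pval p (x * y) = pval p x + pval p y"
proof -
  obtain a c where x: "x = Fraction_Field.Fract a c" "c \<noteq> 0" "a \<noteq> 0"
    using assms(1) by (metis Fract_cases_nonzero)
  obtain b d where y: "y = Fraction_Field.Fract b d" "d \<noteq> 0" "b \<noteq> 0"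
    using assms(2) by (metis Fract_cases_nonzero)
  show ?thesis using x y prime
    by (simp add: pval_Fract prime_elem_multiplicity_mult_distrib)
qed

lemma pval_1 [simp]: "pval p 1 = 0"
  using pval_to_fract[of 1] by simp

lemma pval_inverse: assumes "x \<noteq> 0" shows "pval p (inverse x) = - pval p x"
  using pval_mult[of x "inverse x"] assms by simp

lemma pval_divide: "x \<noteq> 0 \<Longrightarrow> y \<noteq> 0 \<Longrightarrow> pval p (x / y) = pval p x - pval p y"
  by (simp add: divide_inverse pval_mult pval_inverse)

text \<open>The passage from valuations to divisibility in Z[i]. For a negative exponent
  \<open>nat\<close> gives \<open>p ^ 0\<close>, and both sides hold because \<open>a\<close> is
  integral.\<close>

lemma ple_quot:
  assumes "c \<noteq> 0"
  shows "ple p n (to_fract a / to_fract c) \<longleftrightarrow> p ^ nat (n + int (multiplicity p c)) dvd a"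
proof (cases "a = 0")
  case False
  then have "ple p n (to_fract a / to_fract c) \<longleftrightarrow> n + int (multiplicity p c) \<le> int (multiplicity p a)"
    using assms by (auto simp: ple_def pval_divide pval_to_fract)
  also have "\<dots> \<longleftrightarrow> p ^ nat (n + int (multiplicity p c)) dvd a"
    using power_dvd_iff_le_multiplicity[OF False p_nu] by (simp add: nat_le_iff)
  finally show ?thesis .
qed (simp add: ple_def)

lemma ple_to_fract: "ple p n (to_fract a) \<longleftrightarrow> p ^ nat n dvd a"
  using ple_quot[of 1 n a] by simp

lemma ple_0 [simp]: "ple p n 0"
  by (simp add: ple_def)

lemma ple_mono: "ple p n x \<Longrightarrow> m \<le> n \<Longrightarrow> ple p m x"
  by (auto simp: ple_def)

lemma ple_add: assumes "ple p n x" "ple p n y" shows "ple p n (x + y)"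
proof -
  obtain a b c where *: "c \<noteq> 0" "x = to_fract a / to_fract c" "y = to_fract b / to_fract c"
    by (rule qi_common_denom2)
  then have xy: "x + y = to_fract (a + b) / to_fract c" by (simp add: add_divide_distrib)
  have "ple p n (to_fract (a + b) / to_fract c)"
    using assms unfolding *(2,3) ple_quot[OF *(1)] by (rule dvd_add)
  then show ?thesis by (simp only: xy)
qed

lemma ple_uminus [simp]: "ple p n (- x) \<longleftrightarrow> ple p n x"
proof -
  obtain a c where "x = Fraction_Field.Fract a c" "c \<noteq> 0" by (cases x)
  then have *: "x = to_fract a / to_fract c" "- (to_fract a / to_fract c) = to_fract (- a) / to_fract c"
    by (simp_all add: Fract_conv_to_fract)
  show ?thesis unfolding * ple_quot[OF \<open>c \<noteq> 0\<close>] by simp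
qed

lemma ple_diff: "ple p n x \<Longrightarrow> ple p n y \<Longrightarrow> ple p n (x - y)"
  using ple_add[of n x "- y"] by simp

lemma ple_mult: "ple p m x \<Longrightarrow> ple p n y \<Longrightarrow> ple p (m + n) (x * y)"
  by (cases "x = 0 \<or> y = 0") (auto simp: ple_def pval_mult)

lemma ple_mult_unit: "ple p 0 x \<Longrightarrow> ple p n y \<Longrightarrow> ple p n (x * y)"
  using ple_mult[of 0 x n y] by simp

lemma ple_cancel: "x \<noteq> 0 \<Longrightarrow> ple p (pval p x + n) (x * y) \<longleftrightarrow> ple p n y"
  by (cases "y = 0") (auto simp: ple_def pval_mult)

lemma ple_to_fract_0 [simp]: "ple p 0 (to_fract a)"
  by (simp add: ple_to_fract)

lemma not_ple_large: assumes "x \<noteq> 0" shows "\<not> ple p (pval p x + 1) x"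
  using assms by (simp add: ple_def)

section \<open>The completion, with absolute values translated into valuations\<close>

definition v :: real where "v = of_int (Nm p)"

lemma v_gt_1: "v > 1"
proof -
  have "Nm p \<noteq> 1" using p_nu gint_unit_iff_Nm by blast
  then have "Nm p > 1" using p_nz Nm_pos_iff[of p] by linarith
  then show ?thesis by (simp add: v_def)
qed

lemma pabs_eq: "x \<noteq> 0 \<Longrightarrow> pabs p x = v powi (- pval p x)"
  by (simp add: pabs_def v_def)

lemma pabs_nonneg [simp]: "pabs p x \<ge> 0"
  using v_gt_1 by (cases "x = 0") (simp_all add: pabs_eq, simp add: pabs_def)

lemma pabs_le_iff: "pabs p x \<le> v powi (- n) \<longleftrightarrow> ple p n x"
proof (cases "x = 0")
  case True
  then show ?thesis using v_gt_1 by (simp add: pabs_def ple_def)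
next
  case False
  have "v powi (- pval p x) \<le> v powi (- n) \<longleftrightarrow> - pval p x \<le> - n"
    using power_int_increasing[of "- pval p x" "- n" v] v_gt_1
      power_int_strict_increasing[of "- n" "- pval p x" v] by linarith
  with False show ?thesis by (simp add: pabs_eq ple_def)
qed

lemma small_power: assumes "e > 0" obtains n :: int where "v powi (- n) < e"
proof -
  have "inverse v < 1" "inverse v > 0" using v_gt_1 by (simp_all add: inverse_less_1_iff)
  then obtain n where "inverse v ^ n < e" using assms real_arch_pow_inv by blast
  then show thesis using that[of "int n"]
    by (simp add: power_int_minus power_inverse)
qed

lemma v_powi_pos: "v powi n > 0"
  using v_gt_1 by simp

lemma null_seqs_iff: "X \<in> null_seqs p \<longleftrightarrow> (\<forall>n. \<forall>\<^sub>F m in sequentially. ple p n (X m))"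
proof
  assume X: "X \<in> null_seqs p"
  show "\<forall>n. \<forall>\<^sub>F m in sequentially. ple p n (X m)"
  proof
    fix n
    have "\<forall>\<^sub>F m in sequentially. pabs p (X m) < v powi (- n)"
      using X v_powi_pos unfolding null_seqs_def by (auto intro: order_tendstoD)
    then show "\<forall>\<^sub>F m in sequentially. ple p n (X m)"
      by eventually_elim (simp flip: pabs_le_iff)
  qed
next
  assume *: "\<forall>n. \<forall>\<^sub>F m in sequentially. ple p n (X m)"
  have "\<forall>\<^sub>F m in sequentially. pabs p (X m) < e" if e: "e > 0" for e
  proof -
    obtain n where n: "v powi (- n) < e" using small_power[OF e] by blast
    have "\<forall>\<^sub>F m in sequentially. ple p n (X m)" using * by blast
    then show ?thesis by eventually_elim (use n in \<open>simp flip: pabs_le_iff\<close>)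
  qed
  then show "X \<in> null_seqs p" unfolding null_seqs_def
    by (auto intro!: order_tendstoI simp: less_le_trans[OF _ pabs_nonneg])
qed

lemma cauchy_seqs_iff:
  "X \<in> cauchy_seqs p \<longleftrightarrow> (\<forall>n. \<exists>N. \<forall>m\<ge>N. \<forall>k\<ge>N. ple p n (X m - X k))"
proof
  assume X: "X \<in> cauchy_seqs p"
  show "\<forall>n. \<exists>N. \<forall>m\<ge>N. \<forall>k\<ge>N. ple p n (X m - X k)"
  proof
    fix n
    obtain N where "\<forall>m\<ge>N. \<forall>k\<ge>N. pabs p (X m - X k) < v powi (- n)"
      using X v_powi_pos unfolding cauchy_seqs_def by blast
    then show "\<exists>N. \<forall>m\<ge>N. \<forall>k\<ge>N. ple p n (X m - X k)"
      by (intro exI[of _ N]) (auto simp flip: pabs_le_iff intro: less_imp_le)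
  qed
next
  assume *: "\<forall>n. \<exists>N. \<forall>m\<ge>N. \<forall>k\<ge>N. ple p n (X m - X k)"
  show "X \<in> cauchy_seqs p" unfolding cauchy_seqs_def
  proof (intro CollectI allI impI)
    fix e :: real assume "e > 0"
    then obtain n where n: "v powi (- n) < e" using small_power by blast
    obtain N where "\<forall>m\<ge>N. \<forall>k\<ge>N. ple p n (X m - X k)" using * by blast
    then show "\<exists>N. \<forall>m\<ge>N. \<forall>k\<ge>N. pabs p (X m - X k) < e"
      by (intro exI[of _ N]) (auto simp flip: pabs_le_iff intro: le_less_trans[OF _ n])
  qed
qed

lemma cauchy_bounded:
  assumes "X \<in> cauchy_seqs p"
  obtains b N where "b \<le> 0" "\<And>m. m \<ge> N \<Longrightarrow> ple p b (X m)"
proof -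
  obtain N where N: "\<forall>m\<ge>N. \<forall>k\<ge>N. ple p 0 (X m - X k)"
    using assms unfolding cauchy_seqs_iff by blast
  define b where "b = min 0 (pval p (X N))"
  have "ple p b (X N)" by (simp add: ple_def b_def)
  moreover have "ple p b (X m - X N)" if "m \<ge> N" for m
    using N that by (auto intro: ple_mono[of 0] simp: b_def)
  ultimately have "ple p b (X m)" if "m \<ge> N" for m
    using ple_add[of b "X m - X N" "X N"] that by simp
  then show thesis using that[of b N] by (simp add: b_def)
qed

lemma cauchy_const [simp]: "(\<lambda>n. c) \<in> cauchy_seqs p"
  by (simp add: cauchy_seqs_iff)

lemma cauchy_add: assumes "X \<in> cauchy_seqs p" "Y \<in> cauchy_seqs p"
  shows "(\<lambda>n. X n + Y n) \<in> cauchy_seqs p"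
  unfolding cauchy_seqs_iff
proof
  fix n
  obtain N M where "\<forall>m\<ge>N. \<forall>k\<ge>N. ple p n (X m - X k)" "\<forall>m\<ge>M. \<forall>k\<ge>M. ple p n (Y m - Y k)"
    using assms unfolding cauchy_seqs_iff by blast
  then have "\<forall>m\<ge>max N M. \<forall>k\<ge>max N M. ple p n ((X m - X k) + (Y m - Y k))"
    by (auto intro: ple_add)
  then show "\<exists>N. \<forall>m\<ge>N. \<forall>k\<ge>N. ple p n (X m + Y m - (X k + Y k))"
    by (intro exI[of _ "max N M"]) (simp add: algebra_simps)
qed

lemma cauchy_uminus: "X \<in> cauchy_seqs p \<Longrightarrow> (\<lambda>n. - X n) \<in> cauchy_seqs p"
proof -
  assume X: "X \<in> cauchy_seqs p"
  have *: "- X m - - X k = - (X m - X k)" for m k by simp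
  show ?thesis using X unfolding cauchy_seqs_iff * ple_uminus .
qed

lemma cauchy_mult: assumes "X \<in> cauchy_seqs p" "Y \<in> cauchy_seqs p"
  shows "(\<lambda>n. X n * Y n) \<in> cauchy_seqs p"
  unfolding cauchy_seqs_iff
proof
  fix n
  obtain a A where a: "a \<le> 0" "\<And>m. m \<ge> A \<Longrightarrow> ple p a (X m)" using cauchy_bounded[OF assms(1)] by blast
  obtain b B where b: "b \<le> 0" "\<And>m. m \<ge> B \<Longrightarrow> ple p b (Y m)" using cauchy_bounded[OF assms(2)] by blast
  obtain N M where NM: "\<forall>m\<ge>N. \<forall>k\<ge>N. ple p (n - b) (X m - X k)"
    "\<forall>m\<ge>M. \<forall>k\<ge>M. ple p (n - a) (Y m - Y k)"
    using assms unfolding cauchy_seqs_iff by blast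
  define K where "K = Max {A, B, N, M}"
  have K: "A \<le> K" "B \<le> K" "N \<le> K" "M \<le> K" by (simp_all add: K_def)
  have "ple p n (X m * Y m - X k * Y k)" if "m \<ge> K" "k \<ge> K" for m k
  proof -
    have "ple p (a + (n - a)) (X m * (Y m - Y k))"
      using that K by (intro ple_mult a(2)) (auto intro!: NM[rule_format])
    moreover have "ple p ((n - b) + b) ((X m - X k) * Y k)"
      using that K by (intro ple_mult b(2)) (auto intro!: NM[rule_format])
    ultimately have "ple p n (X m * (Y m - Y k) + (X m - X k) * Y k)"
      by (intro ple_add) simp_all
    then show ?thesis by (simp add: algebra_simps)
  qed
  then show "\<exists>N. \<forall>m\<ge>N. \<forall>k\<ge>N. ple p n (X m * Y m - X k * Y k)" by blast
qed

lemma null_add: "X \<in> null_seqs p \<Longrightarrow> Y \<in> null_seqs p \<Longrightarrow> (\<lambda>n. X n + Y n) \<in> null_seqs p"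
  unfolding null_seqs_iff using ple_add by (blast intro: eventually_elim2)

lemma null_uminus: "X \<in> null_seqs p \<Longrightarrow> (\<lambda>n. - X n) \<in> null_seqs p"
  unfolding null_seqs_iff by simp

lemma null_diff: "X \<in> null_seqs p \<Longrightarrow> Y \<in> null_seqs p \<Longrightarrow> (\<lambda>n. X n - Y n) \<in> null_seqs p"
  using null_add[of X "\<lambda>n. - Y n"] null_uminus[of Y] by simp

lemma null_mult: assumes "X \<in> cauchy_seqs p" "Y \<in> null_seqs p"
  shows "(\<lambda>n. X n * Y n) \<in> null_seqs p"
  unfolding null_seqs_iff
proof
  fix n
  obtain a A where a: "a \<le> 0" "\<And>m. m \<ge> A \<Longrightarrow> ple p a (X m)" using cauchy_bounded[OF assms(1)] by blast
  have "\<forall>\<^sub>F m in sequentially. ple p a (X m)" by (rule eventually_sequentiallyI[of A]) (rule a(2))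
  moreover have "\<forall>\<^sub>F m in sequentially. ple p (n - a) (Y m)" using assms(2) by (simp add: null_seqs_iff)
  ultimately show "\<forall>\<^sub>F m in sequentially. ple p n (X m * Y m)"
    by eventually_elim (metis add.commute diff_add_cancel ple_mult)
qed

lemma null_imp_cauchy: assumes "X \<in> null_seqs p" shows "X \<in> cauchy_seqs p"
  unfolding cauchy_seqs_iff
proof
  fix n
  obtain N where "\<forall>m\<ge>N. ple p n (X m)"
    using assms unfolding null_seqs_iff eventually_sequentially by blast
  then show "\<exists>N. \<forall>m\<ge>N. \<forall>k\<ge>N. ple p n (X m - X k)" by (blast intro: ple_diff)
qed

lemma null_0 [simp]: "(\<lambda>n. 0) \<in> null_seqs p"
  by (simp add: null_seqs_iff)

lemma null_const_iff [simp]: "(\<lambda>n. c) \<in> null_seqs p \<longleftrightarrow> c = 0"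
  unfolding null_seqs_iff using not_ple_large[of c] by (auto simp: eventually_sequentially)

abbreviation CR where "CR \<equiv> cauchy_ring p"
abbreviation K where "K \<equiv> completion p"

lemma CR_simps [simp]:
  "carrier CR = cauchy_seqs p" "X \<otimes>\<^bsub>CR\<^esub> Y = (\<lambda>n. X n * Y n)" "\<one>\<^bsub>CR\<^esub> = (\<lambda>n. 1)"
  "\<zero>\<^bsub>CR\<^esub> = (\<lambda>n. 0)" "X \<oplus>\<^bsub>CR\<^esub> Y = (\<lambda>n. X n + Y n)"
  by (simp_all add: cauchy_ring_def)

lemma cring_CR: "cring CR"
proof (rule cringI)
  show "abelian_group CR"
  proof (rule abelian_groupI)
    fix X assume "X \<in> carrier CR"
    then show "\<exists>Y\<in>carrier CR. Y \<oplus>\<^bsub>CR\<^esub> X = \<zero>\<^bsub>CR\<^esub>"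
      by (intro bexI[of _ "\<lambda>n. - X n"]) (simp_all add: cauchy_uminus)
  qed (auto simp: cauchy_add algebra_simps)
  show "Group.comm_monoid CR"
    by (rule comm_monoidI) (auto simp: cauchy_mult algebra_simps)
qed (simp add: algebra_simps)

lemma a_minus_CR:
  assumes "X \<in> cauchy_seqs p" "Y \<in> cauchy_seqs p"
  shows "X \<ominus>\<^bsub>CR\<^esub> Y = (\<lambda>n. X n - Y n)"
proof -
  interpret cring CR by (rule cring_CR)
  have "\<ominus>\<^bsub>CR\<^esub> Y = (\<lambda>n. - Y n)"
    by (rule minus_equality) (simp_all add: assms cauchy_uminus)
  then show ?thesis by (simp add: a_minus_def)
qed

lemma ideal_null: "ideal (null_seqs p) CR"
proof -
  interpret cring CR by (rule cring_CR)
  show ?thesis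
  proof (rule idealI)
    show "ring CR" by (rule ring_axioms)
    show "subgroup (null_seqs p) (add_monoid CR)"
    proof (rule group.subgroupI)
      show "Group.group (add_monoid CR)" by (rule add.is_group)
      show "null_seqs p \<noteq> {}" using null_0 by blast
      show "null_seqs p \<subseteq> carrier (add_monoid CR)" using null_imp_cauchy by auto
      fix X assume X: "X \<in> null_seqs p"
      have "\<ominus>\<^bsub>CR\<^esub> X = (\<lambda>n. - X n)"
        by (rule minus_equality) (simp_all add: X null_imp_cauchy cauchy_uminus)
      then show "inv\<^bsub>add_monoid CR\<^esub> X \<in> null_seqs p"
        using null_uminus[OF X] by (simp add: a_inv_def)
    qed (simp add: null_add)
  next
    fix X Y assume "X \<in> null_seqs p" "Y \<in> carrier CR"
    then show "Y \<otimes>\<^bsub>CR\<^esub> X \<in> null_seqs p" "X \<otimes>\<^bsub>CR\<^esub> Y \<in> null_seqs p"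
      using null_mult[of Y X] by (simp_all add: mult.commute)
  qed
qed

definition cl :: "(nat \<Rightarrow> qi) \<Rightarrow> (nat \<Rightarrow> qi) set" where
  "cl X = null_seqs p +>\<^bsub>CR\<^esub> X"

lemma cring_K: "cring K"
  unfolding completion_def by (rule ideal.quotient_is_cring[OF ideal_null cring_CR])

lemma carrier_K: "carrier K = cl ` cauchy_seqs p"
  by (auto simp: completion_def FactRing_def A_RCOSETS_def' cl_def)

lemma cl_closed [simp]: "X \<in> cauchy_seqs p \<Longrightarrow> cl X \<in> carrier K"
  by (simp add: carrier_K)

lemma cl_eq_iff:
  assumes "X \<in> cauchy_seqs p" "Y \<in> cauchy_seqs p"
  shows "cl X = cl Y \<longleftrightarrow> (\<lambda>n. X n - Y n) \<in> null_seqs p"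
proof -
  interpret cring CR by (rule cring_CR)
  show ?thesis
    using quotient_eq_iff_same_a_r_cos[OF ideal_null, of X Y] assms
    by (simp add: cl_def a_minus_CR)
qed

lemma cl_mult: "X \<in> cauchy_seqs p \<Longrightarrow> Y \<in> cauchy_seqs p \<Longrightarrow> cl X \<otimes>\<^bsub>K\<^esub> cl Y = cl (\<lambda>n. X n * Y n)"
  using ideal.rcoset_mult_add[OF ideal_null, of X Y] by (simp add: completion_def FactRing_def cl_def)

lemma cl_add:
  assumes "X \<in> cauchy_seqs p" "Y \<in> cauchy_seqs p"
  shows "cl X \<oplus>\<^bsub>K\<^esub> cl Y = cl (\<lambda>n. X n + Y n)"
proof -
  interpret ideal "null_seqs p" CR by (rule ideal_null)
  show ?thesis using ring_hom_add[OF rcos_ring_hom, of X Y] assms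
    by (simp add: completion_def cl_def)
qed

lemma cl_one: "\<one>\<^bsub>K\<^esub> = cl (\<lambda>n. 1)"
  by (simp add: completion_def FactRing_def cl_def)

lemma cl_zero: "\<zero>\<^bsub>K\<^esub> = cl (\<lambda>n. 0)"
  using ring.a_rcos_zero[OF cring.axioms(1)[OF cring_CR] ideal_null null_0]
  by (simp add: completion_def FactRing_def cl_def)

lemma cl_uminus: assumes "X \<in> cauchy_seqs p" shows "\<ominus>\<^bsub>K\<^esub> cl X = cl (\<lambda>n. - X n)"
proof -
  interpret K: cring K by (rule cring_K)
  show ?thesis
    by (rule K.minus_equality) (simp_all add: assms cauchy_uminus cl_add cl_zero)
qed

lemma cauchy_diff: "X \<in> cauchy_seqs p \<Longrightarrow> Y \<in> cauchy_seqs p \<Longrightarrow> (\<lambda>n. X n - Y n) \<in> cauchy_seqs p"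
  using cauchy_add[of X "\<lambda>n. - Y n"] cauchy_uminus[of Y] by simp

lemma cl_diff: "X \<in> cauchy_seqs p \<Longrightarrow> Y \<in> cauchy_seqs p \<Longrightarrow> cl X \<ominus>\<^bsub>K\<^esub> cl Y = cl (\<lambda>n. X n - Y n)"
  by (simp add: a_minus_def cl_uminus cl_add cauchy_uminus)

lemma cauchy_power2: "X \<in> cauchy_seqs p \<Longrightarrow> (\<lambda>n. X n ^ 2) \<in> cauchy_seqs p"
  by (simp add: power2_eq_square cauchy_mult)

lemma cl_power2: "X \<in> cauchy_seqs p \<Longrightarrow> cl X [^]\<^bsub>K\<^esub> (2::nat) = cl (\<lambda>n. X n ^ 2)"
proof -
  interpret K: cring K by (rule cring_K)
  assume X: "X \<in> cauchy_seqs p"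
  have "cl X [^]\<^bsub>K\<^esub> (2::nat) = cl X \<otimes>\<^bsub>K\<^esub> cl X" using X by (simp add: numeral_2_eq_2)
  then show ?thesis using X by (simp add: cl_mult power2_eq_square)
qed

lemma loc_eq: "loc p a = cl (\<lambda>n. to_fract a)"
  by (simp add: loc_def to_completion_def cl_def)

text \<open>Eliminates the quotient ring: coordinates become Cauchy sequences of elements of the
  field, and the equations hold up to null sequences.\<close>

lemma C_points_iff:
  "C_points b d p \<noteq> {} \<longleftrightarrow>
    (\<exists>A B W Z. {A, B, W, Z} \<subseteq> cauchy_seqs p \<and> \<not> {A, B, W, Z} \<subseteq> null_seqs p \<and>
      (\<lambda>n. to_fract d * W n ^ 2 - (to_fract (d ^ 2) * A n ^ 2 - to_fract (4 * b) * Z n ^ 2)) \<in> null_seqs p \<and>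
      (\<lambda>n. B n ^ 2 - A n * Z n) \<in> null_seqs p)" (is "_ \<longleftrightarrow> (\<exists>A B W Z. ?P A B W Z)")
proof -
  have *: "(cl A, cl B, cl W, cl Z) \<in> C_points b d p \<longleftrightarrow> ?P A B W Z"
    if "A \<in> cauchy_seqs p" "B \<in> cauchy_seqs p" "W \<in> cauchy_seqs p" "Z \<in> cauchy_seqs p" for A B W Z
    using that unfolding C_points_def Let_def
    by (simp add: loc_eq cl_power2 cl_mult cl_diff cl_zero cl_eq_iff cauchy_power2 cauchy_mult
        cauchy_diff del: to_fract_mult)
  show ?thesis
  proof
    assume "C_points b d p \<noteq> {}"
    then obtain a b' w z where x: "(a, b', w, z) \<in> C_points b d p" by fastforce
    then have "a \<in> carrier K" "b' \<in> carrier K" "w \<in> carrier K" "z \<in> carrier K"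
      unfolding C_points_def Let_def by auto
    then obtain A B W Z where "a = cl A" "b' = cl B" "w = cl W" "z = cl Z"
      "A \<in> cauchy_seqs p" "B \<in> cauchy_seqs p" "W \<in> cauchy_seqs p" "Z \<in> cauchy_seqs p"
      unfolding carrier_K by blast
    then show "\<exists>A B W Z. ?P A B W Z" using x *[of A B W Z] by blast
  next
    assume "\<exists>A B W Z. ?P A B W Z"
    then obtain A B W Z where "?P A B W Z" by blast
    then have "(cl A, cl B, cl W, cl Z) \<in> C_points b d p" using *[of A B W Z] by auto
    then show "C_points b d p \<noteq> {}" by blast
  qed
qed

end

section \<open>Local solvability\<close>

text \<open>\<open>approx_solvable\<close> and \<open>unit_solvable\<close> are finitary substitutes for the existence of a
  point of \<open>C\<^sub>d\<close>: since \<open>-4 = gt ^ 4\<close>, the curve is \<open>d w\<^sup>2 = d\<^sup>2 x\<^sup>4 + b z\<^sup>4\<close> in the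
  coordinates \<open>(X\<^sub>0, X\<^sub>1, X\<^sub>2, X\<^sub>3) = (gt\<^sup>2 x\<^sup>2, gt x z, gt\<^sup>2 w, z\<^sup>2)\<close>.\<close>

definition approx_solvable :: "gint \<Rightarrow> gint \<Rightarrow> gint \<Rightarrow> bool" where
  "approx_solvable p b d \<longleftrightarrow> (\<forall>N. \<exists>x z w k. \<not> (p ^ (k + 1) dvd x \<and> p ^ (k + 1) dvd z) \<and>
     p ^ (4 * k + N) dvd d ^ 2 * x ^ 4 + b * z ^ 4 - d * w ^ 2)"

definition unit_solvable :: "gint \<Rightarrow> gint \<Rightarrow> gint \<Rightarrow> bool" where
  "unit_solvable p b d \<longleftrightarrow> (\<exists>x z w n. \<not> p ^ (n + 1) dvd d * w ^ 2 \<and>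
     p ^ (n + 2 * multiplicity p 2 + 1) dvd d ^ 2 * x ^ 4 + b * z ^ 4 - d * w ^ 2)"

lemma to_fract_power [simp]: "to_fract (x ^ n) = to_fract x ^ n"
  by (induction n) simp_all

lemma to_fract_numeral [simp]: "to_fract (numeral k) = numeral k"
proof -
  have "to_fract (of_nat n) = of_nat n" for n by (induction n) simp_all
  from this[of "numeral k"] show ?thesis by simp
qed

section \<open>From points over the completion to congruences\<close>

context gprime
begin

lemma ple_power2_iff: "ple p (2 * n) (x ^ 2) \<longleftrightarrow> ple p n x"
  by (cases "x = 0") (auto simp: ple_def power2_eq_square pval_mult)

lemma not_null_frequently:
  assumes "X \<notin> null_seqs p"
  obtains n where "\<exists>\<^sub>F m in sequentially. \<not> ple p n (X m)"
  using assms unfolding null_seqs_iff frequently_def by auto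

text \<open>The form is homogeneous of degree 4 when \<open>w\<close> has weight 2. Clearing a
  common denominator \<open>c\<close> multiplies it by \<open>c ^ 4\<close>, provided that the
  numerator of \<open>w / c\<close> receives one more factor \<open>c\<close>.\<close>

lemma approx_from_quot:
  assumes c: "c \<noteq> 0" and N: "\<not> (ple p n (to_fract x / to_fract c) \<and> ple p n (to_fract z / to_fract c))"
    and eq: "ple p (4 * n + int N) (to_fract (d ^ 2) * (to_fract x / to_fract c) ^ 4
      + to_fract b * (to_fract z / to_fract c) ^ 4 - to_fract d * (to_fract w / to_fract c) ^ 2)"
  shows "\<exists>x z w k. \<not> (p ^ (k + 1) dvd x \<and> p ^ (k + 1) dvd z) \<and>
     p ^ (4 * k + N) dvd d ^ 2 * x ^ 4 + b * z ^ 4 - d * w ^ 2"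
proof -
  define m where "m = n + int (multiplicity p c)"
  have nm: "\<not> (p ^ nat m dvd x \<and> p ^ nat m dvd z)"
    using N unfolding ple_quot[OF c] m_def .
  then have m: "m > 0" by (cases "m > 0") auto
  have "ple p (4 * m + int N) (to_fract (c ^ 4) * (to_fract (d ^ 2) * (to_fract x / to_fract c) ^ 4
      + to_fract b * (to_fract z / to_fract c) ^ 4 - to_fract d * (to_fract w / to_fract c) ^ 2))"
  proof -
    have "pval p (to_fract (c ^ 4)) = 4 * int (multiplicity p c)"
      using c prime by (simp add: pval_to_fract prime_elem_multiplicity_power_distrib del: to_fract_power)
    then have "4 * m + int N = pval p (to_fract (c ^ 4)) + (4 * n + int N)" by (simp add: m_def)
    then show ?thesis using eq c by (simp only: ple_cancel to_fract_eq_0_iff power_eq_0_iff simp_thms)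
  qed
  also have "to_fract (c ^ 4) * (to_fract (d ^ 2) * (to_fract x / to_fract c) ^ 4
      + to_fract b * (to_fract z / to_fract c) ^ 4 - to_fract d * (to_fract w / to_fract c) ^ 2)
      = to_fract (d ^ 2 * x ^ 4 + b * z ^ 4 - d * (w * c) ^ 2)"
    using c by (simp add: field_simps power2_eq_square numeral_eq_Suc)
  finally have *: "p ^ nat (4 * m + int N) dvd d ^ 2 * x ^ 4 + b * z ^ 4 - d * (w * c) ^ 2"
    unfolding ple_to_fract .
  \<comment> \<open>Primitivity in \<open>approx_solvable\<close> is stated with
    \<open>k + 1\<close>, so \<open>k\<close> is \<open>nat m - 1\<close>; the four surplus orders
    of precision are dropped.\<close>
  have "4 * (nat m - 1) + N \<le> nat (4 * m + int N)" using m by linarith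
  then have "p ^ (4 * (nat m - 1) + N) dvd d ^ 2 * x ^ 4 + b * z ^ 4 - d * (w * c) ^ 2"
    using * power_le_dvd by blast
  moreover have "nat m - 1 + 1 = nat m" using m by simp
  ultimately show ?thesis using nm by metis
qed

text \<open>The quartic form is recovered by x = A, z = t B, w = A W if \<open>A\<close> is not
  null, and by x = B, z = t Z, w = Z W otherwise. A sequence that is not null is followed only along
  infinitely many indices; this suffices, because a single index provides the congruence.\<close>

lemma C_points_imp_approx:
  assumes d: "d \<noteq> 0" and C: "C_points b d p \<noteq> {}"
  shows "approx_solvable p b d"
proof -
  define D B' where "D = to_fract d" and "B' = to_fract b"
  have D0: "D \<noteq> 0" using d by (simp add: D_def)
  obtain A B W Z where C': "{A, B, W, Z} \<subseteq> cauchy_seqs p" "\<not> {A, B, W, Z} \<subseteq> null_seqs p"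
      "(\<lambda>n. to_fract d * W n ^ 2 - (to_fract (d ^ 2) * A n ^ 2 - to_fract (4 * b) * Z n ^ 2)) \<in> null_seqs p"
      "(\<lambda>n. B n ^ 2 - A n * Z n) \<in> null_seqs p"
    using C unfolding C_points_iff by blast
  have cauchy: "A \<in> cauchy_seqs p" "B \<in> cauchy_seqs p" "W \<in> cauchy_seqs p"
      "Z \<in> cauchy_seqs p"
    and nz: "\<not> {A, B, W, Z} \<subseteq> null_seqs p"
    and e1: "(\<lambda>n. D * W n ^ 2 - (D ^ 2 * A n ^ 2 - 4 * B' * Z n ^ 2)) \<in> null_seqs p"
    and e2: "(\<lambda>n. B n ^ 2 - A n * Z n) \<in> null_seqs p"
    using C' by (simp_all add: D_def B'_def)
  have null_cancel: "X \<in> null_seqs p" if "(\<lambda>n. c * X n ^ 2) \<in> null_seqs p" "c \<noteq> 0" for c and X :: "nat \<Rightarrow> qi"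
    unfolding null_seqs_iff
  proof
    fix n
    have "\<forall>\<^sub>F m in sequentially. ple p (pval p c + 2 * n) (c * X m ^ 2)"
      using that(1) unfolding null_seqs_iff by blast
    then show "\<forall>\<^sub>F m in sequentially. ple p n (X m)"
      by eventually_elim (use that(2) in \<open>simp add: ple_cancel ple_power2_iff\<close>)
  qed
  have gt4: "to_fract gt ^ 4 = (- 4 :: qi)"
    by (simp add: gt_power4 flip: to_fract_power)
  obtain X Y V where XY: "X \<notin> null_seqs p \<or> Y \<notin> null_seqs p"
    and e: "(\<lambda>n. D ^ 2 * X n ^ 4 + B' * Y n ^ 4 - D * V n ^ 2) \<in> null_seqs p"
  proof (cases "A \<in> null_seqs p")
    case False
    have "(\<lambda>n. A n ^ 2 * (D * W n ^ 2 - (D ^ 2 * A n ^ 2 - 4 * B' * Z n ^ 2))) \<in> null_seqs p"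
      by (intro null_mult cauchy_power2 cauchy e1)
    moreover have "(\<lambda>n. (4 * B' * (B n ^ 2 + A n * Z n)) * (B n ^ 2 - A n * Z n)) \<in> null_seqs p"
      by (intro null_mult cauchy_mult cauchy_add cauchy_const cauchy_power2 cauchy e2)
    ultimately have "(\<lambda>n. - (A n ^ 2 * (D * W n ^ 2 - (D ^ 2 * A n ^ 2 - 4 * B' * Z n ^ 2)) +
        (4 * B' * (B n ^ 2 + A n * Z n)) * (B n ^ 2 - A n * Z n))) \<in> null_seqs p"
      by (intro null_uminus null_add)
    moreover have "- (A n ^ 2 * (D * W n ^ 2 - (D ^ 2 * A n ^ 2 - 4 * B' * Z n ^ 2)) +
        (4 * B' * (B n ^ 2 + A n * Z n)) * (B n ^ 2 - A n * Z n))
        = D ^ 2 * A n ^ 4 + B' * (to_fract gt * B n) ^ 4 - D * (A n * W n) ^ 2" for n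
      unfolding power_mult_distrib[of "to_fract gt"] gt4
      by (simp add: power2_eq_square numeral_eq_Suc algebra_simps)
    ultimately show thesis using False by (intro that[of A "\<lambda>n. to_fract gt * B n" "\<lambda>n. A n * W n"]) simp_all
  next
    case True
    have "(\<lambda>n. A n * Z n) \<in> null_seqs p" using null_mult[OF cauchy(4) True] by (simp add: mult.commute)
    from null_add[OF e2 this] have B: "B \<in> null_seqs p" using null_cancel[of 1 B] by simp
    \<comment> \<open>Some coordinate is not null: with \<open>A\<close> and \<open>B\<close> null,
      a null \<open>Z\<close> would make \<open>W\<close> null by the first equation.\<close>
    have Z: "Z \<notin> null_seqs p"
    proof
      assume Z: "Z \<in> null_seqs p"
      have "(\<lambda>n. (D ^ 2 * A n) * A n) \<in> null_seqs p" "(\<lambda>n. (4 * B' * Z n) * Z n) \<in> null_seqs p"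
        by (intro null_mult cauchy_mult cauchy_const cauchy True Z)+
      from null_add[OF e1 null_diff[OF this]] have "(\<lambda>n. D * W n ^ 2) \<in> null_seqs p"
        by (simp add: power2_eq_square algebra_simps)
      then have "W \<in> null_seqs p" using D0 by (rule null_cancel)
      then show False using nz True B Z by blast
    qed
    have "(\<lambda>n. Z n ^ 2 * (D * W n ^ 2 - (D ^ 2 * A n ^ 2 - 4 * B' * Z n ^ 2))) \<in> null_seqs p"
      by (intro null_mult cauchy_power2 cauchy e1)
    moreover have "(\<lambda>n. (D ^ 2 * (B n ^ 2 + A n * Z n)) * (B n ^ 2 - A n * Z n)) \<in> null_seqs p"
      by (intro null_mult cauchy_mult cauchy_add cauchy_const cauchy_power2 cauchy e2)
    ultimately have "(\<lambda>n. (D ^ 2 * (B n ^ 2 + A n * Z n)) * (B n ^ 2 - A n * Z n) -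
        (Z n ^ 2 * (D * W n ^ 2 - (D ^ 2 * A n ^ 2 - 4 * B' * Z n ^ 2)))) \<in> null_seqs p"
      by (intro null_diff)
    moreover have "(D ^ 2 * (B n ^ 2 + A n * Z n)) * (B n ^ 2 - A n * Z n) -
        (Z n ^ 2 * (D * W n ^ 2 - (D ^ 2 * A n ^ 2 - 4 * B' * Z n ^ 2)))
        = D ^ 2 * B n ^ 4 + B' * (to_fract gt * Z n) ^ 4 - D * (Z n * W n) ^ 2" for n
      unfolding power_mult_distrib[of "to_fract gt"] gt4
      by (simp add: power2_eq_square numeral_eq_Suc algebra_simps)
    moreover have "(\<lambda>n. to_fract gt * Z n) \<notin> null_seqs p"
    proof
      assume "(\<lambda>n. to_fract gt * Z n) \<in> null_seqs p"
      from null_mult[OF cauchy_const[of "1 / to_fract gt"] this] show False using Z by simp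
    qed
    ultimately show thesis
      by (intro that[of B "\<lambda>n. to_fract gt * Z n" "\<lambda>n. Z n * W n"]) simp_all
  qed
  show ?thesis unfolding approx_solvable_def
  proof
    fix N
    obtain n where n: "\<exists>\<^sub>F m in sequentially. \<not> (ple p n (X m) \<and> ple p n (Y m))"
    proof (cases "X \<in> null_seqs p")
      case False
      then obtain n where "\<exists>\<^sub>F m in sequentially. \<not> ple p n (X m)" by (rule not_null_frequently)
      then show thesis by (intro that) (auto elim: frequently_elim1)
    next
      case True
      then obtain n where "\<exists>\<^sub>F m in sequentially. \<not> ple p n (Y m)"
        using XY not_null_frequently by blast
      then show thesis by (intro that) (auto elim: frequently_elim1)
    qed
    have "\<forall>\<^sub>F m in sequentially. ple p (4 * n + int N) (D ^ 2 * X m ^ 4 + B' * Y m ^ 4 - D * V m ^ 2)"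
      using e unfolding null_seqs_iff by blast
    from frequently_eventually_frequently[OF n this] have "\<exists>\<^sub>F m in sequentially. \<not> (ple p n (X m) \<and> ple p n (Y m)) \<and>
        ple p (4 * n + int N) (D ^ 2 * X m ^ 4 + B' * Y m ^ 4 - D * V m ^ 2)"
      .
    then obtain m where m: "\<not> (ple p n (X m) \<and> ple p n (Y m))"
        "ple p (4 * n + int N) (D ^ 2 * X m ^ 4 + B' * Y m ^ 4 - D * V m ^ 2)"
      using frequently_ex by blast
    obtain x z w c where c: "c \<noteq> 0" "X m = to_fract x / to_fract c" "Y m = to_fract z / to_fract c"
      "V m = to_fract w / to_fract c" by (rule qi_common_denom3)
    show "\<exists>x z w k. \<not> (p ^ (k + 1) dvd x \<and> p ^ (k + 1) dvd z) \<and>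
     p ^ (4 * k + N) dvd d ^ 2 * x ^ 4 + b * z ^ 4 - d * w ^ 2"
      by (rule approx_from_quot[OF c(1), of n x z N d b w])
        (use m in \<open>simp_all add: D_def B'_def c(2-4) power2_eq_square\<close>)
  qed
qed

text \<open>The triple (e x, c z, e c w) carries a solution for \<open>d'\<close> to one for
  \<open>d\<close> and multiplies the form by \<open>c ^ 4\<close>. This is needed because
  membership in the Selmer group only provides some representative \<open>d'\<close> of the class of
  \<open>d\<close>.\<close>

lemma approx_solvable_square_class:
  assumes "c \<noteq> 0" "e \<noteq> 0" "d' * c ^ 2 = d * e ^ 2" "approx_solvable p b d'"
  shows "approx_solvable p b d"
  unfolding approx_solvable_def
proof
  fix N
  \<comment> \<open>Scaling by \<open>e\<close> and \<open>c\<close> raises the valuations of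
    \<open>x\<close> and \<open>z\<close> by at most \<open>s\<close>, so \<open>4 * s\<close>
    further orders of precision are requested.\<close>
  define s where "s = multiplicity p e + multiplicity p c"
  obtain x z w k where *: "\<not> (p ^ (k + 1) dvd x \<and> p ^ (k + 1) dvd z)"
     "p ^ (4 * k + (N + 4 * s)) dvd d' ^ 2 * x ^ 4 + b * z ^ 4 - d' * w ^ 2"
    using assms(4) unfolding approx_solvable_def by blast
  have cancel: "p ^ (k + 1) dvd y" if "p ^ (k + s + 1) dvd f * y" "f \<noteq> 0" "multiplicity p f \<le> s" for f y
  proof (cases "y = 0")
    case False
    have "k + s + 1 \<le> multiplicity p f + multiplicity p y"
      using that False power_dvd_iff_le_multiplicity[of "f * y" p] p_nu prime
      by (metis mult_eq_0_iff prime_elem_multiplicity_mult_distrib)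
    then have "k + 1 \<le> multiplicity p y" using that(3) by linarith
    then show ?thesis by (rule multiplicity_dvd')
  qed simp
  have "\<not> (p ^ (k + s + 1) dvd e * x \<and> p ^ (k + s + 1) dvd c * z)"
    using * cancel[of e x] cancel[of c z] assms(1,2) by (auto simp: s_def)
  moreover have "p ^ (4 * (k + s) + N) dvd d ^ 2 * (e * x) ^ 4 + b * (c * z) ^ 4 - d * (e * c * w) ^ 2"
  proof -
    have de: "d ^ 2 * (e * x) ^ 4 = (d * e ^ 2) ^ 2 * x ^ 4" "d * (e * c * w) ^ 2 = (d * e ^ 2) * c ^ 2 * w ^ 2"
      by (simp_all add: power2_eq_square numeral_eq_Suc algebra_simps)
    have "d ^ 2 * (e * x) ^ 4 + b * (c * z) ^ 4 - d * (e * c * w) ^ 2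
        = c ^ 4 * (d' ^ 2 * x ^ 4 + b * z ^ 4 - d' * w ^ 2)"
      unfolding de assms(3)[symmetric] by (simp add: power2_eq_square numeral_eq_Suc algebra_simps)
    moreover have N: "4 * (k + s) + N = 4 * k + (N + 4 * s)" by simp
    ultimately show ?thesis unfolding N using dvd_mult[OF *(2), of "c ^ 4"] by (simp only:)
  qed
  ultimately show "\<exists>x z w k. \<not> (p ^ (k + 1) dvd x \<and> p ^ (k + 1) dvd z) \<and>
     p ^ (4 * k + N) dvd d ^ 2 * x ^ 4 + b * z ^ 4 - d * w ^ 2" by blast
qed

text \<open>If \<open>d\<close> is square-free at \<open>p\<close>, dividing by the common power of \<open>p\<close> keeps \<open>w\<close> integral.\<close>

lemma approx_solvable_primitive:
  assumes "\<not> p ^ 2 dvd d" "approx_solvable p b d"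
  obtains x z w where "\<not> (p dvd x \<and> p dvd z)" "p ^ N dvd d ^ 2 * x ^ 4 + b * z ^ 4 - d * w ^ 2"
proof -
  obtain x z w k where *: "\<not> (p ^ (k + 1) dvd x \<and> p ^ (k + 1) dvd z)"
     "p ^ (4 * k + N) dvd d ^ 2 * x ^ 4 + b * z ^ 4 - d * w ^ 2"
    using assms(2) unfolding approx_solvable_def by blast
  define j where "j = (LEAST j. \<not> (p ^ (j + 1) dvd x \<and> p ^ (j + 1) dvd z))"
  have j: "\<not> (p ^ (j + 1) dvd x \<and> p ^ (j + 1) dvd z)" "j \<le> k"
    using LeastI[of "\<lambda>j. \<not> (p ^ (j + 1) dvd x \<and> p ^ (j + 1) dvd z)" k] *(1)
      Least_le[of "\<lambda>j. \<not> (p ^ (j + 1) dvd x \<and> p ^ (j + 1) dvd z)" k] unfolding j_def by auto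
  have "p ^ j dvd x \<and> p ^ j dvd z"
  proof (cases j)
    case (Suc i)
    then have "\<not> (\<not> (p ^ (i + 1) dvd x \<and> p ^ (i + 1) dvd z))"
      using not_less_Least[of i "\<lambda>j. \<not> (p ^ (j + 1) dvd x \<and> p ^ (j + 1) dvd z)"] by (simp add: j_def)
    then show ?thesis using Suc by simp
  qed simp
  then obtain x' z' where xz: "x = p ^ j * x'" "z = p ^ j * z'" by (auto elim!: dvdE)
  have 1: "p ^ (4 * j + N) dvd d ^ 2 * x ^ 4 + b * z ^ 4 - d * w ^ 2"
    using *(2) j(2) power_le_dvd[of p "4 * k + N" _ "4 * j + N"] by simp
  have eq: "d ^ 2 * x ^ 4 + b * z ^ 4 = p ^ (4 * j) * (d ^ 2 * x' ^ 4 + b * z' ^ 4)"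
    unfolding xz by (simp add: power_mult_distrib algebra_simps flip: power_mult)
  have "p ^ (4 * j) dvd d * w ^ 2"
  proof -
    have "p ^ (4 * j) dvd d ^ 2 * x ^ 4 + b * z ^ 4 - d * w ^ 2"
      using 1 by (rule power_le_dvd) simp
    then show ?thesis unfolding eq using dvd_diff_right_iff dvd_triv_left by blast
  qed
  \<comment> \<open>\<open>d\<close> has valuation at most 1, so the bound \<open>4 * j\<close> for
    \<open>d * w ^ 2\<close> leaves \<open>4 * j - 1\<close>, and by parity \<open>4 * j\<close>,
    for \<open>w ^ 2\<close>.\<close>
  have "p ^ (2 * j) dvd w"
  proof (cases "w = 0")
    case False
    have d0: "d \<noteq> 0" using assms(1) by auto
    have "multiplicity p d < 2" using assms(1) d0 power_dvd_iff_le_multiplicity[of d p 2] p_nu by auto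
    moreover have "4 * j \<le> multiplicity p (d * w ^ 2)"
      using \<open>p ^ (4 * j) dvd d * w ^ 2\<close> power_dvd_iff_le_multiplicity[of "d * w ^ 2" p] d0 False p_nu by simp
    moreover have "multiplicity p (d * w ^ 2) = multiplicity p d + 2 * multiplicity p w"
      using d0 False prime by (simp add: prime_elem_multiplicity_mult_distrib prime_elem_multiplicity_power_distrib)
    ultimately have "2 * j \<le> multiplicity p w" by linarith
    then show ?thesis by (rule multiplicity_dvd')
  qed simp
  then obtain w' where w: "w = p ^ (2 * j) * w'" ..
  have "d * w ^ 2 = p ^ (4 * j) * (d * w' ^ 2)"
    unfolding w by (simp add: power_mult_distrib algebra_simps flip: power_mult)
  with 1 eq have "p ^ (4 * j) * p ^ N dvd p ^ (4 * j) * (d ^ 2 * x' ^ 4 + b * z' ^ 4 - d * w' ^ 2)"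
    by (simp add: power_add algebra_simps)
  then have "p ^ N dvd d ^ 2 * x' ^ 4 + b * z' ^ 4 - d * w' ^ 2"
    using p_nz by (simp add: dvd_mult_cancel_left)
  moreover have "\<not> (p dvd x' \<and> p dvd z')"
    using j(1) unfolding xz by (auto simp: mult.commute)
  ultimately show thesis using that by blast
qed

section \<open>Square roots by Newton iteration\<close>

primrec newton :: "qi \<Rightarrow> nat \<Rightarrow> qi" where
  "newton u 0 = 1"
| "newton u (Suc n) = (newton u n + u / newton u n) / 2"

text \<open>A step \<open>\<delta>\<close> from \<open>s\<close> satisfies
  \<open>u - (s + \<delta>) ^ 2 = - (\<delta> ^ 2)\<close> exactly, and dividing by
  \<open>2 * s\<close> costs the valuation \<open>c\<close> of 2. An error of valuation
  \<open>2 * c + 1 + n\<close> thus gives a step of valuation at least \<open>c + 1 + n\<close> and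
  a next error of at least twice that; the recorded growth by 1 is enough for convergence. The
  summand 1 keeps all iterates units.\<close>

lemma newton:
  assumes u: "ple p (2 * int (multiplicity p 2) + 1) (u - 1)"
  shows "(newton u n \<noteq> 0 \<and> pval p (newton u n) = 0) \<and>
    ple p (2 * int (multiplicity p 2) + 1 + int n) (u - newton u n ^ 2) \<and>
    ple p (int n) (newton u (Suc n) - newton u n)"
proof (induction n)
  define c where "c = int (multiplicity p 2)"
  have two: "(2 :: qi) \<noteq> 0" "pval p 2 = c" "c \<ge> 0"
    using pval_to_fract[of 2] to_fract_eq_0_iff[of "2 :: gint"] by (simp_all add: c_def gint_eq_iff del: to_fract_eq_0_iff)
  have step: "ple p (c + 1 + int n) (newton u (Suc n) - newton u n)"
    "u - newton u (Suc n) ^ 2 = - ((newton u (Suc n) - newton u n) ^ 2)"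
    "ple p (int n) (newton u (Suc n) - newton u n)"
    if s: "newton u n \<noteq> 0" "pval p (newton u n) = 0"
      and e: "ple p (2 * c + 1 + int n) (u - newton u n ^ 2)" for n
  proof -
    define s where "s = newton u n"
    define \<delta> where "\<delta> = newton u (Suc n) - s"
    have s0: "s \<noteq> 0" "pval p s = 0" using s by (simp_all add: s_def)
    have \<delta>: "(2 * s) * \<delta> = u - s ^ 2"
      using s0 two(1) by (simp add: \<delta>_def s_def[symmetric] field_simps power2_eq_square)
    have "pval p (2 * s) = c" using s0 two by (simp add: pval_mult)
    then have "ple p (pval p (2 * s) + (c + 1 + int n)) ((2 * s) * \<delta>)"
      unfolding \<delta> using e by (simp add: s_def algebra_simps)
    then have "ple p (c + 1 + int n) \<delta>" using s0 two(1) by (subst (asm) ple_cancel) simp_all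
    then show *: "ple p (c + 1 + int n) (newton u (Suc n) - newton u n)"
      unfolding \<delta>_def s_def .
    show "ple p (int n) (newton u (Suc n) - newton u n)"
      using * by (rule ple_mono) (use two(3) in simp)
    have "newton u (Suc n) = s + \<delta>" by (simp add: \<delta>_def)
    then have "u - newton u (Suc n) ^ 2 = (u - s ^ 2) - (2 * s) * \<delta> - \<delta> ^ 2"
      by (simp only:) (simp add: power2_eq_square algebra_simps)
    then show "u - newton u (Suc n) ^ 2 = - ((newton u (Suc n) - newton u n) ^ 2)"
      unfolding \<delta> by (simp add: \<delta>_def s_def)
  qed
  {
    case 0
    have "ple p (2 * c + 1 + int 0) (u - newton u 0 ^ 2)" using u by (simp add: c_def)
    moreover have "newton u 0 \<noteq> 0" "pval p (newton u 0) = 0" by simp_all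
    moreover from calculation have "ple p (int 0) (newton u (Suc 0) - newton u 0)"
      by (intro step(3))
    ultimately show ?case unfolding c_def by blast
  next
    case (Suc n)
    then have n: "newton u n \<noteq> 0" "pval p (newton u n) = 0"
      "ple p (2 * c + 1 + int n) (u - newton u n ^ 2)" unfolding c_def by blast+
    note st = step[OF n]
    have "newton u (Suc n) \<noteq> 0 \<and> pval p (newton u (Suc n)) = 0"
    proof -
      have d1: "ple p 1 (newton u (Suc n) - newton u n)" using st(1) two(3) by (rule_tac ple_mono) auto
      have n0: "ple p 0 (newton u n)" "\<not> ple p 1 (newton u n)" using n by (simp_all add: ple_def)
      have "ple p 0 (newton u n + (newton u (Suc n) - newton u n))"
        using n0 d1 by (intro ple_add) (auto intro: ple_mono)
      then have 0: "ple p 0 (newton u (Suc n))" by (simp del: newton.simps)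
      have 1: "\<not> ple p 1 (newton u (Suc n))"
      proof
        assume "ple p 1 (newton u (Suc n))"
        from ple_diff[OF this d1] show False using n0 by (simp del: newton.simps)
      qed
      show ?thesis using 0 1 unfolding ple_def by auto
    qed
    moreover have e: "ple p (2 * c + 1 + int (Suc n)) (u - newton u (Suc n) ^ 2)"
    proof -
      have "ple p ((c + 1 + int n) + (c + 1 + int n)) ((newton u (Suc n) - newton u n) ^ 2)"
        unfolding power2_eq_square by (intro ple_mult st(1))
      then show ?thesis unfolding st(2) ple_uminus by (rule ple_mono) simp
    qed
    moreover have "ple p (int (Suc n)) (newton u (Suc (Suc n)) - newton u (Suc n))"
      using calculation by (intro step(3)) blast+
    ultimately show ?case unfolding c_def by blast
  }
qed

declare newton.simps(2) [simp del]

lemma newton_sqrt: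
  assumes u: "ple p (2 * int (multiplicity p 2) + 1) (u - 1)"
  shows "newton u \<in> cauchy_seqs p" "(\<lambda>n. newton u n ^ 2 - u) \<in> null_seqs p"
proof -
  note N = newton[OF u]
  have diff: "ple p (int n) (newton u (n + j) - newton u n)" for n j
  proof (induction j)
    case (Suc j)
    have "ple p (int n) (newton u (Suc (n + j)) - newton u (n + j))"
      by (rule ple_mono[of "int (n + j)"]) (use N[of "n + j"] in simp_all)
    from ple_add[OF this Suc] show ?case by simp
  qed simp
  show "newton u \<in> cauchy_seqs p" unfolding cauchy_seqs_iff
  proof (intro allI exI impI)
    fix n :: int and m k assume "nat n \<le> m" "nat n \<le> k"
    then have "ple p (int (nat n)) (newton u m - newton u (nat n))"
      "ple p (int (nat n)) (newton u k - newton u (nat n))"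
      using diff[of "nat n" "m - nat n"] diff[of "nat n" "k - nat n"] by simp_all
    from ple_diff[OF this] show "ple p n (newton u m - newton u k)" by (simp add: ple_mono)
  qed
  show "(\<lambda>n. newton u n ^ 2 - u) \<in> null_seqs p" unfolding null_seqs_iff
  proof (intro allI eventually_sequentiallyI)
    fix n :: int and m assume "nat n \<le> m"
    then have "ple p n (u - newton u m ^ 2)"
      by (intro ple_mono[OF conjunct1[OF conjunct2[OF N[of m]]]]) linarith
    then show "ple p n (newton u m ^ 2 - u)" using ple_uminus[of n "u - newton u m ^ 2"] by simp
  qed
qed

text \<open>The quotient \<open>u\<close> of \<open>d ^ 2 * x ^ 4 + b * z ^ 4\<close> by
  \<open>d * w ^ 2\<close> is 1 modulo \<open>p ^ (2 * c + 1)\<close>, so multiplying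
  \<open>w\<close> by a square root of \<open>u\<close> makes the equation exact. The point is (t^2
  x^2, t x z, t^2 w sqrt(u), z^2).\<close>

lemma unit_solvable_imp_C_points:
  assumes "unit_solvable p b d"
  shows "C_points b d p \<noteq> {}"
proof -
  define c where "c = int (multiplicity p 2)"
  obtain x z w n where *: "\<not> p ^ (n + 1) dvd d * w ^ 2"
     "p ^ (n + 2 * multiplicity p 2 + 1) dvd d ^ 2 * x ^ 4 + b * z ^ 4 - d * w ^ 2"
    using assms unfolding unit_solvable_def by blast
  define f where "f = d ^ 2 * x ^ 4 + b * z ^ 4"
  define g where "g = d * w ^ 2"
  have g0: "g \<noteq> 0" using *(1) by (auto simp: g_def)
  define u where "u = to_fract f / to_fract g"
  have "multiplicity p g < n + 1"
    using *(1) g0 power_dvd_iff_le_multiplicity[of g p "n + 1"] p_nu by (auto simp: g_def)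
  then have "nat (2 * c + 1 + int (multiplicity p g)) \<le> n + 2 * multiplicity p 2 + 1"
    by (simp add: c_def)
  from power_le_dvd[OF *(2) this] have "ple p (2 * c + 1) (to_fract (f - g) / to_fract g)"
    unfolding ple_quot[OF g0] f_def[symmetric] g_def[symmetric] .
  then have u1: "ple p (2 * c + 1) (u - 1)" using g0 by (simp add: u_def diff_divide_distrib)
  note S = newton_sqrt[OF u1[unfolded c_def]]
  define t where "t = to_fract gt"
  define X Z W D B where "X = to_fract x" and "Z = to_fract z" and "W = to_fract w"
    and "D = to_fract d" and "B = to_fract b"
  have xz: "\<not> (x = 0 \<and> z = 0)"
  proof
    assume xz: "x = 0 \<and> z = 0"
    have "p ^ (n + 1) dvd d ^ 2 * x ^ 4 + b * z ^ 4 - d * w ^ 2"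
      using *(2) by (rule power_le_dvd) simp
    then show False using xz *(1) by simp
  qed
  have gt4: "t ^ 4 = - 4"
    by (simp add: t_def gt_power4 flip: to_fract_power)
  have t0: "t \<noteq> 0" by (simp add: t_def)
  have four: "to_fract (4 * b) = 4 * B"
    by (simp add: B_def)
  have uf: "D * W ^ 2 * u = D ^ 2 * X ^ 4 + B * Z ^ 4"
  proof -
    have "to_fract g * u = to_fract f" using g0 by (simp add: u_def)
    then show ?thesis by (simp add: g_def f_def D_def W_def X_def Z_def B_def numeral_eq_Suc power2_eq_square)
  qed
  have "(\<lambda>n. (t ^ 4 * D * W ^ 2) * (newton u n ^ 2 - u)) \<in> null_seqs p"
    by (intro null_mult cauchy_const S)
  moreover have "(t ^ 4 * D * W ^ 2) * (newton u n ^ 2 - u) =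
    D * (t ^ 2 * W * newton u n) ^ 2 - (D ^ 2 * (t ^ 2 * X ^ 2) ^ 2 - 4 * B * (Z ^ 2) ^ 2)" for n
  proof -
    have "(t ^ 4 * D * W ^ 2) * (newton u n ^ 2 - u) = t ^ 4 * D * W ^ 2 * newton u n ^ 2 - t ^ 4 * (D * W ^ 2 * u)"
      by (simp add: algebra_simps)
    also have "\<dots> = t ^ 4 * D * W ^ 2 * newton u n ^ 2 - t ^ 4 * D ^ 2 * X ^ 4 - (- 4) * B * Z ^ 4"
      unfolding uf gt4[symmetric] by (simp add: algebra_simps)
    also have "\<dots> = D * (t ^ 2 * W * newton u n) ^ 2 - (D ^ 2 * (t ^ 2 * X ^ 2) ^ 2 - 4 * B * (Z ^ 2) ^ 2)"
      by (simp add: power_mult_distrib algebra_simps flip: power_mult)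
    finally show ?thesis .
  qed
  ultimately have 1: "(\<lambda>n. D * (t ^ 2 * W * newton u n) ^ 2 -
      (to_fract (d ^ 2) * (t ^ 2 * X ^ 2) ^ 2 - to_fract (4 * b) * (Z ^ 2) ^ 2)) \<in> null_seqs p"
    unfolding four by (simp add: D_def power2_eq_square)
  have 2: "(\<lambda>n. (t * X * Z) ^ 2 - t ^ 2 * X ^ 2 * Z ^ 2) \<in> null_seqs p"
    by (simp add: power_mult_distrib)
  have 3: "\<not> {\<lambda>n. t ^ 2 * X ^ 2, \<lambda>n. t * X * Z, \<lambda>n. t ^ 2 * W * newton u n, \<lambda>n. Z ^ 2} \<subseteq> null_seqs p"
    using xz t0 by (auto simp: X_def Z_def)
  have 4: "{\<lambda>n. t ^ 2 * X ^ 2, \<lambda>n. t * X * Z, \<lambda>n. t ^ 2 * W * newton u n, \<lambda>n. Z ^ 2} \<subseteq> cauchy_seqs p"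
    using cauchy_mult[OF cauchy_const S(1)] by simp
  show ?thesis unfolding C_points_iff
    using 1 2 3 4 unfolding D_def by blast
qed

end

section \<open>The ring of integers of the completion\<close>

context gprime
begin

lemma pval_add_eq:
  assumes "x \<noteq> 0" "pval p x < n" "ple p n y"
  shows "x + y \<noteq> 0" "pval p (x + y) = pval p x"
proof -
  have "ple p (pval p x) (x + y)"
    using assms by (intro ple_add) (auto simp: ple_def)
  moreover have "\<not> ple p (pval p x + 1) (x + y)"
  proof
    assume "ple p (pval p x + 1) (x + y)"
    moreover have "ple p (pval p x + 1) y" using ple_mono[OF assms(3)] assms(2) by simp
    ultimately have "ple p (pval p x + 1) x" using ple_diff by fastforce
    then show False using not_ple_large[OF assms(1)] by simp
  qed
  ultimately show "x + y \<noteq> 0" "pval p (x + y) = pval p x" by (auto simp: ple_def)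
qed

lemma cl_iff: "Y \<in> cl X \<longleftrightarrow> (\<exists>h\<in>null_seqs p. Y = (\<lambda>n. h n + X n))"
  by (auto simp: cl_def a_r_coset_def')

lemma completion_abs_eqI:
  assumes "\<And>Y. Y \<in> cl X \<Longrightarrow> (\<lambda>n. pabs p (Y n)) \<longlonglongrightarrow> l"
  shows "completion_abs p (cl X) = l"
  unfolding completion_abs_def
proof (rule the_equality)
  have X: "X \<in> cl X" unfolding cl_iff by (rule bexI[of _ "\<lambda>n. 0"]) simp_all
  fix l' assume "\<forall>Y\<in>cl X. (\<lambda>n. pabs p (Y n)) \<longlonglongrightarrow> l'"
  then show "l' = l" using assms[OF X] X LIMSEQ_unique by blast
qed (use assms in blast)

text \<open>Along a Cauchy sequence that is not null the valuation is eventually constant, with the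
  same value for every representative of its class. Hence the limit in \<open>completion_abs\<close>
  exists and integrality can be read off from the terms.\<close>

lemma completion_abs_le_1_iff:
  assumes X: "X \<in> cauchy_seqs p"
  shows "completion_abs p (cl X) \<le> 1 \<longleftrightarrow> (\<forall>\<^sub>F n in sequentially. ple p 0 (X n))"
proof (cases "X \<in> null_seqs p")
  case True
  have "completion_abs p (cl X) = 0"
  proof (rule completion_abs_eqI)
    fix Y assume "Y \<in> cl X"
    then have "Y \<in> null_seqs p" using null_add True by (auto simp: cl_iff)
    then show "(\<lambda>n. pabs p (Y n)) \<longlonglongrightarrow> 0" by (simp add: null_seqs_def)
  qed
  moreover have "\<forall>\<^sub>F n in sequentially. ple p 0 (X n)" using True by (simp add: null_seqs_iff)
  ultimately show ?thesis by simp
next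
  case False
  then obtain n0 where n0: "\<exists>\<^sub>F m in sequentially. \<not> ple p n0 (X m)" by (rule not_null_frequently)
  obtain N where N: "\<forall>m\<ge>N. \<forall>k\<ge>N. ple p n0 (X m - X k)" using X unfolding cauchy_seqs_iff by blast
  obtain m0 where m0: "m0 \<ge> N" "\<not> ple p n0 (X m0)"
    using n0 unfolding frequently_sequentially by blast
  define k where "k = pval p (X m0)"
  have k: "X m0 \<noteq> 0" "pval p (X m0) < n0" using m0(2) by (auto simp: ple_def)
  have ev: "\<forall>\<^sub>F m in sequentially. Y m \<noteq> 0 \<and> pval p (Y m) = k" if "Y \<in> cl X" for Y
  proof -
    obtain h where h: "h \<in> null_seqs p" "Y = (\<lambda>n. h n + X n)" using \<open>Y \<in> cl X\<close> by (auto simp: cl_iff)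
    have "\<forall>\<^sub>F m in sequentially. ple p n0 (h m)" using h(1) by (simp add: null_seqs_iff)
    moreover have "\<forall>\<^sub>F m in sequentially. N \<le> m" by (rule eventually_ge_at_top)
    ultimately show ?thesis
    proof eventually_elim
      case (elim m)
      have "ple p n0 (h m + (X m - X m0))" using elim N m0(1) by (intro ple_add) auto
      from pval_add_eq[OF k this] show ?case by (simp add: h(2) k_def)
    qed
  qed
  have "completion_abs p (cl X) = v powi (- k)"
  proof (rule completion_abs_eqI)
    fix Y assume "Y \<in> cl X"
    from ev[OF this] have "\<forall>\<^sub>F m in sequentially. pabs p (Y m) = v powi (- k)"
      by eventually_elim (simp add: pabs_eq)
    then show "(\<lambda>n. pabs p (Y n)) \<longlonglongrightarrow> v powi (- k)" by (rule tendsto_eventually)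
  qed
  also have "\<dots> \<le> 1 \<longleftrightarrow> ple p 0 (X m0)"
    using pabs_le_iff[of "X m0" 0] k by (simp add: pabs_eq k_def)
  also have "\<dots> \<longleftrightarrow> 0 \<le> k" using k by (simp add: ple_def k_def)
  also have "\<dots> \<longleftrightarrow> (\<forall>\<^sub>F n in sequentially. ple p 0 (X n))"
  proof -
    have X': "X \<in> cl X" unfolding cl_iff by (rule bexI[of _ "\<lambda>n. 0"]) simp_all
    show ?thesis
    proof
      assume "0 \<le> k"
      with ev[OF X'] show "\<forall>\<^sub>F n in sequentially. ple p 0 (X n)"
        by (auto simp: ple_def elim: eventually_mono)
    next
      assume "\<forall>\<^sub>F n in sequentially. ple p 0 (X n)"
      from eventually_conj[OF this ev[OF X']] have "\<exists>n. ple p 0 (X n) \<and> X n \<noteq> 0 \<and> pval p (X n) = k"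
        using eventually_happens by fastforce
      then show "0 \<le> k" by (auto simp: ple_def)
    qed
  qed
  finally show ?thesis .
qed

definition ints :: "(nat \<Rightarrow> qi) set" where
  "ints = {X \<in> cauchy_seqs p. \<forall>\<^sub>F n in sequentially. ple p 0 (X n)}"

abbreviation R where "R \<equiv> completion_ints p"

lemma carrier_R: "carrier R = cl ` ints"
  by (auto simp: completion_ints_def carrier_K ints_def completion_abs_le_1_iff)

lemma R_simps [simp]: "x \<otimes>\<^bsub>R\<^esub> y = x \<otimes>\<^bsub>K\<^esub> y" "x \<oplus>\<^bsub>R\<^esub> y = x \<oplus>\<^bsub>K\<^esub> y"
  "\<one>\<^bsub>R\<^esub> = \<one>\<^bsub>K\<^esub>" "\<zero>\<^bsub>R\<^esub> = \<zero>\<^bsub>K\<^esub>"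
  by (simp_all add: completion_ints_def)

lemma ints_cauchy: "X \<in> ints \<Longrightarrow> X \<in> cauchy_seqs p"
  by (simp add: ints_def)

lemma ints_const [simp]: "(\<lambda>n. to_fract a) \<in> ints"
  by (simp add: ints_def)

lemma ints_add: "X \<in> ints \<Longrightarrow> Y \<in> ints \<Longrightarrow> (\<lambda>n. X n + Y n) \<in> ints"
  and ints_mult: "X \<in> ints \<Longrightarrow> Y \<in> ints \<Longrightarrow> (\<lambda>n. X n * Y n) \<in> ints"
  and ints_uminus: "X \<in> ints \<Longrightarrow> (\<lambda>n. - X n) \<in> ints"
  unfolding ints_def using ple_add ple_mult_unit
  by (auto intro: cauchy_add cauchy_mult cauchy_uminus elim: eventually_elim2)

lemma ints_diff: "X \<in> ints \<Longrightarrow> Y \<in> ints \<Longrightarrow> (\<lambda>n. X n - Y n) \<in> ints"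
  using ints_add[of X "\<lambda>n. - Y n"] ints_uminus[of Y] by simp

lemma cring_R: "cring R"
proof -
  interpret K: cring K by (rule cring_K)
  have sub: "cl ` ints \<subseteq> carrier K" using ints_cauchy by (auto simp: carrier_K)
  have "subring (cl ` ints) K"
  proof (rule K.subringI[OF sub])
    show "\<one>\<^bsub>K\<^esub> \<in> cl ` ints" using ints_const[of 1] by (auto simp: cl_one)
    fix h assume "h \<in> cl ` ints"
    then show "\<ominus>\<^bsub>K\<^esub> h \<in> cl ` ints" using ints_uminus ints_cauchy by (auto simp: cl_uminus)
  next
    fix h1 h2 assume "h1 \<in> cl ` ints" "h2 \<in> cl ` ints"
    then obtain X Y where XY: "X \<in> ints" "Y \<in> ints" "h1 = cl X" "h2 = cl Y" by blast
    show "h1 \<otimes>\<^bsub>K\<^esub> h2 \<in> cl ` ints" "h1 \<oplus>\<^bsub>K\<^esub> h2 \<in> cl ` ints"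
      using XY ints_cauchy ints_mult[OF XY(1,2)] ints_add[OF XY(1,2)] by (auto simp: cl_mult cl_add)
  qed
  then have "cring (K\<lparr>carrier := cl ` ints\<rparr>)"
    using K.subcringI' K.subcring_iff[OF sub] by blast
  moreover have "R = K\<lparr>carrier := cl ` ints\<rparr>"
    using carrier_R by (simp add: completion_ints_def)
  ultimately show ?thesis by simp
qed

lemma R_minus: assumes "X \<in> ints" shows "\<ominus>\<^bsub>R\<^esub> cl X = cl (\<lambda>n. - X n)"
proof -
  interpret R: cring R by (rule cring_R)
  show ?thesis
    by (rule R.minus_equality)
      (use assms ints_uminus[OF assms] in \<open>auto simp: carrier_R ints_cauchy cl_add cauchy_uminus cl_zero\<close>)
qed

lemma R_diff: "X \<in> ints \<Longrightarrow> Y \<in> ints \<Longrightarrow> cl X \<ominus>\<^bsub>R\<^esub> cl Y = cl (\<lambda>n. X n - Y n)"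
  by (simp add: a_minus_def R_minus ints_cauchy cl_add cauchy_uminus)

lemma R_power2: assumes "X \<in> ints" shows "cl X [^]\<^bsub>R\<^esub> (2::nat) = cl (\<lambda>n. X n ^ 2)"
proof -
  interpret R: cring R by (rule cring_R)
  have "cl X \<in> carrier R" using assms by (simp add: carrier_R)
  then have "cl X [^]\<^bsub>R\<^esub> (2::nat) = cl X \<otimes>\<^bsub>R\<^esub> cl X"
    by (simp only: numeral_2_eq_2 R.nat_pow_Suc R.nat_pow_0 R.l_one)
  then show ?thesis using assms by (simp add: ints_cauchy cl_mult power2_eq_square)
qed

lemma R_ring_cong_iff:
  assumes "X \<in> ints" "Y \<in> ints"
  shows "ring_cong R (loc p c) (cl X) (cl Y) \<longleftrightarrow>
    (\<exists>Z\<in>ints. (\<lambda>n. X n - Y n - Z n * to_fract c) \<in> null_seqs p)"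
proof -
  have "ring_cong R (loc p c) (cl X) (cl Y) \<longleftrightarrow> (\<exists>Z\<in>ints. cl (\<lambda>n. X n - Y n) = cl Z \<otimes>\<^bsub>K\<^esub> loc p c)"
    using assms by (auto simp: ring_cong_def cgenideal_def R_diff carrier_R)
  also have "\<dots> \<longleftrightarrow> (\<exists>Z\<in>ints. (\<lambda>n. X n - Y n - Z n * to_fract c) \<in> null_seqs p)"
    using assms by (intro bex_cong)
      (auto simp: loc_eq cl_mult cl_eq_iff ints_cauchy cauchy_diff cauchy_mult)
  finally show ?thesis .
qed

end

interpretation GT: gprime gt
  by unfold_locales (rule prime_elem_gt)

text \<open>An odd denominator \<open>y'\<close> is inverted modulo \<open>gt ^ 7\<close> by
  \<open>y' ^ 3\<close>, since \<open>y' ^ 4\<close> is 1 there.\<close>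

lemma ple_gt_approx:
  assumes "ple gt 0 a"
  obtains g where "ple gt 7 (a - to_fract g)"
proof (cases "a = 0")
  case True
  then show thesis using that[of 0] by simp
next
  case False
  obtain x y where xy: "a = Fraction_Field.Fract x y" "y \<noteq> 0" "x \<noteq> 0"
    using False by (metis Fract_cases_nonzero)
  obtain y' where y': "y = gt ^ multiplicity gt y * y'" "\<not> gt dvd y'"
    using multiplicity_decompose'[OF xy(2)] GT.p_nu by metis
  have "a = to_fract x / to_fract y" using xy by (simp add: Fract_conv_to_fract)
  then have "gt ^ multiplicity gt y dvd x" using assms GT.ple_quot[OF xy(2), of 0 x] by simp
  then obtain x' where x': "x = gt ^ multiplicity gt y * x'" ..
  have y0: "y' \<noteq> 0" using y'(2) by auto
  have a: "a = to_fract x' / to_fract y'"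
    using xy x' y' y0 by (metis Fract_conv_to_fract mult_fract_cancel mult_eq_0_iff)
  have "a - to_fract (x' * y' ^ 3) = to_fract (x' * (1 - y' ^ 4)) / to_fract y'"
    using y0 by (simp add: a field_simps numeral_eq_Suc)
  moreover have "multiplicity gt y' = 0" using y' by (simp add: not_dvd_imp_multiplicity_0)
  moreover have "gt ^ 7 dvd x' * (1 - y' ^ 4)"
    using gt_odd_fourth_power[OF y'(2)] by (simp add: dvd_diff_commute)
  ultimately have "ple gt 7 (a - to_fract (x' * y' ^ 3))"
    using GT.ple_quot[OF y0, of 7 "x' * (1 - y' ^ 4)"] by simp
  then show thesis by (rule that)
qed

text \<open>The congruence in (C) sees the unit of the completion only modulo \<open>gt ^ 7\<close>,
  where a Gaussian integer can replace it. That integer is odd because the unit has an integral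
  inverse. Condition (C) thereby becomes a statement about Z[i].\<close>

lemma unit_square_cong_iff:
  "(\<exists>\<alpha>\<in>Units (completion_ints gt). ring_cong (completion_ints gt) (loc gt (gt ^ 7)) (loc gt b)
     (\<ominus>\<^bsub>completion_ints gt\<^esub> loc gt d \<otimes>\<^bsub>completion_ints gt\<^esub>
       (loc gt d \<ominus>\<^bsub>completion_ints gt\<^esub>
         \<alpha> [^]\<^bsub>completion_ints gt\<^esub> (2::nat) \<otimes>\<^bsub>completion_ints gt\<^esub> loc gt (gt ^ e)))) \<longleftrightarrow>
   (\<exists>a. \<not> gt dvd a \<and> gt ^ 7 dvd b + d * (d - a ^ 2 * gt ^ e))" (is "?L \<longleftrightarrow> ?R")
proof -
  define b' d' t' where "b' = to_fract b" and "d' = to_fract d" and "t' = to_fract (gt ^ e)"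
  have int_c: "(\<lambda>n. b') \<in> GT.ints" "(\<lambda>n. d') \<in> GT.ints" "(\<lambda>n. t') \<in> GT.ints"
    unfolding b'_def d'_def t'_def by (rule GT.ints_const)+
  have main: "ring_cong GT.R (loc gt (gt ^ 7)) (loc gt b)
       (\<ominus>\<^bsub>GT.R\<^esub> loc gt d \<otimes>\<^bsub>GT.R\<^esub>
         (loc gt d \<ominus>\<^bsub>GT.R\<^esub> (GT.cl A) [^]\<^bsub>GT.R\<^esub> (2::nat) \<otimes>\<^bsub>GT.R\<^esub> loc gt (gt ^ e))) \<longleftrightarrow>
     (\<exists>Z\<in>GT.ints. (\<lambda>n. b' - (- d' * (d' - A n ^ 2 * t')) - Z n * to_fract (gt ^ 7)) \<in> null_seqs gt)"
    if A: "A \<in> GT.ints" for A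
  proof -
    have A2: "(\<lambda>n. A n ^ 2) \<in> GT.ints" using GT.ints_mult[OF A A] by (simp add: power2_eq_square)
    have A3: "(\<lambda>n. A n ^ 2 * t') \<in> GT.ints" by (rule GT.ints_mult[OF A2 int_c(3)])
    have A4: "(\<lambda>n. d' - A n ^ 2 * t') \<in> GT.ints" by (rule GT.ints_diff[OF int_c(2) A3])
    have d5: "(\<lambda>n. - d') \<in> GT.ints" by (rule GT.ints_uminus[OF int_c(2)])
    have A5: "(\<lambda>n. - d' * (d' - A n ^ 2 * t')) \<in> GT.ints" by (rule GT.ints_mult[OF d5 A4])
    have "\<ominus>\<^bsub>GT.R\<^esub> loc gt d \<otimes>\<^bsub>GT.R\<^esub>
         (loc gt d \<ominus>\<^bsub>GT.R\<^esub> (GT.cl A) [^]\<^bsub>GT.R\<^esub> (2::nat) \<otimes>\<^bsub>GT.R\<^esub> loc gt (gt ^ e))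
       = GT.cl (\<lambda>n. - d' * (d' - A n ^ 2 * t'))"
      unfolding GT.loc_eq[of d] GT.loc_eq[of "gt ^ e"] d'_def[symmetric] t'_def[symmetric]
      using GT.R_power2[OF A] GT.R_minus[OF int_c(2)] GT.R_diff[OF int_c(2) A3]
        GT.cl_mult[OF GT.ints_cauchy[OF A2] GT.ints_cauchy[OF int_c(3)]]
        GT.cl_mult[OF GT.ints_cauchy[OF d5] GT.ints_cauchy[OF A4]]
      by simp
    then show ?thesis using GT.R_ring_cong_iff[OF int_c(1) A5, of "gt ^ 7"]
      by (simp only: GT.loc_eq[of b] b'_def[symmetric])
  qed
  show ?thesis
  proof
    assume ?L
    then obtain \<alpha> where \<alpha>: "\<alpha> \<in> Units GT.R" "ring_cong GT.R (loc gt (gt ^ 7)) (loc gt b)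
       (\<ominus>\<^bsub>GT.R\<^esub> loc gt d \<otimes>\<^bsub>GT.R\<^esub>
         (loc gt d \<ominus>\<^bsub>GT.R\<^esub> \<alpha> [^]\<^bsub>GT.R\<^esub> (2::nat) \<otimes>\<^bsub>GT.R\<^esub> loc gt (gt ^ e)))" by blast
    then obtain \<beta> where "\<alpha> \<in> carrier GT.R" "\<beta> \<in> carrier GT.R" "\<alpha> \<otimes>\<^bsub>GT.K\<^esub> \<beta> = \<one>\<^bsub>GT.K\<^esub>"
      unfolding Units_def by auto
    then obtain A B where A: "A \<in> GT.ints" "\<alpha> = GT.cl A" and B: "B \<in> GT.ints"
      and AB: "(\<lambda>n. A n * B n - 1) \<in> null_seqs gt"
      by (auto simp: GT.carrier_R GT.cl_mult GT.ints_cauchy GT.cl_one GT.cl_eq_iff GT.cauchy_mult)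
    obtain Z where Z: "Z \<in> GT.ints"
      "(\<lambda>n. b' - (- d' * (d' - A n ^ 2 * t')) - Z n * to_fract (gt ^ 7)) \<in> null_seqs gt"
      using \<alpha>(2) main[OF A(1)] A(2) by blast
    have "\<forall>\<^sub>F n in sequentially. ple gt 0 (A n) \<and> ple gt 0 (B n) \<and> ple gt 0 (Z n) \<and>
        ple gt 1 (A n * B n - 1) \<and> ple gt 7 (b' - (- d' * (d' - A n ^ 2 * t')) - Z n * to_fract (gt ^ 7))"
      using A(1) B Z AB unfolding GT.ints_def GT.null_seqs_iff by (intro eventually_conj) blast+
    then obtain n where n: "ple gt 0 (A n)" "ple gt 0 (B n)" "ple gt 0 (Z n)" "ple gt 1 (A n * B n - 1)"
        "ple gt 7 (b' - (- d' * (d' - A n ^ 2 * t')) - Z n * to_fract (gt ^ 7))"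
      using eventually_happens[of _ sequentially] by fastforce
    define a where "a = A n"
    obtain g where g: "ple gt 7 (a - to_fract g)" using n(1) ple_gt_approx by (auto simp: a_def)
    have "ple gt 7 (Z n * to_fract (gt ^ 7))"
      using GT.ple_mult_unit[OF n(3), of 7 "to_fract (gt ^ 7)"] GT.ple_to_fract[of 7 "gt ^ 7"] by simp
    from GT.ple_add[OF n(5) this] have 1: "ple gt 7 (b' + d' * (d' - a ^ 2 * t'))"
      by (simp add: a_def algebra_simps)
    have "ple gt 0 (a + to_fract g)" using n(1) by (intro GT.ple_add) (simp_all add: a_def)
    from GT.ple_mult_unit[OF this g] have ag: "ple gt 7 ((a + to_fract g) * (a - to_fract g))" .
    have "ple gt 0 (d' * t')"
      using GT.ple_to_fract_0[of "d * gt ^ e"] unfolding d'_def t'_def by (simp only: to_fract_mult)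
    from GT.ple_mult_unit[OF this ag]
    have 2: "ple gt 7 (d' * t' * ((a + to_fract g) * (a - to_fract g)))" .
    have "b' + d' * (d' - a ^ 2 * t') + d' * t' * ((a + to_fract g) * (a - to_fract g))
        = to_fract (b + d * (d - g ^ 2 * gt ^ e))"
      by (simp add: b'_def d'_def t'_def algebra_simps power2_eq_square)
    with GT.ple_add[OF 1 2] have "gt ^ 7 dvd b + d * (d - g ^ 2 * gt ^ e)"
      using GT.ple_to_fract[of 7] by (simp only:) simp
    moreover have "\<not> gt dvd g"
    proof
      assume "gt dvd g"
      then have "ple gt 1 (to_fract g)" by (simp add: GT.ple_to_fract)
      from GT.ple_add[OF GT.ple_mono[OF g, of 1] this] have "ple gt 1 a" by simp
      from GT.ple_mult_unit[OF n(2) this] have "ple gt 1 (A n * B n)" by (simp add: a_def mult.commute)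
      from GT.ple_diff[OF this n(4)] have "ple gt 1 1" by simp
      then show False by (simp add: ple_def)
    qed
    ultimately show ?R by blast
  next
    assume ?R
    then obtain a q where a: "\<not> gt dvd a" "b + d * (d - a ^ 2 * gt ^ e) = gt ^ 7 * q" by blast
    define A where "A = (\<lambda>n::nat. to_fract a)"
    define B where "B = (\<lambda>n::nat. 1 / to_fract a)"
    have a0: "a \<noteq> 0" using a(1) by auto
    have A: "A \<in> GT.ints" unfolding A_def by (rule GT.ints_const)
    have "multiplicity gt a = 0" using a by (simp add: not_dvd_imp_multiplicity_0)
    then have "ple gt 0 (1 / to_fract a)" using GT.ple_quot[OF a0, of 0 1] by simp
    then have B: "B \<in> GT.ints" by (simp add: GT.ints_def B_def)
    have "GT.cl A \<otimes>\<^bsub>GT.K\<^esub> GT.cl B = \<one>\<^bsub>GT.K\<^esub>" "GT.cl B \<otimes>\<^bsub>GT.K\<^esub> GT.cl A = \<one>\<^bsub>GT.K\<^esub>"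
      using A B a0 by (simp_all add: GT.cl_mult GT.ints_cauchy GT.cl_one) (simp_all add: A_def B_def)
    then have "GT.cl A \<in> Units GT.R" using A B by (auto simp: Units_def GT.carrier_R)
    moreover have "(\<lambda>n. b' - (- d' * (d' - A n ^ 2 * t')) - to_fract q * to_fract (gt ^ 7)) \<in> null_seqs gt"
    proof -
      have "b' - (- d' * (d' - A n ^ 2 * t')) = to_fract (b + d * (d - a ^ 2 * gt ^ e))" for n
        by (simp add: b'_def d'_def t'_def A_def)
      then show ?thesis unfolding a(2) by (simp add: mult.commute)
    qed
    then have "\<exists>Z\<in>GT.ints. (\<lambda>n. b' - (- d' * (d' - A n ^ 2 * t')) - Z n * to_fract (gt ^ 7)) \<in> null_seqs gt"
      by (intro bexI[of _ "\<lambda>n. to_fract q"]) (simp_all only: GT.ints_const)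
    ultimately show ?L using main[OF A] by blast
  qed
qed

section \<open>Solvability at the prime above 2\<close>

lemma multiplicity_gt_2: "multiplicity gt 2 = 2"
proof (rule multiplicity_eqI)
  show "gt ^ 2 dvd 2" by (subst two_eq_gt) simp
  show "\<not> gt ^ Suc 2 dvd 2"
  proof
    assume "gt ^ Suc 2 dvd 2"
    from Nm_dvd[OF this] show False by (simp add: Nm_mult Nm_def numeral_eq_Suc)
  qed
qed

lemma gt_dvd_odd_diff: "\<not> gt dvd x \<Longrightarrow> \<not> gt dvd y \<Longrightarrow> gt dvd x - y"
  and gt_dvd_odd_add: "\<not> gt dvd x \<Longrightarrow> \<not> gt dvd y \<Longrightarrow> gt dvd x + y"
  by (auto simp: gt_dvd_iff)

lemma dvd_power_mult_cancel:
  fixes p :: "'a :: idom"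
  assumes "p \<noteq> 0" shows "p ^ (n + m) dvd p ^ n * y \<longleftrightarrow> p ^ m dvd y"
  using assms by (simp add: power_add dvd_mult_cancel_left)

lemma (in gprime) power_dvd_power_mult_imp_le:
  assumes "p ^ m dvd p ^ n * y" "\<not> p dvd y"
  shows "m \<le> n"
proof (rule ccontr)
  assume "\<not> m \<le> n"
  then have "p ^ (n + 1) dvd p ^ n * y" using assms(1) power_le_dvd by (metis Suc_eq_plus1 not_less_eq_eq)
  then show False using dvd_power_mult_cancel[OF p_nz, of n 1 y] assms(2) by simp
qed

lemma (in gprime) power_cong_imp_eq:
  assumes "p ^ N dvd p ^ m * x - p ^ n * y" "\<not> p dvd x" "\<not> p dvd y" "m < N"
  shows "m = n"
proof (rule antisym)
  show "n \<le> m"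
  proof (rule ccontr)
    assume "\<not> n \<le> m"
    then have "p ^ (m + 1) dvd p ^ n * y" by (intro dvd_mult2 le_imp_power_dvd) simp
    moreover have "p ^ (m + 1) dvd p ^ m * x - p ^ n * y" using power_le_dvd[OF assms(1), of "m + 1"] assms(4) by simp
    ultimately have "p ^ (m + 1) dvd p ^ m * x" by (metis dvd_add diff_add_cancel)
    then show False using power_dvd_power_mult_imp_le[of "m + 1" m x] assms(2) by simp
  qed
  show "m \<le> n"
  proof (rule ccontr)
    assume "\<not> m \<le> n"
    then have "p ^ (n + 1) dvd p ^ m * x" by (intro dvd_mult2 le_imp_power_dvd) simp
    moreover have "p ^ (n + 1) dvd p ^ m * x - p ^ n * y"
      using power_le_dvd[OF assms(1), of "n + 1"] assms(4) \<open>\<not> m \<le> n\<close> by simp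
    ultimately have "p ^ (n + 1) dvd p ^ m * x - (p ^ m * x - p ^ n * y)" by (rule dvd_diff)
    then have "p ^ (n + 1) dvd p ^ n * y" by simp
    then show False using power_dvd_power_mult_imp_le[of "n + 1" n y] assms(3) by simp
  qed
qed

text \<open>Units congruent to \<open>1\<close> modulo \<open>gt ^ 7\<close> are fourth powers: as \<open>4 = - gt ^ 4\<close>, replacing \<open>z\<close> by
  \<open>z (1 + s)\<close> with \<open>s = gt ^ (n + 3)\<close> changes \<open>z ^ 4\<close> by \<open>gt ^ (n + 7)\<close> to leading order.\<close>

lemma gt_fourth_root:
  assumes "\<not> gt dvd b" "gt ^ 7 dvd b - c"
  obtains z where "\<not> gt dvd z" "gt ^ (7 + n) dvd b * z ^ 4 - c"
proof -
  have "\<exists>z. \<not> gt dvd z \<and> gt ^ (7 + n) dvd b * z ^ 4 - c"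
  proof (induction n)
    case 0
    show ?case using assms(2) GT.p_nu by (intro exI[of _ 1]) simp
  next
    case (Suc n)
    then obtain z q where z: "\<not> gt dvd z" and q: "b * z ^ 4 - c = gt ^ (7 + n) * q" by blast
    have pSuc: "gt ^ (7 + Suc n) = gt ^ (7 + n) * gt" by (simp only: add_Suc_right power_Suc2)
    show ?case
    proof (cases "gt dvd q")
      case True
      then have "gt ^ (7 + Suc n) dvd b * z ^ 4 - c"
        unfolding q pSuc by (rule mult_dvd_mono[OF dvd_refl])
      then show ?thesis using z by blast
    next
      case False
      define s where "s = gt ^ (3 + n)"
      have gs: "gt ^ 4 * s = gt ^ (7 + n)" "s ^ 2 = gt ^ (6 + 2 * n)"
        by (simp_all add: s_def flip: power_add power_mult) (simp add: algebra_simps)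
      have 4: "(4 :: gint) = - (gt ^ 4)" by (simp add: gt_power4)
      \<comment> \<open>The terms of order at least 2 in \<open>s\<close> carry
        \<open>gt ^ (6 + 2 * n)\<close>; the factor \<open>gt ^ 2\<close> of the bracket lifts this
        to \<open>8 + 2 * n\<close>, beyond the digit that is being corrected.\<close>
      have "gt ^ 2 dvd 6 + 4 * s + s ^ 2"
      proof -
        have "gt ^ 2 dvd 2" using multiplicity_dvd[of gt 2] by (simp add: multiplicity_gt_2)
        then have "gt ^ 2 dvd 2 * (3 + 2 * s)" by (rule dvd_mult2)
        moreover have "gt ^ 2 dvd s ^ 2" unfolding gs by (simp add: le_imp_power_dvd)
        ultimately have "gt ^ 2 dvd 2 * (3 + 2 * s) + s ^ 2" by (rule dvd_add)
        then show ?thesis by (simp add: algebra_simps)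
      qed
      then have "gt ^ (6 + 2 * n) * gt ^ 2 dvd s ^ 2 * (6 + 4 * s + s ^ 2)"
        unfolding gs by (rule mult_dvd_mono[OF dvd_refl])
      then have s2: "gt ^ (7 + Suc n) dvd s ^ 2 * (6 + 4 * s + s ^ 2)"
        unfolding power_add[symmetric] by (rule power_le_dvd) simp
      have "b * (z * (1 + s)) ^ 4 - c = (b * z ^ 4 - c) + b * z ^ 4 * (4 * s + s ^ 2 * (6 + 4 * s + s ^ 2))"
        by (simp add: numeral_eq_Suc algebra_simps)
      also have "\<dots> = gt ^ (7 + n) * (q - b * z ^ 4) + b * z ^ 4 * (s ^ 2 * (6 + 4 * s + s ^ 2))"
      proof -
        have "4 * s = - (gt ^ (7 + n))" unfolding gs(1)[symmetric] by (subst 4) simp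
        then show ?thesis unfolding q by (simp only:) (simp add: algebra_simps)
      qed
      finally have eq: "b * (z * (1 + s)) ^ 4 - c = gt ^ (7 + n) * (q - b * z ^ 4) + b * z ^ 4 * (s ^ 2 * (6 + 4 * s + s ^ 2))" .
      have "\<not> gt dvd b * z ^ 4" using assms(1) z prime_elem_gt
        by (simp add: prime_elem_dvd_mult_iff prime_elem_dvd_power_iff)
      \<comment> \<open>The residue field has two elements, so the odd digit \<open>q\<close> is
        cancelled by the odd \<open>b * z ^ 4\<close>.\<close>
      with False have "gt dvd q - b * z ^ 4" by (rule gt_dvd_odd_diff)
      then have "gt ^ (7 + Suc n) dvd gt ^ (7 + n) * (q - b * z ^ 4)"
        unfolding pSuc by (rule mult_dvd_mono[OF dvd_refl])
      from dvd_add[OF this dvd_mult[OF s2, of "b * z ^ 4"]]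
      have "gt ^ (7 + Suc n) dvd b * (z * (1 + s)) ^ 4 - c" unfolding eq .
      moreover have "gt dvd s" by (simp add: s_def)
      then have "\<not> gt dvd z * (1 + s)" using z prime_elem_gt GT.p_nu
        by (metis dvd_add_left_iff prime_elem_dvd_mult_iff)
      ultimately show ?thesis by blast
    qed
  qed
  then show thesis using that by blast
qed

text \<open>Conditions (A), (B), (C) in this order, with the unit in (C) replaced by an odd Gaussian
  integer. They belong to solutions in which \<open>b * z ^ 4\<close> has smaller, larger or the
  same valuation as \<open>d ^ 2 * x ^ 4\<close>.\<close>

definition gt_cond :: "gint \<Rightarrow> gint \<Rightarrow> nat \<Rightarrow> nat \<Rightarrow> bool" where
  "gt_cond b0 d0 tb td \<longleftrightarrow>
    ([tb = td] (mod 2) \<and>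
        (\<exists>k::nat. \<exists>e\<in>{1, -1}. gcong (gt ^ 5) b0 (d0 * (e - d0 * gt ^ (4 * k + tb))))) \<or>
     (td = 0 \<and>
        (\<exists>k::nat. \<exists>e\<in>{1, -1}. gcong (gt ^ 5) (b0 * gt ^ (4 * k + tb)) (d0 * (e - d0)))) \<or>
     (tb = 2 * td \<and>
        (\<exists>k::nat. k \<ge> 1 \<and> (\<exists>a. \<not> gt dvd a \<and> gt ^ 7 dvd b0 + d0 * (d0 - a ^ 2 * gt ^ (2 * k - td)))))"

text \<open>The valuation of 2 at \<open>gt\<close> is 2, so extracting the square root takes 2 * 2
  + 1 digits beyond the valuation of \<open>d * w ^ 2\<close>: this is the modulus
  \<open>gt ^ 5\<close> of (A) and (B).\<close>

lemma unit_solvable_gtI: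
  assumes "\<not> gt dvd u" "d * w ^ 2 = gt ^ n * u"
    "gt ^ (n + 5) dvd d ^ 2 * x ^ 4 + b * z ^ 4 - d * w ^ 2"
  shows "unit_solvable gt b d"
  unfolding unit_solvable_def
proof (intro exI conjI)
  show "\<not> gt ^ (n + 1) dvd d * w ^ 2"
    unfolding assms(2) dvd_power_mult_cancel[OF gt_nonzero] using assms(1) by simp
  show "gt ^ (n + 2 * multiplicity gt 2 + 1) dvd d ^ 2 * x ^ 4 + b * z ^ 4 - d * w ^ 2"
  proof -
    have "n + 2 * multiplicity gt 2 + 1 = n + 5" by (simp add: multiplicity_gt_2)
    then show ?thesis using assms(3) by (simp only:)
  qed
qed

text \<open>The sign in (A) and (B) is a square, of 1 or of \<open>gi\<close>, which gives the odd
  part of \<open>w\<close>. In (A) \<open>z\<close> is 1 and \<open>x\<close> a power of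
  \<open>gt\<close>; in (B) the roles are exchanged.\<close>

lemma gt_cond_imp_unit_solvable:
  assumes d: "d = gt ^ td * d0" "\<not> gt dvd d0" and b: "b = gt ^ tb * b0" "\<not> gt dvd b0"
    and td: "td \<le> 1" and tb: "tb \<le> 3" and cond: "gt_cond b0 d0 tb td"
  shows "unit_solvable gt b d"
proof -
  have sq: "\<exists>w0. w0 ^ 2 = e \<and> \<not> gt dvd d0 * e" if "e \<in> {1, -1}" for e
    using that d(2) by (auto simp: gi_power2 intro: exI[of _ 1] exI[of _ gi])
  from cond consider
    (A) k e where "[tb = td] (mod 2)" "e \<in> {1, -1}" "gt ^ 5 dvd b0 - d0 * (e - d0 * gt ^ (4 * k + tb))"
  | (B) k e where "td = 0" "e \<in> {1, -1}" "gt ^ 5 dvd b0 * gt ^ (4 * k + tb) - d0 * (e - d0)"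
  | (C) k a where "tb = 2 * td" "k \<ge> 1" "\<not> gt dvd a" "gt ^ 7 dvd b0 + d0 * (d0 - a ^ 2 * gt ^ (2 * k - td))"
    unfolding gt_cond_def gcong_def by blast
  then show ?thesis
  proof cases
    case A
    obtain w0 where w0: "w0 ^ 2 = e" "\<not> gt dvd d0 * e" using sq[OF A(2)] by blast
    have "td \<le> tb" using A(1) td by (cases "tb = 0") (auto simp: unique_euclidean_semiring_class.cong_def)
    define m where "m = (tb - td) div 2"
    have "2 dvd tb - td"
      using A(1) \<open>td \<le> tb\<close> by (simp add: unique_euclidean_semiring_class.cong_def mod_eq_dvd_iff_nat)
    then have m: "tb = td + 2 * m" using \<open>td \<le> tb\<close> unfolding m_def by simp
    have w: "d * (gt ^ m * w0) ^ 2 = gt ^ tb * (d0 * e)"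
      by (simp add: d(1) m w0(1)[symmetric] power_mult_distrib power_add power_mult[symmetric] algebra_simps)
    have "gt ^ td * gt ^ td * gt ^ (4 * (k + m)) = gt ^ tb * gt ^ (4 * k + tb)"
      unfolding power_add[symmetric] by (simp add: m algebra_simps)
    then have "d ^ 2 * (gt ^ (k + m)) ^ 4 = gt ^ tb * (d0 ^ 2 * gt ^ (4 * k + tb))"
      by (simp add: d(1) power2_eq_square algebra_simps flip: power_mult)
    then have "d ^ 2 * (gt ^ (k + m)) ^ 4 + b * 1 ^ 4 - d * (gt ^ m * w0) ^ 2
       = gt ^ tb * (b0 - d0 * (e - d0 * gt ^ (4 * k + tb)))"
      unfolding w by (simp only: b(1)) (simp add: power2_eq_square algebra_simps)
    then have "gt ^ (tb + 5) dvd d ^ 2 * (gt ^ (k + m)) ^ 4 + b * 1 ^ 4 - d * (gt ^ m * w0) ^ 2"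
      using A(3) dvd_power_mult_cancel[OF gt_nonzero, of tb 5] by (simp only:)
    then show ?thesis by (rule unit_solvable_gtI[OF w0(2) w])
  next
    case B
    obtain w0 where w0: "w0 ^ 2 = e" "\<not> gt dvd d0 * e" using sq[OF B(2)] by blast
    have "d ^ 2 * 1 ^ 4 + b * (gt ^ k) ^ 4 - d * w0 ^ 2 = b0 * gt ^ (4 * k + tb) - d0 * (e - d0)"
      unfolding w0(1) by (simp add: d(1) b(1) B(1) power2_eq_square power_add algebra_simps flip: power_mult)
    then have "gt ^ (0 + 5) dvd d ^ 2 * 1 ^ 4 + b * (gt ^ k) ^ 4 - d * w0 ^ 2"
      using B(3) by simp
    moreover have "d * w0 ^ 2 = gt ^ 0 * (d0 * e)" by (simp add: d(1) B(1) w0(1))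
    ultimately show ?thesis using unit_solvable_gtI[OF w0(2)] by blast
  next
    \<comment> \<open>The valuation \<open>td + 2 * k\<close> of \<open>d * w ^ 2\<close> is
      unbounded in \<open>k\<close>, while (C) is a congruence modulo \<open>gt ^ 7\<close>. Taking
      for \<open>z\<close> an approximate fourth root instead of 1 provides the missing
      \<open>2 * k\<close> digits.\<close>
    case C
    define c where "c = - (d0 * (d0 - a ^ 2 * gt ^ (2 * k - td)))"
    have "gt ^ 7 dvd b0 - c" using C(4) by (simp add: c_def)
    then obtain z where z: "\<not> gt dvd z" "gt ^ (7 + 2 * k) dvd b0 * z ^ 4 - c"
      using gt_fourth_root[OF b(2), of c "2 * k"] by blast
    have k: "td \<le> 2 * k" using C(2) td by simp
    have d2: "d ^ 2 = gt ^ (2 * td) * d0 ^ 2"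
      by (simp add: d(1) power_mult_distrib mult.commute flip: power_mult)
    have w: "d * (a * gt ^ k) ^ 2 = gt ^ (td + 2 * k) * (d0 * a ^ 2)"
      by (simp add: d(1) power_mult_distrib power_add algebra_simps flip: power_mult)
    have "gt ^ (td + 2 * k) = gt ^ (2 * td) * gt ^ (2 * k - td)" using k by (simp flip: power_add)
    then have "d ^ 2 * 1 ^ 4 + b * z ^ 4 - d * (a * gt ^ k) ^ 2 = gt ^ (2 * td) * (b0 * z ^ 4 - c)"
      unfolding w d2 by (simp add: b(1) C(1) c_def power2_eq_square algebra_simps)
    moreover have "gt ^ (2 * td + (7 + 2 * k)) dvd gt ^ (2 * td) * (b0 * z ^ 4 - c)"
      using z(2) by (simp add: dvd_power_mult_cancel)
    ultimately have "gt ^ ((td + 2 * k) + 5) dvd d ^ 2 * 1 ^ 4 + b * z ^ 4 - d * (a * gt ^ k) ^ 2"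
      by (auto intro: power_le_dvd)
    moreover have "\<not> gt dvd d0 * a ^ 2" using d(2) C(3) prime_elem_gt
      by (simp add: prime_elem_dvd_mult_iff prime_elem_dvd_power_iff)
    ultimately show ?thesis using unit_solvable_gtI w by blast
  qed
qed

text \<open>Odd fourth powers are 1 modulo \<open>gt ^ 7\<close> and odd squares are 1 or -1 modulo
  \<open>gt ^ 5\<close>. So once the valuations are compared, the odd parts of the coordinates drop
  out, except for the square that remains in (C).\<close>

lemma gt_cond_of_approx_solvable:
  assumes d: "d = gt ^ td * d0" "\<not> gt dvd d0" and b: "b = gt ^ tb * b0" "\<not> gt dvd b0"
    and td: "td \<le> 1" and tb: "tb \<le> 3" and S: "approx_solvable gt b d"
  shows "gt_cond b0 d0 tb td"
proof -
  have "\<not> gt ^ 2 dvd d"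
    using GT.power_dvd_power_mult_imp_le[of 2 td d0] d td by auto
  then obtain x' z' w' where xzw': "\<not> (gt dvd x' \<and> gt dvd z')"
      "gt ^ 30 dvd d ^ 2 * x' ^ 4 + b * z' ^ 4 - d * w' ^ 2"
    using GT.approx_solvable_primitive[OF _ S] by blast
  \<comment> \<open>Zero coordinates are replaced by \<open>gt ^ 30\<close>, which is invisible at
    the working precision, so that every coordinate has a finite valuation. The exponent 30 only has
    to exceed the valuations and moduli compared below.\<close>
  define x z w where "x = (if x' = 0 then gt ^ 30 else x')" and "z = (if z' = 0 then gt ^ 30 else z')"
    and "w = (if w' = 0 then gt ^ 30 else w')"
  have nz: "x \<noteq> 0" "z \<noteq> 0" "w \<noteq> 0" by (simp_all add: x_def z_def w_def)
  have prim: "\<not> (gt dvd x \<and> gt dvd z)" using xzw'(1) by (auto simp: x_def z_def)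
  have E: "gt ^ 30 dvd d ^ 2 * x ^ 4 + b * z ^ 4 - d * w ^ 2"
  proof -
    have "gt ^ 30 dvd x - x'" "gt ^ 30 dvd z - z'" "gt ^ 30 dvd w - w'"
      by (simp_all add: x_def z_def w_def)
    then have *: "gt ^ 30 dvd x ^ 4 - x' ^ 4" "gt ^ 30 dvd z ^ 4 - z' ^ 4" "gt ^ 30 dvd w ^ 2 - w' ^ 2"
      by (simp_all add: dvd_power_diff)
    have "gt ^ 30 dvd d ^ 2 * (x ^ 4 - x' ^ 4) + b * (z ^ 4 - z' ^ 4) - d * (w ^ 2 - w' ^ 2) +
        (d ^ 2 * x' ^ 4 + b * z' ^ 4 - d * w' ^ 2)"
      by (rule dvd_add[OF dvd_diff[OF dvd_add[OF dvd_mult dvd_mult] dvd_mult] xzw'(2)]) (fact *)+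
    then show ?thesis by (simp add: algebra_simps)
  qed
  obtain x0 where x0: "x = gt ^ multiplicity gt x * x0" "\<not> gt dvd x0"
    using multiplicity_decompose'[OF nz(1)] GT.p_nu by metis
  obtain z0 where z0: "z = gt ^ multiplicity gt z * z0" "\<not> gt dvd z0"
    using multiplicity_decompose'[OF nz(2)] GT.p_nu by metis
  obtain w0 where w0: "w = gt ^ multiplicity gt w * w0" "\<not> gt dvd w0"
    using multiplicity_decompose'[OF nz(3)] GT.p_nu by metis
  define i j l where "i = multiplicity gt x" and "j = multiplicity gt z" and "l = multiplicity gt w"
  have ij: "i = 0 \<or> j = 0"
    using prim x0(1) z0(1) dvd_power[of "multiplicity gt x" gt] dvd_power[of "multiplicity gt z" gt]
    unfolding i_def j_def by (metis dvd_mult2 neq0_conv)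
  obtain \<xi> where \<xi>: "x0 ^ 4 - 1 = gt ^ 7 * \<xi>" using gt_odd_fourth_power[OF x0(2)] ..
  obtain \<zeta> where \<zeta>: "z0 ^ 4 - 1 = gt ^ 7 * \<zeta>" using gt_odd_fourth_power[OF z0(2)] ..
  obtain e \<omega> where e: "e \<in> {1, -1}" "w0 ^ 2 - e = gt ^ 5 * \<omega>" using gt_odd_square[OF w0(2)] by (metis dvdE)
  have 1: "d ^ 2 * x ^ 4 = gt ^ (2 * td + 4 * i) * (d0 ^ 2 * x0 ^ 4)"
    by (subst x0(1)) (simp add: d(1) i_def power_add power_mult_distrib algebra_simps flip: power_mult)
  have 2: "b * z ^ 4 = gt ^ (tb + 4 * j) * (b0 * z0 ^ 4)"
    by (subst z0(1)) (simp add: b(1) j_def power_add power_mult_distrib algebra_simps flip: power_mult)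
  have 3: "d * w ^ 2 = gt ^ (td + 2 * l) * (d0 * w0 ^ 2)"
    by (subst w0(1)) (simp add: d(1) l_def power_add power_mult_distrib algebra_simps flip: power_mult)
  have o1: "\<not> gt dvd d0 ^ 2 * x0 ^ 4" and o2: "\<not> gt dvd b0 * z0 ^ 4" and o3: "\<not> gt dvd d0 * w0 ^ 2"
    using d(2) b(2) x0(2) z0(2) w0(2) prime_elem_gt
    by (simp_all add: prime_elem_dvd_mult_iff prime_elem_dvd_power_iff)
  note E = E[unfolded 1 2 3]
  have odd_add: "\<not> gt dvd u + gt ^ r * y" if "\<not> gt dvd u" "r > 0" for u y r
    using that by (metis dvd_add_left_iff dvd_mult2 dvd_power)
  consider (gr) "2 * td + 4 * i > tb + 4 * j" | (ls) "2 * td + 4 * i < tb + 4 * j"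
    | (eq) "2 * td + 4 * i = tb + 4 * j" by linarith
  then show ?thesis
  proof cases
    case gr
    then have j: "j = 0" using ij td tb by auto
    define r where "r = 2 * td + 4 * i - tb"
    have r: "2 * td + 4 * i = tb + r" "r > 0" using gr j by (simp_all add: r_def)
    have E': "gt ^ 30 dvd gt ^ tb * (b0 * z0 ^ 4 + gt ^ r * (d0 ^ 2 * x0 ^ 4)) - gt ^ (td + 2 * l) * (d0 * w0 ^ 2)"
      using E unfolding r(1) j by (simp add: power_add algebra_simps)
    have l: "tb = td + 2 * l"
      using GT.power_cong_imp_eq[OF E' odd_add[OF o2 r(2)] o3] tb by simp
    have "gt ^ (tb + 5) dvd gt ^ tb * (b0 * z0 ^ 4 + gt ^ r * (d0 ^ 2 * x0 ^ 4) - d0 * w0 ^ 2)"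
      using power_le_dvd[OF E', of "tb + 5"] tb unfolding l[symmetric] by (simp add: right_diff_distrib)
    then have F: "gt ^ 5 dvd b0 * z0 ^ 4 + gt ^ r * (d0 ^ 2 * x0 ^ 4) - d0 * w0 ^ 2"
      by (simp only: dvd_power_mult_cancel[OF gt_nonzero])
    have "b0 - d0 * (e - d0 * gt ^ r) = (b0 * z0 ^ 4 + gt ^ r * (d0 ^ 2 * x0 ^ 4) - d0 * w0 ^ 2)
        - b0 * (z0 ^ 4 - 1) - gt ^ r * d0 ^ 2 * (x0 ^ 4 - 1) + d0 * (w0 ^ 2 - e)"
      by (simp add: power2_eq_square algebra_simps)
    also have "gt ^ 5 dvd \<dots>"
      unfolding \<xi> \<zeta> e(2) by (intro dvd_add dvd_diff F dvd_mult dvd_mult2 le_imp_power_dvd) simp_all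
    finally have "gt ^ 5 dvd b0 - d0 * (e - d0 * gt ^ r)" .
    moreover have "r = 4 * (i - l) + tb" using r l tb by linarith
    moreover have "[tb = td] (mod 2)" by (simp add: l unique_euclidean_semiring_class.cong_def)
    ultimately show ?thesis unfolding gt_cond_def gcong_def using e(1) by blast
  next
    case ls
    then have i: "i = 0" using ij td tb by auto
    define r where "r = tb + 4 * j - 2 * td"
    have r: "tb + 4 * j = 2 * td + r" "r > 0" using ls i by (simp_all add: r_def)
    have E': "gt ^ 30 dvd gt ^ (2 * td) * (d0 ^ 2 * x0 ^ 4 + gt ^ r * (b0 * z0 ^ 4)) - gt ^ (td + 2 * l) * (d0 * w0 ^ 2)"
      using E unfolding r(1) i by (simp add: power_add algebra_simps)
    have "2 * td = td + 2 * l"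
      using GT.power_cong_imp_eq[OF E' odd_add[OF o1 r(2)] o3] td by simp
    then have td0: "td = 0" "l = 0" using td by auto
    have F: "gt ^ 5 dvd d0 ^ 2 * x0 ^ 4 + gt ^ r * (b0 * z0 ^ 4) - d0 * w0 ^ 2"
      using power_le_dvd[OF E', of 5] unfolding td0 by simp
    have "b0 * gt ^ r - d0 * (e - d0) = (d0 ^ 2 * x0 ^ 4 + gt ^ r * (b0 * z0 ^ 4) - d0 * w0 ^ 2)
        - d0 ^ 2 * (x0 ^ 4 - 1) - gt ^ r * b0 * (z0 ^ 4 - 1) + d0 * (w0 ^ 2 - e)"
      by (simp add: power2_eq_square algebra_simps)
    also have "gt ^ 5 dvd \<dots>"
      unfolding \<xi> \<zeta> e(2) by (intro dvd_add dvd_diff F dvd_mult dvd_mult2 le_imp_power_dvd) simp_all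
    finally have "gt ^ 5 dvd b0 * gt ^ r - d0 * (e - d0)" .
    moreover have "r = 4 * j + tb" using r td0 by simp
    ultimately show ?thesis unfolding gt_cond_def gcong_def using e(1) td0 by blast
  next
    case eq
    have i: "i = 0" and j: "j = 0" using eq ij td tb by presburger+
    then have tb2: "tb = 2 * td" using eq by simp
    define s where "s = d0 ^ 2 * x0 ^ 4 + b0 * z0 ^ 4"
    have E': "gt ^ 30 dvd gt ^ (2 * td) * s - gt ^ (td + 2 * l) * (d0 * w0 ^ 2)"
      using E unfolding i j tb2 s_def by (simp add: algebra_simps)
    \<comment> \<open>Two odd terms are added, so the sum gains a factor \<open>gt\<close>; this
      forces \<open>l \<ge> 1\<close>, the lower bound on \<open>k\<close> in (C).\<close>
    have "gt dvd s" unfolding s_def using o1 o2 by (rule gt_dvd_odd_add)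
    then have "gt ^ (2 * td) * gt dvd gt ^ (2 * td) * s" by (rule mult_dvd_mono[OF dvd_refl])
    then have "gt ^ (2 * td + 1) dvd gt ^ (2 * td) * s" by (simp add: mult.commute)
    moreover have "gt ^ (2 * td + 1) dvd gt ^ (2 * td) * s - gt ^ (td + 2 * l) * (d0 * w0 ^ 2)"
      using E' by (rule power_le_dvd) (use td in simp)
    ultimately have "gt ^ (2 * td + 1) dvd gt ^ (2 * td) * s -
        (gt ^ (2 * td) * s - gt ^ (td + 2 * l) * (d0 * w0 ^ 2))" by (rule dvd_diff)
    then have "gt ^ (2 * td + 1) dvd gt ^ (td + 2 * l) * (d0 * w0 ^ 2)" by simp
    from GT.power_dvd_power_mult_imp_le[OF this o3] have l: "td + 1 \<le> 2 * l" by simp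
    have "gt ^ (td + 2 * l) = gt ^ (2 * td) * gt ^ (2 * l - td)" using l by (simp flip: power_add)
    then have "gt ^ (2 * td) * s - gt ^ (td + 2 * l) * (d0 * w0 ^ 2) =
        gt ^ (2 * td) * (s - gt ^ (2 * l - td) * (d0 * w0 ^ 2))"
      by (simp add: algebra_simps)
    moreover have "gt ^ (2 * td + 7) dvd gt ^ (2 * td) * s - gt ^ (td + 2 * l) * (d0 * w0 ^ 2)"
      using E' by (rule power_le_dvd) (use td in simp)
    ultimately have F: "gt ^ 7 dvd s - gt ^ (2 * l - td) * (d0 * w0 ^ 2)"
      using dvd_power_mult_cancel[OF gt_nonzero] by (simp only:)
    have "b0 + d0 * (d0 - w0 ^ 2 * gt ^ (2 * l - td)) = (s - gt ^ (2 * l - td) * (d0 * w0 ^ 2))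
        - d0 ^ 2 * (x0 ^ 4 - 1) - b0 * (z0 ^ 4 - 1)"
      by (simp add: s_def power2_eq_square algebra_simps)
    also have "gt ^ 7 dvd \<dots>"
      unfolding \<xi> \<zeta> by (intro dvd_diff F dvd_mult dvd_triv_left)
    finally have "gt ^ 7 dvd b0 + d0 * (d0 - w0 ^ 2 * gt ^ (2 * l - td))" .
    moreover have "l \<ge> 1" using l by simp
    ultimately show ?thesis unfolding gt_cond_def using tb2 w0(2) by blast
  qed
qed

section \<open>Quartic residues\<close>

text \<open>The logarithm to base \<open>gi\<close> of the quartic symbol. It is a chosen
  representative of a class modulo 4, and arbitrary if \<open>p\<close> divides \<open>x\<close>;
  all rules for it are therefore congruences modulo 4.\<close>

definition qlog :: "gint \<Rightarrow> gint \<Rightarrow> int" where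
  "qlog p x = int (SOME k. p dvd x ^ qexp p - gi ^ k)"

locale gprime_odd = gprime +
  assumes odd: "\<not> gt dvd p"
begin

text \<open>A difference of two powers of \<open>gi\<close> has norm at most 4, while
  \<open>Nm p\<close> exceeds 4, so distinct units stay distinct modulo \<open>p\<close>.\<close>

lemma dvd_gi_power_diff_iff: "p dvd gi ^ j - gi ^ k \<longleftrightarrow> [int j = int k] (mod 4)"
proof
  assume p: "p dvd gi ^ j - gi ^ k"
  have m: "gi ^ m \<in> {1, gi, -1, -gi}" for m
    using gint_unit_cases[OF gi_power_unit[of m]] by blast
  have "Nm (gi ^ j - gi ^ k) \<le> 4"
    using m[of j] m[of k] by (elim insertE emptyE) (simp_all add: Nm_def)
  moreover have "Nm p dvd Nm (gi ^ j - gi ^ k)" using p by (rule Nm_dvd)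
  moreover have "Nm p > 4" using gint_prime_Nm_mod4(2)[OF prime odd] .
  ultimately have "Nm (gi ^ j - gi ^ k) = 0"
    using zdvd_imp_le[of "Nm p" "Nm (gi ^ j - gi ^ k)"] Nm_nonneg[of "gi ^ j - gi ^ k"] by linarith
  then show "[int j = int k] (mod 4)" using gi_power_eq_iff[of j k]
    by (simp add: cong_int_iff[of j k 4, simplified])
next
  assume "[int j = int k] (mod 4)"
  then have "gi ^ j = gi ^ k" using gi_power_eq_iff[of j k] by (simp add: cong_int_iff[of j k 4, simplified])
  then show "p dvd gi ^ j - gi ^ k" by simp
qed

lemma qlog_ex:
  assumes "\<not> p dvd x" shows "\<exists>k. p dvd x ^ qexp p - gi ^ k"
proof -
  define y where "y = x ^ qexp p"
  have "p dvd y ^ 4 - 1"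
    using gint_fermat[OF prime odd assms] by (simp add: y_def mult.commute flip: power_mult)
  also have "y ^ 4 - 1 = (y - gi ^ 0) * ((y - gi ^ 1) * ((y - gi ^ 2) * (y - gi ^ 3)))"
    by (simp add: gi_power2 numeral_eq_Suc algebra_simps gint_eq_iff)
  finally show ?thesis using prime unfolding y_def[symmetric]
    by (metis prime_elem_dvd_mult_iff)
qed

lemma qlog_spec: assumes "\<not> p dvd x" obtains k where "qlog p x = int k" "p dvd x ^ qexp p - gi ^ k"
  using someI_ex[OF qlog_ex[OF assms]] that unfolding qlog_def by blast

lemma qlog_eqI:
  assumes "p dvd x ^ qexp p - gi ^ k" shows "[qlog p x = int k] (mod 4)"
proof -
  have "p dvd x ^ qexp p - gi ^ (SOME k. p dvd x ^ qexp p - gi ^ k)" using assms by (rule someI)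
  from dvd_diff[OF assms this] have "p dvd gi ^ (SOME k. p dvd x ^ qexp p - gi ^ k) - gi ^ k" by simp
  then show ?thesis unfolding dvd_gi_power_diff_iff qlog_def .
qed

lemma not_dvd_mult: "\<not> p dvd x \<Longrightarrow> \<not> p dvd y \<Longrightarrow> \<not> p dvd x * y"
  using prime by (simp add: prime_elem_dvd_mult_iff)

lemma not_dvd_power: "\<not> p dvd x \<Longrightarrow> \<not> p dvd x ^ n"
  using prime prime_elem_dvd_power by blast

lemma not_dvd_unit: "u dvd 1 \<Longrightarrow> \<not> p dvd u"
  using p_nu dvd_trans by blast

lemma qlog_mult:
  assumes "\<not> p dvd x" "\<not> p dvd y" shows "[qlog p (x * y) = qlog p x + qlog p y] (mod 4)"
proof -
  obtain k where k: "qlog p x = int k" "p dvd x ^ qexp p - gi ^ k" using qlog_spec[OF assms(1)] .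
  obtain l where l: "qlog p y = int l" "p dvd y ^ qexp p - gi ^ l" using qlog_spec[OF assms(2)] .
  have "(x * y) ^ qexp p - gi ^ (k + l) = x ^ qexp p * (y ^ qexp p - gi ^ l) + (x ^ qexp p - gi ^ k) * gi ^ l"
    by (simp add: power_mult_distrib power_add algebra_simps)
  also have "p dvd \<dots>" using k l by simp
  finally show ?thesis using qlog_eqI k(1) l(1) by fastforce
qed

lemma qlog_1: "[qlog p 1 = 0] (mod 4)"
  using qlog_eqI[of 1 0] by simp

lemma qlog_power:
  assumes "\<not> p dvd x" shows "[qlog p (x ^ n) = int n * qlog p x] (mod 4)"
proof (induction n)
  case 0
  show ?case using qlog_1 by simp
next
  case (Suc n)
  have "[qlog p (x * x ^ n) = qlog p x + qlog p (x ^ n)] (mod 4)"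
    by (intro qlog_mult assms not_dvd_power)
  also have "[qlog p x + qlog p (x ^ n) = qlog p x + int n * qlog p x] (mod 4)"
    by (intro cong_add cong_refl Suc)
  finally show ?case by (simp add: algebra_simps)
qed

lemma qlog_mult_power:
  assumes "\<not> p dvd x" "\<not> p dvd y" shows "[qlog p (x * y ^ n) = qlog p x + int n * qlog p y] (mod 4)"
  using cong_trans[OF qlog_mult[OF assms(1) not_dvd_power[OF assms(2)]]
      cong_add[OF cong_refl qlog_power[OF assms(2)]]] .

lemma qlog_prod:
  assumes "\<And>x. x \<in> A \<Longrightarrow> \<not> p dvd f x"
  shows "[qlog p (\<Prod>x\<in>A. f x) = (\<Sum>x\<in>A. qlog p (f x))] (mod 4)" "\<not> p dvd (\<Prod>x\<in>A. f x)"
proof -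
  have "[qlog p (\<Prod>x\<in>A. f x) = (\<Sum>x\<in>A. qlog p (f x))] (mod 4) \<and> \<not> p dvd (\<Prod>x\<in>A. f x)"
    using assms
  proof (induction A rule: infinite_finite_induct)
    case (insert x A)
    then have "[qlog p (f x * prod f A) = qlog p (f x) + qlog p (prod f A)] (mod 4)"
      by (intro qlog_mult) auto
    also have "[qlog p (f x) + qlog p (prod f A) = qlog p (f x) + (\<Sum>x\<in>A. qlog p (f x))] (mod 4)"
      using insert by (intro cong_add cong_refl) auto
    finally show ?case using insert not_dvd_mult by simp
  qed (use qlog_1 p_nu in simp_all)
  then show "[qlog p (\<Prod>x\<in>A. f x) = (\<Sum>x\<in>A. qlog p (f x))] (mod 4)" "\<not> p dvd (\<Prod>x\<in>A. f x)"
    by blast+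
qed

lemma qlog_cong:
  assumes "p dvd x - y" "\<not> p dvd x" shows "[qlog p x = qlog p y] (mod 4)"
proof -
  obtain k where k: "qlog p x = int k" "p dvd x ^ qexp p - gi ^ k" using qlog_spec[OF assms(2)] .
  have "p dvd (x ^ qexp p - gi ^ k) - (x ^ qexp p - y ^ qexp p)"
    using k(2) dvd_power_diff[OF assms(1)] by (rule dvd_diff)
  then have "p dvd y ^ qexp p - gi ^ k" by simp
  from qlog_eqI[OF this] show ?thesis using k(1) by (simp add: cong_sym)
qed

lemma qlog_gi: "[qlog p gi = int (qexp p)] (mod 4)"
  using qlog_eqI[of gi "qexp p"] by simp

lemma qlog_minus_1: "[qlog p (-1) = 2 * int (qexp p)] (mod 4)"
proof -
  have "[qlog p (gi ^ 2) = int 2 * qlog p gi] (mod 4)"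
    by (intro qlog_power not_dvd_unit) simp
  also have "[int 2 * qlog p gi = int 2 * int (qexp p)] (mod 4)" by (intro cong_mult cong_refl qlog_gi)
  finally show ?thesis by (simp add: gi_power2)
qed

lemma cong4_even: "[a = b] (mod 4) \<Longrightarrow> even a \<longleftrightarrow> even b" for a b :: int
  by (auto simp: cong_iff_dvd_diff elim!: dvdE) presburger+

lemma square_iff:
  assumes "\<not> p dvd x" shows "(\<exists>y. p dvd y ^ 2 - x) \<longleftrightarrow> even (qlog p x)"
proof
  assume "\<exists>y. p dvd y ^ 2 - x"
  then obtain y where y: "p dvd y ^ 2 - x" ..
  have py: "\<not> p dvd y ^ 2" using y assms by (metis dvd_diff diff_diff_eq2 add_diff_cancel_left' add.commute diff_add_cancel)
  then have "\<not> p dvd y" by (auto simp: power2_eq_square)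
  have "[qlog p x = qlog p (y ^ 2)] (mod 4)" using qlog_cong[OF y py] by (simp add: cong_sym)
  also have "[qlog p (y ^ 2) = int 2 * qlog p y] (mod 4)" by (rule qlog_power[OF \<open>\<not> p dvd y\<close>])
  finally show "even (qlog p x)" using cong4_even by fastforce
next
  assume ev: "even (qlog p x)"
  obtain k where k: "qlog p x = int k" "p dvd x ^ qexp p - gi ^ k" using qlog_spec[OF assms] .
  have "p dvd (x ^ qexp p) ^ 2 - (gi ^ k) ^ 2" using k(2) by (rule dvd_power_diff)
  moreover have "(gi ^ k) ^ 2 = 1"
  proof -
    obtain l where "k = 2 * l" using ev k(1) by auto
    have "(gi ^ k) ^ 2 = gi ^ (4 * l)" by (simp add: \<open>k = 2 * l\<close> flip: power_mult)
    then show ?thesis unfolding power_mult by simp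
  qed
  ultimately have "p dvd x ^ (2 * qexp p) - 1" by (simp add: mult.commute flip: power_mult)
  then show "\<exists>y. p dvd y ^ 2 - x"
    using gint_root_exists[OF prime odd assms, of "2 * qexp p" 2] by fastforce
qed

lemma fourth_power_exists:
  assumes "\<not> p dvd x" "[qlog p x = 0] (mod 4)" obtains y where "p dvd y ^ 4 - x"
proof -
  obtain k where k: "qlog p x = int k" "p dvd x ^ qexp p - gi ^ k" using qlog_spec[OF assms(1)] .
  have "gi ^ k = gi ^ 0" unfolding gi_power_eq_iff using assms(2) k(1) by (metis cong_int_iff of_nat_0 of_nat_numeral)
  with k(2) have "p dvd x ^ qexp p - 1" by simp
  then show thesis using gint_root_exists[OF prime odd assms(1), of "qexp p" 4] that by fastforce
qed

section \<open>Solvability at the odd primes\<close>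

definition local_cond :: "nat \<Rightarrow> nat \<Rightarrow> gint \<Rightarrow> gint \<Rightarrow> bool" where
  "local_cond e r b1 d1 \<longleftrightarrow>
    (if r = 2 then
      if e = 0 then even (qlog p d1) \<or> even (qlog p b1 + qlog p d1)
      else [qlog p (-1) + qlog p b1 + 2 * qlog p d1 = 0] (mod 4)
     else
      if e = 0 then even (qlog p d1) else even (qlog p b1 + qlog p d1))"

lemma multiplicity_2: "multiplicity p 2 = 0"
proof -
  have "\<not> p dvd 2"
  proof
    assume "p dvd 2"
    from Nm_dvd[OF this] have "Nm p \<le> 4" by (intro zdvd_imp_le) (simp_all add: Nm_def)
    then show False using gint_prime_Nm_mod4(2)[OF prime odd] by simp
  qed
  then show ?thesis by (rule not_dvd_imp_multiplicity_0)
qed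

lemma unit_solvableI:
  assumes "d * w ^ 2 = p ^ n * u" "\<not> p dvd u"
    "d ^ 2 * x ^ 4 + b * z ^ 4 = p ^ n * u'" "p dvd u' - u"
  shows "unit_solvable p b d"
  unfolding unit_solvable_def
proof (intro exI conjI)
  show "\<not> p ^ (n + 1) dvd d * w ^ 2"
    unfolding assms(1) dvd_power_mult_cancel[OF p_nz] using assms(2) by simp
  have "p ^ (n + 1) dvd p ^ n * (u' - u)"
    unfolding dvd_power_mult_cancel[OF p_nz] using assms(4) by simp
  then show "p ^ (n + 2 * multiplicity p 2 + 1) dvd d ^ 2 * x ^ 4 + b * z ^ 4 - d * w ^ 2"
    unfolding assms(1,3) multiplicity_2 by (simp add: right_diff_distrib)
qed

text \<open>If \<open>d1\<close> is a square and \<open>e = 0\<close>, a solution with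
  \<open>z = 0\<close> exists; if \<open>b1 * d1\<close> is a square and \<open>r - e\<close> is
  even, one with \<open>x = 0\<close>. For \<open>e = 1\<close> and \<open>r = 2\<close> both
  quartic terms can have valuation 2 but \<open>d * w ^ 2\<close> has odd valuation, so the terms
  must first cancel, which asks for a fourth root of \<open>- (b1 * d1 ^ 2)\<close>.\<close>

lemma local_cond_imp_unit_solvable:
  assumes d: "d = p ^ e * d1" "\<not> p dvd d1" and b: "b = p ^ r * b1" "\<not> p dvd b1"
    and e: "e \<le> 1" and r: "r \<in> {1, 2, 3}" and cond: "local_cond e r b1 d1"
  shows "unit_solvable p b d"
proof -
  have bd: "\<not> p dvd b1 * d1" using b d by (intro not_dvd_mult)
  have not_dvd_cong: "\<not> p dvd y ^ 2" if "p dvd y ^ 2 - x" "\<not> p dvd x" for x y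
    using that by (metis dvd_diff diff_diff_eq2 add_diff_cancel_left' add.commute diff_add_cancel)
  have sq: "\<exists>y. p dvd y ^ 2 - b1 * d1" if "even (qlog p b1 + qlog p d1)"
    unfolding square_iff[OF bd] using that cong4_even[OF qlog_mult[OF b(2) d(2)]] by blast
  consider (1) "e = 0" "even (qlog p d1)" | (2) "e = 0" "r = 2" "even (qlog p b1 + qlog p d1)"
    | (3) "e = 1" "r \<noteq> 2" "even (qlog p b1 + qlog p d1)"
    | (4) "e = 1" "r = 2" "[qlog p (-1) + qlog p b1 + 2 * qlog p d1 = 0] (mod 4)"
    using cond e unfolding local_cond_def by (cases "e = 0") (auto split: if_splits)
  then show ?thesis
  proof cases
    case 1
    then obtain y where y: "p dvd y ^ 2 - d1" using square_iff[OF d(2)] by blast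
    have "\<not> p dvd d1 * y ^ 2" using not_dvd_cong[OF y d(2)] d(2) by (intro not_dvd_mult)
    moreover have "p dvd d1 ^ 2 - d1 * y ^ 2"
    proof -
      have "d1 ^ 2 - d1 * y ^ 2 = - (d1 * (y ^ 2 - d1))" by (simp add: power2_eq_square algebra_simps)
      then show ?thesis using y by simp
    qed
    ultimately show ?thesis
      by (intro unit_solvableI[where w = y and n = 0 and x = 1 and z = 0 and u = "d1 * y ^ 2" and u' = "d1 ^ 2"])
        (simp_all add: d(1) 1(1))
  next
    case 2
    then obtain y where y: "p dvd y ^ 2 - b1 * d1" using sq by blast
    have "\<not> p dvd d1 ^ 3 * y ^ 2"
      by (intro not_dvd_mult[OF not_dvd_power[OF d(2)] not_dvd_cong[OF y bd]])
    moreover have "p dvd b1 * d1 ^ 4 - d1 ^ 3 * y ^ 2"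
    proof -
      have "b1 * d1 ^ 4 - d1 ^ 3 * y ^ 2 = - (d1 ^ 3 * (y ^ 2 - b1 * d1))"
        by (simp add: numeral_eq_Suc algebra_simps)
      then show ?thesis using y by simp
    qed
    ultimately show ?thesis
      by (intro unit_solvableI[where w = "p * d1 * y" and n = 2 and x = 0 and z = d1 and u = "d1 ^ 3 * y ^ 2"
          and u' = "b1 * d1 ^ 4"])
        (simp_all add: d(1) b(1) 2 numeral_eq_Suc algebra_simps)
  next
    case 3
    then obtain y where y: "p dvd y ^ 2 - b1 * d1" using sq by blast
    define j where "j = (r - 1) div 2"
    have j: "r = 2 * j + 1" using r 3 by (auto simp: j_def)
    have "\<not> p dvd d1 ^ 3 * y ^ 2"
      by (intro not_dvd_mult[OF not_dvd_power[OF d(2)] not_dvd_cong[OF y bd]])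
    moreover have "p dvd b1 * d1 ^ 4 - d1 ^ 3 * y ^ 2"
    proof -
      have "b1 * d1 ^ 4 - d1 ^ 3 * y ^ 2 = - (d1 ^ 3 * (y ^ 2 - b1 * d1))"
        by (simp add: numeral_eq_Suc algebra_simps)
      then show ?thesis using y by simp
    qed
    moreover have "d * (p ^ j * d1 * y) ^ 2 = p ^ r * (d1 ^ 3 * y ^ 2)"
      by (simp add: d(1) 3(1) j power_mult power2_eq_square power3_eq_cube power_mult_distrib algebra_simps)
    ultimately show ?thesis
      by (intro unit_solvableI[where w = "p ^ j * d1 * y" and n = r and x = 0 and z = d1 and u = "d1 ^ 3 * y ^ 2"
          and u' = "b1 * d1 ^ 4"])
        (simp_all add: b(1))
  next
    case 4
    define c where "c = (-1) * (b1 * d1 ^ 2)"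
    have m1: "\<not> p dvd -1" by (rule not_dvd_unit) simp
    have c: "\<not> p dvd c" unfolding c_def using b(2) d(2) m1 by (intro not_dvd_mult not_dvd_power)
    have "[qlog p c = qlog p (-1) + qlog p (b1 * d1 ^ 2)] (mod 4)"
      unfolding c_def using b(2) d(2) m1 by (intro qlog_mult not_dvd_mult not_dvd_power)
    also have "[qlog p (-1) + qlog p (b1 * d1 ^ 2) = qlog p (-1) + (qlog p b1 + qlog p (d1 ^ 2))] (mod 4)"
      using b(2) d(2) by (intro cong_add cong_refl qlog_mult not_dvd_power)
    also have "[qlog p (-1) + (qlog p b1 + qlog p (d1 ^ 2)) = qlog p (-1) + (qlog p b1 + int 2 * qlog p d1)] (mod 4)"
      using d(2) by (intro cong_add cong_refl qlog_power)
    also have "[qlog p (-1) + (qlog p b1 + int 2 * qlog p d1) = 0] (mod 4)" using 4(3) by (simp add: algebra_simps)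
    finally obtain y where y: "p dvd y ^ 4 - c" using fourth_power_exists[OF c] by blast
    have py: "\<not> p dvd y"
    proof
      assume "p dvd y"
      then have "p dvd y ^ 4" by (simp add: dvd_power_le[of p y 1 4, simplified])
      from dvd_diff[OF this y] show False using c by simp
    qed
    have "p dvd d1 ^ 2 * y ^ 4 + b1 * d1 ^ 4"
    proof -
      have "d1 ^ 2 * y ^ 4 + b1 * d1 ^ 4 = d1 ^ 2 * (y ^ 4 - c)"
        by (simp add: c_def numeral_eq_Suc algebra_simps)
      then show ?thesis using y by simp
    qed
    then obtain \<gamma> where \<gamma>: "d1 ^ 2 * y ^ 4 + b1 * d1 ^ 4 = p * \<gamma>" ..
    have p2: "\<not> p dvd 2" using multiplicity_2 p_nu prime
      by (metis multiplicity_eq_zero_iff zero_neq_numeral gRe_numeral gRe_simps(1) p_nz)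
    then have "\<not> p dvd 2 ^ 2 * d1 ^ 2 * y ^ 3" using d(2) py by (intro not_dvd_mult not_dvd_power)
    then obtain \<delta>' where \<delta>': "p dvd (2 ^ 2 * d1 ^ 2 * y ^ 3) * \<delta>' - 1"
      using gint_inverse_mod[OF prime odd] by blast
    \<comment> \<open>Shifting \<open>y\<close> by \<open>p * \<delta>\<close> brings the
      coefficient of \<open>p ^ 3\<close> to \<open>d1\<close> modulo \<open>p\<close>, which is its
      value in \<open>d * w ^ 2\<close> for \<open>w = p\<close>. This is possible because the
      derivative \<open>4 * d1 ^ 2 * y ^ 3\<close> is invertible.\<close>
    define \<delta> where "\<delta> = \<delta>' * (d1 - \<gamma>)"
    define s where "s = d1 ^ 2 * (6 * y ^ 2 * \<delta> ^ 2 + 4 * y * \<delta> ^ 3 * p + \<delta> ^ 4 * p ^ 2)"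
    have "d1 ^ 2 * (y + p * \<delta>) ^ 4 + b1 * d1 ^ 4 =
        (d1 ^ 2 * y ^ 4 + b1 * d1 ^ 4) + p * (2 ^ 2 * d1 ^ 2 * y ^ 3 * \<delta>) + p ^ 2 * s"
      by (simp add: s_def numeral_eq_Suc algebra_simps)
    also have "\<dots> = p * (\<gamma> + 2 ^ 2 * d1 ^ 2 * y ^ 3 * \<delta> + p * s)"
      unfolding \<gamma> by (simp add: power2_eq_square algebra_simps)
    finally have eq: "d1 ^ 2 * (y + p * \<delta>) ^ 4 + b1 * d1 ^ 4 = p * (\<gamma> + 2 ^ 2 * d1 ^ 2 * y ^ 3 * \<delta> + p * s)" .
    have "\<gamma> + 2 ^ 2 * d1 ^ 2 * y ^ 3 * \<delta> + p * s - d1 =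
        ((2 ^ 2 * d1 ^ 2 * y ^ 3) * \<delta>' - 1) * (d1 - \<gamma>) + p * s"
      by (simp add: \<delta>_def algebra_simps)
    also have "p dvd \<dots>" using \<delta>' by simp
    finally have "p dvd \<gamma> + 2 ^ 2 * d1 ^ 2 * y ^ 3 * \<delta> + p * s - d1" .
    moreover have "d ^ 2 * (y + p * \<delta>) ^ 4 + b * d1 ^ 4 = p ^ 3 * (\<gamma> + 2 ^ 2 * d1 ^ 2 * y ^ 3 * \<delta> + p * s)"
    proof -
      have "d ^ 2 * (y + p * \<delta>) ^ 4 + b * d1 ^ 4 = p ^ 2 * (d1 ^ 2 * (y + p * \<delta>) ^ 4 + b1 * d1 ^ 4)"
        by (simp add: d(1) b(1) 4 power_mult_distrib algebra_simps)
      then show ?thesis unfolding eq by (simp add: numeral_eq_Suc algebra_simps)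
    qed
    moreover have "d * p ^ 2 = p ^ 3 * d1" by (simp add: d(1) 4 numeral_eq_Suc algebra_simps)
    ultimately show ?thesis using unit_solvableI d(2) by blast
  qed
qed

text \<open>The valuation of \<open>d * w ^ 2\<close> has the parity of \<open>e\<close>. Comparison
  with the two quartic terms shows which of them can lead, and \<open>main\<close> then compares
  leading coefficients.\<close>

lemma local_cond_of_approx_solvable:
  assumes d: "d = p ^ e * d1" "\<not> p dvd d1" and b: "b = p ^ r * b1" "\<not> p dvd b1"
    and e: "e \<le> 1" and r: "r \<in> {1, 2, 3}" and S: "approx_solvable p b d"
  shows "local_cond e r b1 d1"
proof -
  have "\<not> p ^ 2 dvd d"
    using power_dvd_power_mult_imp_le[of 2 e d1] d e by auto
  then obtain x z w' where xz: "\<not> (p dvd x \<and> p dvd z)"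
      and E0: "p ^ 10 dvd d ^ 2 * x ^ 4 + b * z ^ 4 - d * w' ^ 2"
    using approx_solvable_primitive[OF _ S] by blast
  \<comment> \<open>A zero \<open>w'\<close> is replaced by an element that vanishes at the working
    precision; 10 exceeds every leading valuation that occurs.\<close>
  define w where "w = (if w' = 0 then p ^ 10 else w')"
  have w0: "w \<noteq> 0" using p_nz by (simp add: w_def)
  have "p ^ 10 dvd w - w'" by (simp add: w_def)
  then have "p ^ 10 dvd w ^ 2 - w' ^ 2" by (rule dvd_power_diff)
  from dvd_diff[OF E0 dvd_mult[OF this, of d]]
  have E1: "p ^ 10 dvd d ^ 2 * x ^ 4 + b * z ^ 4 - d * w ^ 2" by (simp add: algebra_simps)
  obtain y where y: "w = p ^ multiplicity p w * y" "\<not> p dvd y"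
    using multiplicity_decompose'[OF w0] p_nu by metis
  define l where "l = multiplicity p w"
  have dw: "d * w ^ 2 = p ^ (e + 2 * l) * (d1 * y ^ 2)"
    by (subst y(1)) (simp add: d(1) l_def power_add power_mult_distrib algebra_simps flip: power_mult)
  have o: "\<not> p dvd d1 * y ^ 2" using d(2) y(2) by (intro not_dvd_mult not_dvd_power)
  have d2: "d ^ 2 = p ^ (2 * e) * d1 ^ 2" by (simp add: d(1) power_mult_distrib mult.commute flip: power_mult)
  note E = E1[unfolded dw d2 b(1)]
  have main: "n = e + 2 * l \<and> p dvd u - d1 * y ^ 2"
    if "p ^ (2 * e) * d1 ^ 2 * x ^ 4 + p ^ r * b1 * z ^ 4 = p ^ n * u" "\<not> p dvd u" "n < 10" for n u
  proof -
    have E2: "p ^ 10 dvd p ^ n * u - p ^ (e + 2 * l) * (d1 * y ^ 2)" using E unfolding that(1) .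
    have n: "n = e + 2 * l" by (rule power_cong_imp_eq[OF E2 that(2) o that(3)])
    have "p ^ (n + 1) dvd p ^ n * (u - d1 * y ^ 2)"
      using power_le_dvd[OF E2, of "n + 1"] that(3) unfolding n[symmetric] by (simp add: right_diff_distrib)
    then show ?thesis using n unfolding dvd_power_mult_cancel[OF p_nz] by simp
  qed
  have pos4: "p dvd u ^ 4" if "p dvd u" for u using that dvd_power_le[of p u 1 4] by simp
  have even_d1: "even (qlog p d1)" if "p dvd d1 ^ 2 * x ^ 4 - d1 * y ^ 2" "\<not> p dvd x"
  proof -
    have "d1 * (y ^ 2 - d1 * x ^ 4) = - (d1 ^ 2 * x ^ 4 - d1 * y ^ 2)" by (simp add: power2_eq_square algebra_simps)
    then have "p dvd d1 * (y ^ 2 - d1 * x ^ 4)" using that(1) by (simp only: dvd_minus_iff)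
    then have "p dvd y ^ 2 - d1 * x ^ 4" using d(2) prime by (simp add: prime_elem_dvd_mult_iff)
    then have "even (qlog p (d1 * x ^ 4))" using square_iff d(2) that(2) not_dvd_mult not_dvd_power by blast
    moreover have "[qlog p (d1 * x ^ 4) = qlog p d1 + int 4 * qlog p x] (mod 4)"
      by (rule qlog_mult_power[OF d(2) that(2)])
    ultimately show ?thesis using cong4_even[of "qlog p (d1 * x ^ 4)"] by simp
  qed
  have even_bd: "even (qlog p b1 + qlog p d1)" if "p dvd b1 * z ^ 4 - d1 * y ^ 2" "\<not> p dvd z"
  proof -
    have "[qlog p (b1 * z ^ 4) = qlog p (d1 * y ^ 2)] (mod 4)"
      using that b(2) by (intro qlog_cong not_dvd_mult not_dvd_power)
    then have "even (qlog p (b1 * z ^ 4)) = even (qlog p (d1 * y ^ 2))" by (rule cong4_even)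
    moreover have "even (qlog p (b1 * z ^ 4)) = even (qlog p b1 + int 4 * qlog p z)"
      by (rule cong4_even, rule qlog_mult_power[OF b(2) that(2)])
    moreover have "even (qlog p (d1 * y ^ 2)) = even (qlog p d1 + int 2 * qlog p y)"
      by (rule cong4_even, rule qlog_mult_power[OF d(2) y(2)])
    ultimately show ?thesis by simp
  qed
  show ?thesis
  proof (cases "p dvd x")
    case False
    show ?thesis
    proof (cases "e = 0")
      case True
      have u: "p ^ (2 * e) * d1 ^ 2 * x ^ 4 + p ^ r * b1 * z ^ 4 = p ^ 0 * (d1 ^ 2 * x ^ 4 + p ^ r * b1 * z ^ 4)"
        by (simp add: True)
      have pr: "p dvd p ^ r * b1 * z ^ 4" using r by (auto simp: dvd_power)
      have "\<not> p dvd d1 ^ 2 * x ^ 4 + p ^ r * b1 * z ^ 4"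
        using d(2) False not_dvd_mult not_dvd_power pr by (simp add: dvd_add_left_iff)
      from main[OF u this] have "p dvd d1 ^ 2 * x ^ 4 + p ^ r * b1 * z ^ 4 - d1 * y ^ 2" by simp
      from dvd_diff[OF this pr] have "p dvd d1 ^ 2 * x ^ 4 - d1 * y ^ 2" by simp
      from even_d1[OF this False] show ?thesis using True by (simp add: local_cond_def)
    next
      case e1: False
      then have e1: "e = 1" using e by simp
      consider "r = 1" | "r = 2" | "r = 3" using r by blast
      then show ?thesis
      proof cases
        case 1
        show ?thesis
        proof (cases "p dvd z")
          case True
          then obtain z' where z': "z = p * z'" ..
          have u: "p ^ (2 * e) * d1 ^ 2 * x ^ 4 + p ^ r * b1 * z ^ 4 = p ^ 2 * (d1 ^ 2 * x ^ 4 + p * (p ^ 2 * b1 * z' ^ 4))"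
            by (simp add: e1 1 z' numeral_eq_Suc algebra_simps)
          have "\<not> p dvd d1 ^ 2 * x ^ 4 + p * (p ^ 2 * b1 * z' ^ 4)"
            using d(2) False not_dvd_mult not_dvd_power by (simp add: dvd_add_left_iff)
          from main[OF u this] have "2 = e + 2 * l" by simp
          then show ?thesis using e1 by presburger
        next
          case z: False
          have u: "p ^ (2 * e) * d1 ^ 2 * x ^ 4 + p ^ r * b1 * z ^ 4 = p ^ 1 * (b1 * z ^ 4 + p * (d1 ^ 2 * x ^ 4))"
            by (simp add: e1 1 numeral_eq_Suc algebra_simps)
          have "\<not> p dvd b1 * z ^ 4 + p * (d1 ^ 2 * x ^ 4)"
            using b(2) z not_dvd_mult not_dvd_power by (simp add: dvd_add_left_iff)
          from main[OF u this] have "p dvd b1 * z ^ 4 + p * (d1 ^ 2 * x ^ 4) - d1 * y ^ 2" by simp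
          from dvd_diff[OF this dvd_triv_left[of p "d1 ^ 2 * x ^ 4"]] have "p dvd b1 * z ^ 4 - d1 * y ^ 2" by simp
          from even_bd[OF this z] show ?thesis using 1 e1 by (simp add: local_cond_def)
        qed
      next
        case 3
        have u: "p ^ (2 * e) * d1 ^ 2 * x ^ 4 + p ^ r * b1 * z ^ 4 = p ^ 2 * (d1 ^ 2 * x ^ 4 + p * (b1 * z ^ 4))"
          by (simp add: e1 3 numeral_eq_Suc algebra_simps)
        have "\<not> p dvd d1 ^ 2 * x ^ 4 + p * (b1 * z ^ 4)"
          using d(2) False not_dvd_mult not_dvd_power by (simp add: dvd_add_left_iff)
        from main[OF u this] have "2 = e + 2 * l" by simp
        then show ?thesis using e1 by presburger
      next
        case 2
        have u: "p ^ (2 * e) * d1 ^ 2 * x ^ 4 + p ^ r * b1 * z ^ 4 = p ^ 2 * (d1 ^ 2 * x ^ 4 + b1 * z ^ 4)"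
          by (simp add: e1 2 power2_eq_square algebra_simps)
        \<comment> \<open>Without this cancellation the sum would have valuation exactly 2, which is
          not of the form \<open>1 + 2 * l\<close>.\<close>
        have pd: "p dvd d1 ^ 2 * x ^ 4 + b1 * z ^ 4"
        proof (rule ccontr)
          assume "\<not> p dvd d1 ^ 2 * x ^ 4 + b1 * z ^ 4"
          from main[OF u this] have "2 = e + 2 * l" by simp
          then show False using e1 by presburger
        qed
        have odx: "\<not> p dvd d1 ^ 2 * x ^ 4" using d(2) False not_dvd_mult not_dvd_power by blast
        have z: "\<not> p dvd z"
        proof
          assume "p dvd z"
          then have "p dvd b1 * z ^ 4" using pos4 by simp
          then show False using pd odx by (simp add: dvd_add_left_iff)
        qed
        have m1: "\<not> p dvd -1" by (rule not_dvd_unit) simp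
        have bz: "\<not> p dvd b1 * z ^ 4" using b(2) z by (intro not_dvd_mult not_dvd_power)
        have "p dvd (-1) * (b1 * z ^ 4) - d1 ^ 2 * x ^ 4"
        proof -
          have "(-1) * (b1 * z ^ 4) - d1 ^ 2 * x ^ 4 = - (d1 ^ 2 * x ^ 4 + b1 * z ^ 4)" by simp
          then show ?thesis using pd by (simp only: dvd_minus_iff)
        qed
        then have c1: "[qlog p ((-1) * (b1 * z ^ 4)) = qlog p (d1 ^ 2 * x ^ 4)] (mod 4)"
          by (rule qlog_cong[OF _ not_dvd_mult[OF m1 bz]])
        have c2: "[qlog p ((-1) * (b1 * z ^ 4)) = qlog p (-1) + (qlog p b1 + int 4 * qlog p z)] (mod 4)"
          by (rule cong_trans[OF qlog_mult[OF m1 bz] cong_add[OF cong_refl qlog_mult_power[OF b(2) z]]])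
        have c3: "[qlog p (d1 ^ 2 * x ^ 4) = int 2 * qlog p d1 + int 4 * qlog p x] (mod 4)"
          using cong_trans[OF qlog_mult[OF not_dvd_power[OF d(2)] not_dvd_power[OF False], of 2 4]
            cong_add[OF qlog_power[OF d(2), of 2] qlog_power[OF False, of 4]]] .
        have "[qlog p (-1) + (qlog p b1 + int 4 * qlog p z) = int 2 * qlog p d1 + int 4 * qlog p x] (mod 4)"
          using cong_trans[OF cong_sym[OF c2] cong_trans[OF c1 c3]] .
        then have "4 dvd (qlog p (-1) + (qlog p b1 + int 4 * qlog p z)) - (int 2 * qlog p d1 + int 4 * qlog p x)"
          by (simp only: cong_iff_dvd_diff)
        then have "4 dvd qlog p (-1) + qlog p b1 + 2 * qlog p d1 - 0" by presburger
        then have "[qlog p (-1) + qlog p b1 + 2 * qlog p d1 = 0] (mod 4)" by (simp only: cong_iff_dvd_diff)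
        then show ?thesis using 2 e1 by (simp add: local_cond_def)
      qed
    qed
  next
    case True
    then have z: "\<not> p dvd z" using xz by blast
    obtain x' where x': "x = p * x'" using True ..
    \<comment> \<open>\<open>p\<close> divides \<open>x\<close>, so the first term has valuation at
      least 4, and \<open>r \<le> 3\<close> makes \<open>b * z ^ 4\<close> the leading one.\<close>
    have u: "p ^ (2 * e) * d1 ^ 2 * x ^ 4 + p ^ r * b1 * z ^ 4
        = p ^ r * (b1 * z ^ 4 + p * (p ^ (2 * e + 3 - r) * d1 ^ 2 * x' ^ 4))"
    proof -
      have "p ^ (2 * e) * p ^ 4 = p ^ r * (p * p ^ (2 * e + 3 - r))"
        using r by (simp flip: power_add power_Suc) (rule arg_cong[of _ _ "\<lambda>n. p ^ n"], auto)
      then show ?thesis by (simp add: x' power_mult_distrib algebra_simps)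
    qed
    have nd: "\<not> p dvd b1 * z ^ 4 + p * (p ^ (2 * e + 3 - r) * d1 ^ 2 * x' ^ 4)"
      using b(2) z not_dvd_mult not_dvd_power by (simp add: dvd_add_left_iff)
    have r10: "r < 10" using r by auto
    have M: "r = e + 2 * l" "p dvd b1 * z ^ 4 + p * (p ^ (2 * e + 3 - r) * d1 ^ 2 * x' ^ 4) - d1 * y ^ 2"
      using main[OF u nd r10] by blast+
    from dvd_diff[OF M(2) dvd_triv_left[of p "p ^ (2 * e + 3 - r) * d1 ^ 2 * x' ^ 4"]]
    have "p dvd b1 * z ^ 4 - d1 * y ^ 2" by simp
    from even_bd[OF this z] have ev: "even (qlog p b1 + qlog p d1)" .
    have "r = 2 \<longleftrightarrow> e = 0" using M(1) r e by auto presburger+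
    then show ?thesis using ev e by (auto simp: local_cond_def)
  qed
qed

end

section \<open>Frobenius congruences\<close>

lemma freshman_dvd:
  fixes x y :: "'a :: comm_ring_1"
  assumes q: "prime q" shows "of_nat q dvd (x + y) ^ q - (x ^ q + y ^ q)"
proof -
  have q0: "q > 0" using q by (rule prime_gt_0_nat)
  have "(x + y) ^ q = (\<Sum>k\<le>q. of_nat (q choose k) * x ^ k * y ^ (q - k))" by (rule binomial_ring)
  also have "{..q} = insert 0 (insert q {0<..<q})" using q0 by auto
  also have "(\<Sum>k\<in>\<dots>. of_nat (q choose k) * x ^ k * y ^ (q - k)) =
      y ^ q + (x ^ q + (\<Sum>k\<in>{0<..<q}. of_nat (q choose k) * x ^ k * y ^ (q - k)))"
    using q0 by simp
  finally have "(x + y) ^ q - (x ^ q + y ^ q) = (\<Sum>k\<in>{0<..<q}. of_nat (q choose k) * x ^ k * y ^ (q - k))"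
    by simp
  also have "of_nat q dvd \<dots>"
  proof (intro dvd_sum dvd_mult2)
    fix k assume "k \<in> {0<..<q}"
    then have "q dvd (q choose k)" using q by (intro dvd_choose_prime) auto
    then show "(of_nat q :: 'a) dvd of_nat (q choose k)" by (auto elim!: dvdE)
  qed
  finally show ?thesis .
qed

lemma freshman_sum_dvd:
  fixes f :: "'b \<Rightarrow> 'a :: comm_ring_1"
  assumes q: "prime q" shows "of_nat q dvd (\<Sum>x\<in>A. f x) ^ q - (\<Sum>x\<in>A. f x ^ q)"
proof (induction A rule: infinite_finite_induct)
  case (insert x A)
  have "of_nat q dvd (f x + sum f A) ^ q - (f x ^ q + sum f A ^ q) + (sum f A ^ q - (\<Sum>x\<in>A. f x ^ q))"
    using insert freshman_dvd[OF q] by (intro dvd_add) auto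
  then show ?case using insert by (simp add: algebra_simps)
qed (use prime_gt_0_nat[OF q] in \<open>simp_all add: power_0_left\<close>)

text \<open>Modulo \<open>q\<close>, the binomial formula and Fermat's theorem reduce the power of a
  + b i to a + i^q b, and i^q is i or -i according to \<open>q mod 4\<close>.\<close>

lemma gint_frobenius:
  assumes q: "prime q" "odd q"
  shows "of_nat q dvd x ^ q - (if q mod 4 = 1 then x else gcnj x)"
proof -
  have int_pow: "(of_nat q :: gint) dvd of_int n ^ q - of_int n" for n :: int
  proof -
    have nat: "[a ^ q = a] (mod q)" for a
    proof (cases "q dvd a")
      case True
      then have "q dvd a ^ q" using prime_gt_0_nat[OF q(1)] by (meson dvd_power dvd_trans)
      then show ?thesis using True by (simp add: unique_euclidean_semiring_class.cong_def mod_eq_0_iff_dvd)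
    next
      case False
      have "[a ^ (q - 1) * a = 1 * a] (mod q)" by (intro cong_mult cong_refl fermat_theorem q(1) False)
      then show ?thesis by (simp only: power_minus_mult[OF prime_gt_0_nat[OF q(1)]] mult_1)
    qed
    define a where "a = nat (n mod int q)"
    have na: "[n = int a] (mod int q)" using prime_gt_0_nat[OF q(1)] by (simp add: a_def)
    have "[n ^ q = int (a ^ q)] (mod int q)" using cong_pow[OF na, of q] by simp
    also have "[int (a ^ q) = int a] (mod int q)" using nat[of a] by (simp only: cong_int_iff)
    also have "[int a = n] (mod int q)" using na by (rule cong_sym)
    finally have "[n ^ q = n] (mod int q)" .
    then have "int q dvd n ^ q - n" by (simp add: cong_iff_dvd_diff)
    then have "(of_int (int q) :: gint) dvd of_int (n ^ q - n)" by (simp only: of_int_dvd_gint_iff gRe_of_int gIm_of_int dvd_0_right)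
    then show ?thesis by simp
  qed
  define a c where "a = gRe x" and "c = gIm x"
  have x: "x = of_int a + gi * of_int c" unfolding a_def c_def by (rule gint_decomp)
  have giq: "gi ^ q = (if q mod 4 = 1 then gi else - gi)"
  proof -
    have "q mod 4 = 1 \<or> q mod 4 = 3" using q(2) by presburger
    then show ?thesis using gi_power_mod[of q] by (elim disjE) (simp_all add: power3_eq_cube)
  qed
  have "x ^ q - (if q mod 4 = 1 then x else gcnj x) =
    (x ^ q - (of_int a ^ q + (gi * of_int c) ^ q)) + (of_int a ^ q - of_int a) + gi ^ q * (of_int c ^ q - of_int c)"
    by (auto simp: giq power_mult_distrib x algebra_simps)
  also have "of_nat q dvd \<dots>"
    using freshman_dvd[OF q(1), of "of_int a" "gi * of_int c :: gint"] int_pow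
    by (intro dvd_add dvd_mult) (simp_all add: x)
  finally show ?thesis .
qed

text \<open>As \<open>gt ^ 9 = 16 gt\<close>, the residue of \<open>a + b i\<close> modulo \<open>gt ^ 9\<close> is determined by \<open>b mod 16\<close> and
  \<open>(a + b) mod 32\<close>, which \<open>nf9\<close> packs into one integer; \<open>gen_pow m n\<close> is
  \<open>(1 - 4 i) ^ m (-1 - 6 i) ^ n\<close> modulo \<open>32\<close>.\<close>

definition nf9 :: "int \<times> int \<Rightarrow> int" where
  "nf9 = (\<lambda>(a, b). 32 * (b mod 16) + (a + b) mod 32)"

definition gen_pow :: "nat \<Rightarrow> nat \<Rightarrow> int \<times> int" where
  "gen_pow m n = ((\<lambda>(a, b). ((a + 4 * b) mod 32, (b - 4 * a) mod 32)) ^^ m)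
     (((\<lambda>(a, b). ((6 * b - a) mod 32, (- b - 6 * a) mod 32)) ^^ n) (1, 0))"

text \<open>A finite check over all 64 pairs. For a primary a + b i, the classical exponent of the
  quartic symbol of \<open>gt\<close> is (a - b - b^2 - 1) / 4, and that of \<open>gi\<close> is
  (a^2 + b^2 - 1) / 4; the table identifies them with \<open>m\<close> and \<open>n\<close> modulo
  4.\<close>

lemma gen_pow_table:
  "distinct (map (\<lambda>(m, n). nf9 (gen_pow m n)) (List.product [0..<8] [0..<8])) \<and>
   list_all (\<lambda>(m, n). let (a, b) = gen_pow m n in b mod 2 = 0 \<and> (a + b) mod 4 = 1 \<and>
     (a - b - b * b - 1) mod 16 = 4 * int (m mod 4) \<and> (a * a + b * b - 1) mod 16 = 4 * int (n mod 4))
     (List.product [0..<8] [0..<8])"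
  by code_simp

lemma nf9_eq_iff:
  "nf9 (a, b) = nf9 (a', b') \<longleftrightarrow> b mod 16 = b' mod 16 \<and> (a + b) mod 32 = (a' + b') mod 32"
proof -
  have "u = u' \<and> s = s'" if "0 \<le> s" "s < 32" "0 \<le> s'" "s' < 32" "32 * u + s = 32 * u' + s'"
    for u s u' s' :: int
  proof -
    have "u \<le> u'" "u' \<le> u" using that by linarith+
    then show ?thesis using that(5) by simp
  qed
  from this[of "(a + b) mod 32" "(a' + b') mod 32" "b mod 16" "b' mod 16"] show ?thesis
    unfolding nf9_def by auto
qed

lemma gt9_dvd_iff: "gt ^ 9 dvd x - y \<longleftrightarrow> nf9 (gRe x, gIm x) = nf9 (gRe y, gIm y)"
proof -
  have 9: "gt ^ 9 = of_int 16 * gt" by (simp add: gint_eq_iff numeral_eq_Suc)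
  have "gt ^ 9 dvd z \<longleftrightarrow> 16 dvd gIm z \<and> 32 dvd gRe z + gIm z" for z
  proof
    assume "gt ^ 9 dvd z"
    then obtain w where "z = of_int 16 * gt * w" unfolding 9 by blast
    then have "gIm z = 16 * (gIm w + gRe w)" "gRe z + gIm z = 32 * gRe w" by simp_all
    then show "16 dvd gIm z \<and> 32 dvd gRe z + gIm z" by (metis dvd_triv_left)
  next
    assume "16 dvd gIm z \<and> 32 dvd gRe z + gIm z"
    then obtain k l where "gIm z = 16 * k" "gRe z + gIm z = 32 * l" by blast
    then have "z = gt ^ 9 * GInt l (k - l)" unfolding 9 by (simp add: gint_eq_iff)
    then show "gt ^ 9 dvd z" by simp
  qed
  then have "gt ^ 9 dvd x - y \<longleftrightarrow> gIm x mod 16 = gIm y mod 16 \<and> (gRe x + gIm x) mod 32 = (gRe y + gIm y) mod 32"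
    by (simp add: mod_eq_dvd_iff algebra_simps)
  also have "\<dots> \<longleftrightarrow> nf9 (gRe x, gIm x) = nf9 (gRe y, gIm y)" by (simp only: nf9_eq_iff)
  finally show ?thesis .
qed

lemma gen_pow_eq:
  "[gRe ((1 - 4 * gi) ^ m * (- 1 - 6 * gi) ^ n) = fst (gen_pow m n)] (mod 32) \<and>
   [gIm ((1 - 4 * gi) ^ m * (- 1 - 6 * gi) ^ n) = snd (gen_pow m n)] (mod 32)"
proof -
  have n: "[gRe ((- 1 - 6 * gi) ^ n) = fst (gen_pow 0 n)] (mod 32) \<and>
   [gIm ((- 1 - 6 * gi) ^ n) = snd (gen_pow 0 n)] (mod 32)"
  proof (induction n)
    case (Suc n)
    define y where "y = (- 1 - 6 * gi) ^ n"
    have g: "gen_pow 0 (Suc n) = ((6 * snd (gen_pow 0 n) - fst (gen_pow 0 n)) mod 32,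
        (- snd (gen_pow 0 n) - 6 * fst (gen_pow 0 n)) mod 32)"
      by (simp add: gen_pow_def split: prod.splits)
    have "gRe ((- 1 - 6 * gi) ^ Suc n) = 6 * gIm y - gRe y" "gIm ((- 1 - 6 * gi) ^ Suc n) = - gIm y - 6 * gRe y"
      by (simp_all add: y_def algebra_simps)
    moreover have "[gRe y = fst (gen_pow 0 n)] (mod 32)" "[gIm y = snd (gen_pow 0 n)] (mod 32)"
      using Suc by (simp_all add: y_def)
    ultimately show ?case unfolding g
      by (simp add: cong_diff cong_minus_minus_iff cong_mult)
  qed (simp add: gen_pow_def)
  show ?thesis
  proof (induction m)
    case (Suc m)
    define y where "y = (1 - 4 * gi) ^ m * (- 1 - 6 * gi) ^ n"
    have g: "gen_pow (Suc m) n = ((fst (gen_pow m n) + 4 * snd (gen_pow m n)) mod 32,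
        (snd (gen_pow m n) - 4 * fst (gen_pow m n)) mod 32)"
      by (simp add: gen_pow_def split: prod.splits)
    have "(1 - 4 * gi) ^ Suc m * (- 1 - 6 * gi) ^ n = (1 - 4 * gi) * y" by (simp add: y_def)
    then have "gRe ((1 - 4 * gi) ^ Suc m * (- 1 - 6 * gi) ^ n) = gRe y + 4 * gIm y"
      "gIm ((1 - 4 * gi) ^ Suc m * (- 1 - 6 * gi) ^ n) = gIm y - 4 * gRe y"
      by (simp_all only:) simp_all
    moreover have "[gRe y = fst (gen_pow m n)] (mod 32)" "[gIm y = snd (gen_pow m n)] (mod 32)"
      using Suc by (simp_all add: y_def)
    ultimately show ?case unfolding g
      by (simp add: cong_add cong_diff cong_scalar_left)
  qed (use n in simp)
qed

lemma gt3_dvd_iff: "gt ^ 3 dvd z \<longleftrightarrow> even (gIm z) \<and> 4 dvd gRe z + gIm z"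
proof
  have 3: "gt ^ 3 = 2 * gi * gt" by (simp add: gint_eq_iff numeral_eq_Suc)
  {
    assume "gt ^ 3 dvd z"
    then obtain w where "z = 2 * gi * gt * w" unfolding 3 by blast
    then have "gIm z = 2 * (gRe w - gIm w)" "gRe z + gIm z = 4 * (- gIm w)" by simp_all
    then show "even (gIm z) \<and> 4 dvd gRe z + gIm z" by (metis dvd_triv_left)
  next
    assume "even (gIm z) \<and> 4 dvd gRe z + gIm z"
    then obtain k l where "gIm z = 2 * k" "gRe z + gIm z = 4 * l" by blast
    then have "z = gt ^ 3 * GInt (k - l) (- l)" unfolding 3 by (simp add: gint_eq_iff)
    then show "gt ^ 3 dvd z" by simp
  }
qed

lemma primary_iff: "primary x \<longleftrightarrow> even (gIm x) \<and> (gRe x + gIm x) mod 4 = 1"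
  unfolding primary_def gcong_def gt3_dvd_iff by simp presburger

text \<open>Counting gives existence of the exponents: primary elements fall into at most 64 classes
  modulo \<open>gt ^ 9\<close>, and the 64 products occupy distinct ones. Both expressions depend
  only on the coordinates modulo 16, which the class determines, so the table decides them.\<close>

lemma mn_exponents:
  assumes "primary x"
  shows "(gRe x - gIm x - (gIm x)\<^sup>2 - 1) mod 16 = 4 * int (m_exp x mod 4)"
    and "(Nm x - 1) mod 16 = 4 * int (n_exp x mod 4)"
proof -
  define T where "T = {0..<8::nat} \<times> {0..<8::nat}"
  have T: "set (List.product [0..<8] [0..<8]) = T" by (simp add: T_def)
  have inj: "inj_on (\<lambda>(m, n). nf9 (gen_pow m n)) T"
    using gen_pow_table unfolding distinct_map T by blast
  \<comment> \<open>Room for the normal forms of primary elements: 8 even values of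
    \<open>b mod 16\<close> and 8 values of \<open>(a + b) mod 32\<close> that are 1 modulo
    4.\<close>
  define S where "S = (\<lambda>(u, c). 32 * (2 * u) + (4 * c + 1)) ` ({0..<8::int} \<times> {0..<8::int})"
  have inS: "nf9 (a, b) \<in> S" if "b mod 2 = 0" "(a + b) mod 4 = 1" for a b
  proof -
    have "2 dvd b mod 16" using that(1) by (intro dvd_mod) auto
    then have b: "b mod 16 = 2 * (b mod 16 div 2)" by simp
    have "(a + b) mod 32 mod 4 = 1" using that(2) by (simp add: mod_mod_cancel)
    then have "(a + b) mod 32 = 4 * ((a + b) mod 32 div 4) + 1"
      using mult_div_mod_eq[of 4 "(a + b) mod 32"] by simp
    with b have "nf9 (a, b) = 32 * (2 * (b mod 16 div 2)) + (4 * ((a + b) mod 32 div 4) + 1)"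
      by (simp add: nf9_def)
    moreover have "(b mod 16 div 2, (a + b) mod 32 div 4) \<in> {0..<8} \<times> {0..<8}" by auto
    ultimately show ?thesis unfolding S_def
      by (intro image_eqI[where x = "(b mod 16 div 2, (a + b) mod 32 div 4)"]) (simp_all only: case_prod_conv)
  qed
  have props: "snd (gen_pow m n) mod 2 = 0" "(fst (gen_pow m n) + snd (gen_pow m n)) mod 4 = 1"
    "(fst (gen_pow m n) - snd (gen_pow m n) - snd (gen_pow m n) * snd (gen_pow m n) - 1) mod 16 = 4 * int (m mod 4)"
    "(fst (gen_pow m n) * fst (gen_pow m n) + snd (gen_pow m n) * snd (gen_pow m n) - 1) mod 16 = 4 * int (n mod 4)"
    if "(m, n) \<in> T" for m n
    using bspec[OF conjunct2[OF gen_pow_table, unfolded list_all_iff T] that]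
    by (simp_all add: case_prod_unfold Let_def)
  have "(\<lambda>(m, n). nf9 (gen_pow m n)) ` T \<subseteq> S"
    using props(1,2) inS by (auto simp: T_def) (metis prod.collapse atLeastLessThan_iff mem_Sigma_iff zero_le)
  moreover have "card S \<le> card T"
    unfolding S_def T_def by (rule order_trans[OF card_image_le]) simp_all
  moreover have "finite S" by (simp add: S_def)
  ultimately have img: "(\<lambda>(m, n). nf9 (gen_pow m n)) ` T = S"
    using inj by (metis card_image card_seteq)
  have nf: "nf9 (gRe ((1 - 4 * gi) ^ m * (- 1 - 6 * gi) ^ n), gIm ((1 - 4 * gi) ^ m * (- 1 - 6 * gi) ^ n))
      = nf9 (gen_pow m n)" for m n
  proof -
    have 1: "[gIm ((1 - 4 * gi) ^ m * (- 1 - 6 * gi) ^ n) = snd (gen_pow m n)] (mod 16)"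
      using gen_pow_eq[of m n] by (auto intro: cong_dvd_modulus)
    have 2: "[gRe ((1 - 4 * gi) ^ m * (- 1 - 6 * gi) ^ n) + gIm ((1 - 4 * gi) ^ m * (- 1 - 6 * gi) ^ n) =
        fst (gen_pow m n) + snd (gen_pow m n)] (mod 32)"
      using gen_pow_eq[of m n] by (intro cong_add) auto
    from 1 2 have "nf9 (gRe ((1 - 4 * gi) ^ m * (- 1 - 6 * gi) ^ n), gIm ((1 - 4 * gi) ^ m * (- 1 - 6 * gi) ^ n))
      = nf9 (fst (gen_pow m n), snd (gen_pow m n))"
      unfolding unique_euclidean_semiring_class.cong_def nf9_eq_iff by blast
    then show ?thesis by (simp only: prod.collapse)
  qed
  have x: "nf9 (gRe x, gIm x) \<in> S" using assms inS unfolding primary_iff by auto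
  then obtain m n where mn: "(m, n) \<in> T" "nf9 (gen_pow m n) = nf9 (gRe x, gIm x)"
    using img by (auto simp: image_iff)
  have ex: "mn_exponents x = (m, n)" unfolding mn_exponents_def
  proof (rule the_equality)
    show "fst (m, n) < 8 \<and> snd (m, n) < 8 \<and>
     gcong (gt ^ 9) x ((1 - 4 * gi) ^ fst (m, n) * (- 1 - 6 * gi) ^ snd (m, n))"
      using mn nf[of m n] by (simp add: gcong_def gt9_dvd_iff T_def)
    fix z assume z: "fst z < 8 \<and> snd z < 8 \<and> gcong (gt ^ 9) x ((1 - 4 * gi) ^ fst z * (- 1 - 6 * gi) ^ snd z)"
    then have "z \<in> T" by (cases z) (simp add: T_def)
    moreover have "(\<lambda>(m, n). nf9 (gen_pow m n)) z = (\<lambda>(m, n). nf9 (gen_pow m n)) (m, n)"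
      using z mn(2) nf[of "fst z" "snd z"] by (cases z) (simp add: gcong_def gt9_dvd_iff)
    ultimately show "z = (m, n)" using inj mn(1) by (meson inj_onD)
  qed
  define a b a' b' where "a = gRe x" and "b = gIm x" and "a' = fst (gen_pow m n)" and "b' = snd (gen_pow m n)"
  have "nf9 (a, b) = nf9 (a', b')" using mn(2) by (simp add: a_def b_def a'_def b'_def)
  then have "b mod 16 = b' mod 16 \<and> (a + b) mod 32 = (a' + b') mod 32" by (simp only: nf9_eq_iff)
  then have b: "[b = b'] (mod 16)" and ab: "[a + b = a' + b'] (mod 16)"
    by (auto simp: cong_iff_dvd_diff mod_eq_dvd_iff elim: dvd_trans[rotated])
  have a: "[a = a'] (mod 16)" using cong_diff[OF ab b] by simp
  have me: "m_exp x = m" "n_exp x = n" by (simp_all add: m_exp_def n_exp_def ex)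
  have "[a - b - b * b - 1 = a' - b' - b' * b' - 1] (mod 16)"
    by (intro cong_diff cong_mult a b cong_refl)
  then show "(gRe x - gIm x - (gIm x)\<^sup>2 - 1) mod 16 = 4 * int (m_exp x mod 4)"
    using props(3)[OF mn(1)]
    unfolding unique_euclidean_semiring_class.cong_def me power2_eq_square a_def b_def a'_def b'_def
    by (rule trans)
  have "[a * a + b * b - 1 = a' * a' + b' * b' - 1] (mod 16)"
    by (intro cong_diff cong_add cong_mult a b cong_refl)
  then show "(Nm x - 1) mod 16 = 4 * int (n_exp x mod 4)"
    using props(4)[OF mn(1)]
    unfolding unique_euclidean_semiring_class.cong_def me Nm_def power2_eq_square a_def b_def a'_def b'_def
    by (rule trans)
qed

section \<open>Gauss sums\<close>

text \<open>Gauss sums live in \<open>\<int>[i][X]\<close> modulo the \<open>P\<close>-th cyclotomic polynomial \<open>Phi\<close>.\<close>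

lemma const_poly_sum: "[:sum f A:] = (\<Sum>t\<in>A. [:f t:])" for f :: "'b \<Rightarrow> 'a :: comm_ring_1"
proof (induction A rule: infinite_finite_induct)
  case (insert x A)
  then show ?case unfolding sum.insert[OF insert.hyps] insert.IH[symmetric] by simp
qed simp_all

locale cyclotomic =
  fixes P :: int
  assumes P: "prime P" "odd P"
begin

lemma P_gt_2: "P > 2"
  using P prime_ge_2_int[of P] by (cases "P = 2") auto

definition X :: "gint poly" where "X = [:0, 1:]"

definition Phi :: "gint poly" where "Phi = (\<Sum>k<nat P. X ^ k)"

text \<open>Congruence modulo the ideal generated by \<open>q\<close> and \<open>Phi\<close>. For
  \<open>q = 0\<close> it is equality in Z[i][X] modulo \<open>Phi\<close>, so one relation serves
  both for exact identities of Gauss sums and for their reductions.\<close>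

definition pcong :: "gint \<Rightarrow> gint poly \<Rightarrow> gint poly \<Rightarrow> bool" where
  "pcong q f g \<longleftrightarrow> (\<exists>A B. f - g = [:q:] * A + Phi * B)"

lemma pcong_refl [simp]: "pcong q f f"
  unfolding pcong_def by (rule exI[of _ 0], rule exI[of _ 0]) simp

lemma pcong_sym: "pcong q f g \<Longrightarrow> pcong q g f"
  unfolding pcong_def
proof (elim exE)
  fix A B assume "f - g = [:q:] * A + Phi * B"
  then have "g - f = [:q:] * (- A) + Phi * (- B)" by (simp add: algebra_simps)
  then show "\<exists>A B. g - f = [:q:] * A + Phi * B" by blast
qed

lemma pcong_add: assumes "pcong q f g" "pcong q f' g'" shows "pcong q (f + f') (g + g')"
proof -
  obtain A B A' B' where "f - g = [:q:] * A + Phi * B" "f' - g' = [:q:] * A' + Phi * B'"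
    using assms unfolding pcong_def by blast
  then have "(f + f') - (g + g') = [:q:] * (A + A') + Phi * (B + B')" by (simp add: smult_add_right algebra_simps)
  then show ?thesis unfolding pcong_def by blast
qed

lemma pcong_mult_left: assumes "pcong q f g" shows "pcong q (h * f) (h * g)"
proof -
  obtain A B where "f - g = [:q:] * A + Phi * B" using assms unfolding pcong_def by blast
  then have "h * f - h * g = [:q:] * (h * A) + Phi * (h * B)"
    by (metis (no_types, lifting) distrib_left mult.left_commute right_diff_distrib)
  then show ?thesis unfolding pcong_def by blast
qed

lemma pcong_trans [trans]: assumes "pcong q f g" "pcong q g h" shows "pcong q f h"
proof -
  have "pcong q (f + g) (g + h)" using assms by (rule pcong_add)
  then show ?thesis unfolding pcong_def by simp
qed

lemma pcong_mult: assumes "pcong q f g" "pcong q f' g'" shows "pcong q (f * f') (g * g')"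
  using pcong_trans[OF pcong_mult_left[OF assms(2), of f] pcong_mult_left[OF assms(1), of g', unfolded mult.commute[of g']]] .

lemma pcong_power: "pcong q f g \<Longrightarrow> pcong q (f ^ n) (g ^ n)"
  by (induction n) (simp_all add: pcong_mult)

lemma pcong_sum: "(\<And>x. x \<in> A \<Longrightarrow> pcong q (f x) (g x)) \<Longrightarrow> pcong q (sum f A) (sum g A)"
  by (induction A rule: infinite_finite_induct) (simp_all add: pcong_add)

lemma pcong_0_imp: assumes "pcong 0 f g" shows "pcong q f g"
proof -
  obtain A B where "f - g = [:0:] * A + Phi * B" using assms unfolding pcong_def by blast
  then have "f - g = [:q:] * 0 + Phi * B" by simp
  then show ?thesis unfolding pcong_def by blast
qed

lemma degree_X_power [simp]: "degree (X ^ k) = k" and coeff_X_power: "Polynomial.coeff (X ^ k) m = (if m = k then 1 else 0)"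
proof -
  have "X ^ k = Polynomial.monom 1 k" by (simp add: X_def monom_altdef)
  then show "degree (X ^ k) = k" "Polynomial.coeff (X ^ k) m = (if m = k then 1 else 0)"
    by (simp_all add: degree_monom_eq)
qed

lemma coeff_Phi: "Polynomial.coeff Phi m = (if m < nat P then 1 else 0)"
  unfolding Phi_def coeff_sum by (auto simp: coeff_X_power)

lemma degree_Phi: "degree Phi = nat P - 1" and lead_Phi: "lead_coeff Phi = 1"
proof -
  show d: "degree Phi = nat P - 1"
    by (rule antisym, rule degree_le) (use P_gt_2 in \<open>auto simp: coeff_Phi intro!: le_degree\<close>)
  show "lead_coeff Phi = 1" unfolding d using P_gt_2 by (simp add: coeff_Phi)
qed

text \<open>Since \<open>Phi\<close> is monic of positive degree, the leading coefficient of a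
  nonzero \<open>B\<close> appears in a coefficient where the constant has 0, so it is a multiple of
  \<open>q\<close>. Its term can be absorbed into \<open>A\<close>, which lowers the degree of
  \<open>B\<close>. Congruences between constants thus descend to Z[i].\<close>

lemma pcong_const_imp_dvd:
  assumes "pcong q [:c:] [:c':]" shows "q dvd c - c'"
proof -
  have "q dvd c" if "[:c:] = [:q:] * A + Phi * B" for c A B
    using that
  proof (induction "degree B" arbitrary: A B rule: less_induct)
    case less
    show ?case
    proof (cases "B = 0")
      case True
      then have "[:c:] = Polynomial.smult q A" using less.prems by simp
      then have "c = q * Polynomial.coeff A 0" by (metis coeff_pCons_0 coeff_smult)
      then show ?thesis by simp
    next
      case False
      define n where "n = degree Phi + degree B"
      have n0: "n > 0" using P_gt_2 by (simp add: n_def degree_Phi)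
      have "Polynomial.coeff ([:q:] * A + Phi * B) n = q * Polynomial.coeff A n + lead_coeff B"
        using lead_Phi by (simp add: n_def coeff_mult_degree_sum)
      moreover have "Polynomial.coeff [:c:] n = 0" using n0 by (simp add: coeff_pCons split: nat.split)
      ultimately have lB: "lead_coeff B = q * (- Polynomial.coeff A n)" using less.prems by (simp add: algebra_simps eq_neg_iff_add_eq_0)
      define M where "M = Polynomial.monom (- Polynomial.coeff A n) (degree B)"
      define B' where "B' = B - [:q:] * M"
      have B: "B = [:q:] * M + B'" by (simp add: B'_def)
      have eq: "[:c:] = [:q:] * (A + Phi * M) + Phi * B'"
        unfolding less.prems by (subst B) (simp add: algebra_simps)
      have cB': "Polynomial.coeff B' (degree B) = 0" using lB by (simp add: B'_def M_def)
      have dB': "degree B' \<le> degree B"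
        unfolding B'_def M_def by (intro degree_diff_le) (auto simp: degree_monom_le intro: order_trans[OF degree_smult_le])
      show ?thesis
      proof (cases "degree B' < degree B")
        case True
        then show ?thesis using less.hyps eq by blast
      next
        case False
        then have "degree B' = degree B" using dB' by simp
        then have "B' = 0" using cB' by (metis leading_coeff_0_iff)
        then have "[:c:] = Polynomial.smult q (A + Phi * M)" using eq by simp
        then have "c = q * Polynomial.coeff (A + Phi * M) 0" by (metis coeff_pCons_0 coeff_smult)
        then show ?thesis by simp
      qed
    qed
  qed
  moreover obtain A B where "[:c:] - [:c':] = [:q:] * A + Phi * B" using assms unfolding pcong_def by blast
  ultimately show ?thesis by simp
qed

text \<open>The additive character modulo \<open>P\<close>, with the class of \<open>X\<close> as
  root of unity; reducing the exponent makes it periodic already as a polynomial.\<close>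

definition e :: "int \<Rightarrow> gint poly" where "e x = X ^ nat (x mod P)"

lemma e_cong: "[x = y] (mod P) \<Longrightarrow> e x = e y"
  by (simp add: e_def unique_euclidean_semiring_class.cong_def)

lemma pcong_XP: "pcong q (X ^ nat P) 1"
proof -
  have "X ^ nat P - 1 = (X - 1) * Phi" unfolding Phi_def by (rule power_diff_1_eq)
  then have "X ^ nat P - 1 = [:q:] * 0 + Phi * (X - 1)" by (simp add: mult.commute)
  then show ?thesis unfolding pcong_def by blast
qed

lemma pcong_e_add: "pcong q (e x * e y) (e (x + y))"
proof -
  have P0: "P > 0" using P_gt_2 by simp
  define s where "s = x mod P + y mod P"
  have s: "0 \<le> s" "s < 2 * P" unfolding s_def using pos_mod_sign[OF P0] pos_mod_bound[OF P0]
    by (smt (verit))+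
  have xy: "(x + y) mod P = s mod P" by (simp add: s_def mod_add_eq)
  have l: "e x * e y = X ^ nat s"
    using P0 by (simp add: e_def s_def nat_add_distrib power_add)
  show ?thesis
  proof (cases "s < P")
    case True
    then have "e (x + y) = X ^ nat s" using s by (simp add: e_def xy)
    then show ?thesis using l by simp
  next
    case False
    have "s mod P = (s - P) mod P" by simp
    also have "\<dots> = s - P" using s False by (intro mod_pos_pos_trivial) auto
    finally have "s mod P = s - P" .
    then have r: "e (x + y) = X ^ nat (s - P)" by (simp add: e_def xy)
    have "X ^ nat s = X ^ nat (s - P) * X ^ nat P"
      using False P0 by (simp flip: power_add nat_add_distrib)
    moreover have "pcong q (X ^ nat (s - P) * X ^ nat P) (X ^ nat (s - P) * 1)"
      by (intro pcong_mult_left pcong_XP)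
    ultimately show ?thesis using l r by simp
  qed
qed

lemma pcong_e_power: "pcong q (e x ^ n) (e (int n * x))"
proof (induction n)
  case 0
  show ?case by (simp add: e_def)
next
  case (Suc n)
  have "pcong q (e x * e x ^ n) (e x * e (int n * x))" by (rule pcong_mult_left[OF Suc])
  also have "pcong q (e x * e (int n * x)) (e (x + int n * x))" by (rule pcong_e_add)
  finally show ?case by (simp add: algebra_simps)
qed

abbreviation F :: "int set" where "F \<equiv> {0..<P}"

lemma bij_betw_F:
  assumes "\<not> P dvd c" shows "bij_betw (\<lambda>x. (c * x + a) mod P) F F"
proof -
  have P0: "P > 0" using P_gt_2 by simp
  have inj: "inj_on (\<lambda>x. (c * x + a) mod P) F"
  proof (rule inj_onI)
    fix x y assume xy: "x \<in> F" "y \<in> F" "(c * x + a) mod P = (c * y + a) mod P"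
    then have "P dvd c * (x - y)" by (simp add: mod_eq_dvd_iff algebra_simps)
    then have "P dvd x - y" using P(1) assms by (simp add: prime_dvd_mult_iff)
    then show "x = y" using xy by (metis atLeastLessThan_iff mod_eq_dvd_iff mod_pos_pos_trivial)
  qed
  have "(\<lambda>x. (c * x + a) mod P) ` F \<subseteq> F" using P0 by auto
  then have "(\<lambda>x. (c * x + a) mod P) ` F = F" using inj by (intro endo_inj_surj) auto
  with inj show ?thesis by (rule bij_betw_imageI)
qed

lemma sum_F_affine:
  assumes "\<not> P dvd c" "\<And>x y. [x = y] (mod P) \<Longrightarrow> f x = f y"
  shows "(\<Sum>x\<in>F. f (c * x + a)) = (\<Sum>x\<in>F. f x)"
proof -
  have "(\<Sum>x\<in>F. f x) = (\<Sum>x\<in>F. f ((c * x + a) mod P))"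
    by (rule sum.reindex_bij_betw[OF bij_betw_F[OF assms(1)], symmetric])
  also have "\<dots> = (\<Sum>x\<in>F. f (c * x + a))" by (intro sum.cong refl assms(2)) simp
  finally show ?thesis by simp
qed

lemma sum_e: "pcong q (\<Sum>x\<in>F. e (c * x)) (if P dvd c then [:of_int P:] else 0)"
proof (cases "P dvd c")
  case True
  then have "e (c * x) = 1" for x by (auto simp: e_def elim!: dvdE)
  then have "(\<Sum>x\<in>F. e (c * x)) = of_nat (card F)" by simp
  also have "\<dots> = [:of_int P:]" using P_gt_2 by (simp add: of_nat_poly)
  finally show ?thesis using True by simp
next
  case False
  have "(\<Sum>x\<in>F. e (c * x)) = (\<Sum>x\<in>F. e x)"
    using sum_F_affine[OF False, of e 0] e_cong by simp
  also have "\<dots> = (\<Sum>k<nat P. X ^ k)"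
    by (rule sum.reindex_bij_witness[of _ int nat]) (auto simp: e_def)
  finally have "(\<Sum>x\<in>F. e (c * x)) - 0 = [:q:] * 0 + Phi * 1" by (simp add: Phi_def)
  then have "pcong q (\<Sum>x\<in>F. e (c * x)) 0" unfolding pcong_def by blast
  then show ?thesis using False by simp
qed

section \<open>Gauss and Jacobi sums of multiplicative characters\<close>

definition char :: "(int \<Rightarrow> gint) \<Rightarrow> bool" where
  "char \<chi> \<longleftrightarrow> (\<forall>x y. \<chi> (x * y) = \<chi> x * \<chi> y) \<and> (\<forall>x y. [x = y] (mod P) \<longrightarrow> \<chi> x = \<chi> y) \<and>
    (\<forall>x. P dvd x \<longrightarrow> \<chi> x = 0) \<and> (\<forall>x. \<not> P dvd x \<longrightarrow> \<chi> x * gcnj (\<chi> x) = 1)"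

definition gsum :: "(int \<Rightarrow> gint) \<Rightarrow> gint poly" where
  "gsum \<chi> = (\<Sum>x\<in>F. [:\<chi> x:] * e x)"

definition jsum :: "(int \<Rightarrow> gint) \<Rightarrow> gint" where
  "jsum \<chi> = (\<Sum>x\<in>F. \<chi> x * \<chi> (1 - x))"

lemma char_mult: "char \<chi> \<Longrightarrow> \<chi> (x * y) = \<chi> x * \<chi> y"
  unfolding char_def by (drule conjunct1) simp

lemma char_cong: "char \<chi> \<Longrightarrow> [x = y] (mod P) \<Longrightarrow> \<chi> x = \<chi> y"
  unfolding char_def by (drule conjunct2, drule conjunct1) (drule spec2, erule mp)

lemma char_0: "char \<chi> \<Longrightarrow> P dvd x \<Longrightarrow> \<chi> x = 0"
  unfolding char_def by (drule conjunct2, drule conjunct2, drule conjunct1) simp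

lemma char_unit: "char \<chi> \<Longrightarrow> \<not> P dvd x \<Longrightarrow> \<chi> x * gcnj (\<chi> x) = 1"
  unfolding char_def by (drule conjunct2, drule conjunct2, drule conjunct2) simp

lemma char_cnj: assumes \<chi>: "char \<chi>" shows "char (\<lambda>x. gcnj (\<chi> x))"
  unfolding char_def
proof (intro conjI allI impI)
  fix x y
  show "gcnj (\<chi> (x * y)) = gcnj (\<chi> x) * gcnj (\<chi> y)" by (simp add: char_mult[OF \<chi>])
  show "[x = y] (mod P) \<Longrightarrow> gcnj (\<chi> x) = gcnj (\<chi> y)" by (simp only: char_cong[OF \<chi>])
  show "P dvd x \<Longrightarrow> gcnj (\<chi> x) = 0" by (simp add: char_0[OF \<chi>])
  show "\<not> P dvd x \<Longrightarrow> gcnj (\<chi> x) * gcnj (gcnj (\<chi> x)) = 1"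
    using char_unit[OF \<chi>, of x] by (simp add: mult.commute)
qed

lemma char_power2: assumes \<chi>: "char \<chi>" shows "char (\<lambda>x. \<chi> x ^ 2)"
  unfolding char_def
proof (intro conjI allI impI)
  fix x y
  show "\<chi> (x * y) ^ 2 = \<chi> x ^ 2 * \<chi> y ^ 2" by (simp add: char_mult[OF \<chi>] power_mult_distrib)
  show "[x = y] (mod P) \<Longrightarrow> \<chi> x ^ 2 = \<chi> y ^ 2" by (simp only: char_cong[OF \<chi>])
  show "P dvd x \<Longrightarrow> \<chi> x ^ 2 = 0" by (simp add: char_0[OF \<chi>])
  show "\<not> P dvd x \<Longrightarrow> \<chi> x ^ 2 * gcnj (\<chi> x ^ 2) = 1"
    using char_unit[OF \<chi>, of x] by (simp flip: power_mult_distrib)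
qed

lemma char_1: assumes "char \<chi>" shows "\<chi> 1 = 1"
proof -
  have "\<not> P dvd 1" using P(1) by (metis not_prime_unit)
  then have "\<chi> 1 \<noteq> 0" using char_unit[OF assms, of 1] by auto
  moreover have "\<chi> 1 * \<chi> 1 = \<chi> 1 * 1" using char_mult[OF assms, of 1 1] by simp
  ultimately show ?thesis by simp
qed

lemma sum_char:
  assumes "char \<chi>" "\<not> P dvd a" "\<chi> a \<noteq> 1" shows "(\<Sum>x\<in>F. \<chi> x) = 0"
proof -
  define S where "S = (\<Sum>x\<in>F. \<chi> x)"
  have "S = (\<Sum>x\<in>F. \<chi> (a * x + 0))"
    unfolding S_def using assms(2) by (rule sum_F_affine[symmetric]) (rule char_cong[OF assms(1)])
  also have "\<dots> = \<chi> a * S" by (simp add: char_mult[OF assms(1)] S_def sum_distrib_left)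
  finally have eq: "S = \<chi> a * S" .
  have "(1 - \<chi> a) * S = S - \<chi> a * S" by (simp add: algebra_simps)
  also have "\<dots> = 0" unfolding eq[symmetric] by simp
  finally show ?thesis using assms(3) by (simp add: S_def)
qed

lemma gsum_scale:
  assumes \<chi>: "char \<chi>" and c: "\<not> P dvd c"
  shows "(\<Sum>x\<in>F. [:\<chi> x:] * e (c * x)) = [:gcnj (\<chi> c):] * gsum \<chi>"
proof -
  have "(\<Sum>x\<in>F. [:\<chi> x:] * e (c * x)) = [:gcnj (\<chi> c):] * (\<Sum>x\<in>F. [:\<chi> (c * x + 0):] * e (c * x + 0))"
    unfolding sum_distrib_left
  proof (rule sum.cong)
    fix x
    have "gcnj (\<chi> c) * \<chi> (c * x) = (\<chi> c * gcnj (\<chi> c)) * \<chi> x" by (simp add: char_mult[OF \<chi>])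
    then have "\<chi> x = gcnj (\<chi> c) * \<chi> (c * x)" by (simp add: char_unit[OF \<chi> c])
    then show "[:\<chi> x:] * e (c * x) = [:gcnj (\<chi> c):] * ([:\<chi> (c * x + 0):] * e (c * x + 0))"
      by (simp add: mult.commute)
  qed simp
  also have "(\<Sum>x\<in>F. [:\<chi> (c * x + 0):] * e (c * x + 0)) = gsum \<chi>"
    unfolding gsum_def
    by (rule sum_F_affine[OF c, of "\<lambda>x. [:\<chi> x:] * e x"]) (simp only: e_cong char_cong[OF \<chi>])
  finally show ?thesis .
qed

text \<open>Substituting \<open>y = x * t\<close> leaves the sum of \<open>e ((1 + t) * x)\<close>
  over nonzero \<open>x\<close>, which is \<open>P - 1\<close> if \<open>t\<close> is -1 modulo
  \<open>P\<close> and -1 otherwise. The contribution of the constant -1 vanishes because the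
  conjugate character is nontrivial.\<close>

lemma gsum_cnj:
  assumes \<chi>: "char \<chi>" and a: "\<not> P dvd a" "\<chi> a \<noteq> 1"
  shows "pcong 0 (gsum \<chi> * gsum (\<lambda>x. gcnj (\<chi> x))) [:\<chi> (-1) * of_int P:]"
proof -
  note cc = char_cnj[OF \<chi>]
  have "pcong 0 (gsum \<chi> * gsum (\<lambda>x. gcnj (\<chi> x)))
      (\<Sum>x\<in>F. \<Sum>y\<in>F. [:\<chi> x * gcnj (\<chi> y):] * e (x + y))"
    unfolding gsum_def sum_product
  proof (intro pcong_sum)
    fix x y
    have "[:\<chi> x:] * e x * ([:gcnj (\<chi> y):] * e y) = [:\<chi> x * gcnj (\<chi> y):] * (e x * e y)"
      by (simp add: mult_smult_left mult_smult_right mult.commute)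
    then show "pcong 0 ([:\<chi> x:] * e x * ([:gcnj (\<chi> y):] * e y)) ([:\<chi> x * gcnj (\<chi> y):] * e (x + y))"
      using pcong_mult_left[OF pcong_e_add] by metis
  qed
  also have "(\<Sum>x\<in>F. \<Sum>y\<in>F. [:\<chi> x * gcnj (\<chi> y):] * e (x + y))
      = (\<Sum>x\<in>F. \<Sum>t\<in>F. [:\<chi> x * gcnj (\<chi> x) * gcnj (\<chi> t):] * e ((1 + t) * x))"
  proof (rule sum.cong[OF refl])
    fix x assume x: "x \<in> F"
    show "(\<Sum>y\<in>F. [:\<chi> x * gcnj (\<chi> y):] * e (x + y)) =
        (\<Sum>t\<in>F. [:\<chi> x * gcnj (\<chi> x) * gcnj (\<chi> t):] * e ((1 + t) * x))"
    proof (cases "P dvd x")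
      case True
      then show ?thesis by (simp add: char_0[OF \<chi>])
    next
      case False
      have "(\<Sum>y\<in>F. [:\<chi> x * gcnj (\<chi> y):] * e (x + y)) =
          (\<Sum>t\<in>F. [:\<chi> x * gcnj (\<chi> (x * t + 0)):] * e (x + (x * t + 0)))"
      proof (rule sum_F_affine[where f = "\<lambda>y. [:\<chi> x * gcnj (\<chi> y):] * e (x + y)", OF False, symmetric])
        fix y y' assume yy: "[y = y'] (mod P)"
        then have "e (x + y) = e (x + y')" by (intro e_cong cong_add cong_refl)
        then show "[:\<chi> x * gcnj (\<chi> y):] * e (x + y) = [:\<chi> x * gcnj (\<chi> y'):] * e (x + y')"
          by (simp only: char_cong[OF \<chi> yy])
      qed
      then show ?thesis by (simp add: char_mult[OF \<chi>] algebra_simps)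
    qed
  qed
  also have "\<dots> = (\<Sum>t\<in>F. [:gcnj (\<chi> t):] * (\<Sum>x\<in>F. [:\<chi> x * gcnj (\<chi> x):] * e ((1 + t) * x)))"
    by (subst sum.swap) (simp add: sum_distrib_left mult.commute)
  also have "pcong 0 \<dots> (\<Sum>t\<in>F. [:gcnj (\<chi> t):] * ((if P dvd 1 + t then [:of_int P:] else 0) - 1))"
  proof (intro pcong_sum pcong_mult_left)
    fix t
    have "(\<Sum>x\<in>F. [:\<chi> x * gcnj (\<chi> x):] * e ((1 + t) * x)) = (\<Sum>x\<in>F - {0}. e ((1 + t) * x))"
    proof (intro sum.mono_neutral_cong_right)
      show "\<forall>i\<in>F - (F - {0}). [:\<chi> i * gcnj (\<chi> i):] * e ((1 + t) * i) = 0"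
        using char_0[OF \<chi>, of 0] by auto
      fix x assume "x \<in> F - {0}"
      then have "\<not> P dvd x" by (auto dest: zdvd_imp_le)
      then show "[:\<chi> x * gcnj (\<chi> x):] * e ((1 + t) * x) = e ((1 + t) * x)" by (simp add: char_unit[OF \<chi>])
    qed auto
    also have "\<dots> = (\<Sum>x\<in>F. e ((1 + t) * x)) + (- 1)"
      using P_gt_2 by (subst sum_diff1) (simp_all add: e_def)
    also have "pcong 0 \<dots> ((if P dvd 1 + t then [:of_int P:] else 0) + (- 1))"
      by (intro pcong_add sum_e pcong_refl)
    finally show "pcong 0 (\<Sum>x\<in>F. [:\<chi> x * gcnj (\<chi> x):] * e ((1 + t) * x))
        ((if P dvd 1 + t then [:of_int P:] else 0) - 1)" by simp
  qed
  also have "(\<Sum>t\<in>F. [:gcnj (\<chi> t):] * ((if P dvd 1 + t then [:of_int P:] else 0) - 1)) =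
      [:gcnj (\<chi> (-1)) * of_int P:]"
  proof -
    have dvd: "P dvd 1 + t \<longleftrightarrow> t = P - 1" if "t \<in> F" for t
    proof
      assume "P dvd 1 + t"
      then have "P \<le> 1 + t" using that by (intro zdvd_imp_le) auto
      then show "t = P - 1" using that by simp
    qed simp
    have "(\<Sum>t\<in>F. [:gcnj (\<chi> t):] * ((if P dvd 1 + t then [:of_int P:] else 0) - 1)) =
       (\<Sum>t\<in>F. (if t = P - 1 then [:gcnj (\<chi> t) * of_int P:] else 0)) - [:\<Sum>t\<in>F. gcnj (\<chi> t):]"
    proof -
      show ?thesis unfolding const_poly_sum sum_subtractf[symmetric]
        by (intro sum.cong refl) (simp add: dvd right_diff_distrib)
    qed
    also have "(\<Sum>t\<in>F. gcnj (\<chi> t)) = 0"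
    proof (rule sum_char[OF cc a(1)])
      show "gcnj (\<chi> a) \<noteq> 1" using a(2) by (metis gcnj_1 gcnj_gcnj)
    qed
    also have "(\<Sum>t\<in>F. (if t = P - 1 then [:gcnj (\<chi> t) * of_int P:] else 0)) = [:gcnj (\<chi> (P - 1)) * of_int P:]"
      using P_gt_2 by simp
    also have "\<chi> (P - 1) = \<chi> (-1)"
    proof -
      have "[P - 1 = -1] (mod P)" by (simp add: cong_iff_dvd_diff)
      then show ?thesis by (rule char_cong[OF \<chi>])
    qed
    finally show ?thesis by simp
  qed
  also have "gcnj (\<chi> (-1)) = \<chi> (-1)"
  proof -
    have "\<chi> (-1) * \<chi> (-1) = 1" using char_mult[OF \<chi>, of "-1" "-1"] char_1[OF \<chi>] by simp
    then have "(\<chi> (-1) - 1) * (\<chi> (-1) + 1) = 0" by (simp add: algebra_simps)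
    then have "\<chi> (-1) = 1 \<or> \<chi> (-1) = - 1" by (auto simp: eq_neg_iff_add_eq_0)
    then show ?thesis by auto
  qed
  finally show ?thesis .
qed

text \<open>Terms are collected by \<open>z = x + y\<close>. For \<open>z\<close> prime to
  \<open>P\<close>, substituting \<open>x = z * u\<close> extracts \<open>\<chi> z ^ 2\<close>; for
  \<open>z = 0\<close> the coefficient is a multiple of the sum of \<open>\<chi> x ^ 2\<close>,
  which vanishes since the square of the character is nontrivial.\<close>

lemma gsum_square:
  assumes \<chi>: "char \<chi>" and a: "\<not> P dvd a" "\<chi> a ^ 2 \<noteq> 1"
  shows "pcong 0 (gsum \<chi> ^ 2) ([:jsum \<chi>:] * gsum (\<lambda>x. \<chi> x ^ 2))"
proof -
  have "pcong 0 (gsum \<chi> ^ 2) (\<Sum>x\<in>F. \<Sum>y\<in>F. [:\<chi> x * \<chi> y:] * e (x + y))"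
    unfolding gsum_def power2_eq_square sum_product
  proof (intro pcong_sum)
    fix x y
    have "[:\<chi> x:] * e x * ([:\<chi> y:] * e y) = [:\<chi> x * \<chi> y:] * (e x * e y)"
      by (simp add: mult_smult_left mult_smult_right mult.commute)
    then show "pcong 0 ([:\<chi> x:] * e x * ([:\<chi> y:] * e y)) ([:\<chi> x * \<chi> y:] * e (x + y))"
      using pcong_mult_left[OF pcong_e_add] by metis
  qed
  also have "(\<Sum>x\<in>F. \<Sum>y\<in>F. [:\<chi> x * \<chi> y:] * e (x + y)) = (\<Sum>x\<in>F. \<Sum>z\<in>F. [:\<chi> x * \<chi> (z - x):] * e z)"
  proof (rule sum.cong[OF refl])
    fix x
    have "(\<Sum>z\<in>F. [:\<chi> x * \<chi> (z - x):] * e z) = (\<Sum>y\<in>F. [:\<chi> x * \<chi> ((1 * y + x) - x):] * e (1 * y + x))"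
    proof (rule sum_F_affine[where f = "\<lambda>z. [:\<chi> x * \<chi> (z - x):] * e z", symmetric])
      show "\<not> P dvd 1" using P(1) by (metis not_prime_unit)
      fix z z' assume zz: "[z = z'] (mod P)"
      have "\<chi> (z - x) = \<chi> (z' - x)" by (intro char_cong[OF \<chi>] cong_diff zz cong_refl)
      then show "[:\<chi> x * \<chi> (z - x):] * e z = [:\<chi> x * \<chi> (z' - x):] * e z'"
        by (simp only: e_cong[OF zz])
    qed
    then show "(\<Sum>y\<in>F. [:\<chi> x * \<chi> y:] * e (x + y)) = (\<Sum>z\<in>F. [:\<chi> x * \<chi> (z - x):] * e z)"
      by (simp add: add.commute)
  qed
  also have "\<dots> = (\<Sum>z\<in>F. [:\<Sum>x\<in>F. \<chi> x * \<chi> (z - x):] * e z)"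
  proof -
    show ?thesis unfolding const_poly_sum sum_distrib_right by (rule sum.swap)
  qed
  also have "\<dots> = [:jsum \<chi>:] * gsum (\<lambda>x. \<chi> x ^ 2)"
    unfolding gsum_def sum_distrib_left
  proof (rule sum.cong[OF refl])
    fix z assume z: "z \<in> F"
    have "(\<Sum>x\<in>F. \<chi> x * \<chi> (z - x)) = jsum \<chi> * \<chi> z ^ 2"
    proof (cases "P dvd z")
      case True
      have "\<chi> (z - x) = \<chi> (-1) * \<chi> x" for x
      proof -
        have "[z - x = (-1) * x] (mod P)" using True by (simp add: cong_iff_dvd_diff)
        then have "\<chi> (z - x) = \<chi> ((-1) * x)" by (rule char_cong[OF \<chi>])
        then show ?thesis by (simp only: char_mult[OF \<chi>])
      qed
      then have "(\<Sum>x\<in>F. \<chi> x * \<chi> (z - x)) = \<chi> (-1) * (\<Sum>x\<in>F. \<chi> x ^ 2)"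
        by (simp add: sum_distrib_left power2_eq_square mult.left_commute)
      also have "(\<Sum>x\<in>F. \<chi> x ^ 2) = 0" by (rule sum_char[OF char_power2[OF \<chi>] a])
      finally show ?thesis using True by (simp add: char_0[OF \<chi>])
    next
      case False
      have "(\<Sum>x\<in>F. \<chi> x * \<chi> (z - x)) = (\<Sum>u\<in>F. \<chi> (z * u + 0) * \<chi> (z - (z * u + 0)))"
      proof (rule sum_F_affine[where f = "\<lambda>x. \<chi> x * \<chi> (z - x)", OF False, symmetric])
        fix x x' assume xx: "[x = x'] (mod P)"
        have "\<chi> (z - x) = \<chi> (z - x')" by (intro char_cong[OF \<chi>] cong_diff xx cong_refl)
        then show "\<chi> x * \<chi> (z - x) = \<chi> x' * \<chi> (z - x')" by (simp only: char_cong[OF \<chi> xx])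
      qed
      also have "\<dots> = (\<Sum>u\<in>F. \<chi> z ^ 2 * (\<chi> u * \<chi> (1 - u)))"
      proof (rule sum.cong[OF refl])
        fix u
        have "z - (z * u + 0) = z * (1 - u)" by (simp add: algebra_simps)
        then show "\<chi> (z * u + 0) * \<chi> (z - (z * u + 0)) = \<chi> z ^ 2 * (\<chi> u * \<chi> (1 - u))"
          by (simp add: char_mult[OF \<chi>] power2_eq_square)
      qed
      finally show ?thesis by (simp add: jsum_def sum_distrib_left[symmetric] mult.commute)
    qed
    then show "[:\<Sum>x\<in>F. \<chi> x * \<chi> (z - x):] * e z = [:jsum \<chi>:] * ([:\<chi> z ^ 2:] * e z)"
      by (simp add: mult.commute)
  qed
  finally show ?thesis .
qed

lemma gsum_frobenius:
  assumes q: "prime q"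
  shows "pcong (of_nat q) (gsum \<chi> ^ q) (\<Sum>x\<in>F. [:\<chi> x ^ q:] * e (int q * x))"
proof -
  have "of_nat q dvd gsum \<chi> ^ q - (\<Sum>x\<in>F. ([:\<chi> x:] * e x) ^ q)"
    unfolding gsum_def by (rule freshman_sum_dvd[OF q])
  then obtain A where "gsum \<chi> ^ q - (\<Sum>x\<in>F. ([:\<chi> x:] * e x) ^ q) = of_nat q * A" ..
  then have "gsum \<chi> ^ q - (\<Sum>x\<in>F. ([:\<chi> x:] * e x) ^ q) = [:of_nat q:] * A + Phi * 0"
    by (simp add: of_nat_poly)
  then have "pcong (of_nat q) (gsum \<chi> ^ q) (\<Sum>x\<in>F. ([:\<chi> x:] * e x) ^ q)" unfolding pcong_def by blast
  also have "pcong (of_nat q) \<dots> (\<Sum>x\<in>F. [:\<chi> x ^ q:] * e (int q * x))"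
  proof (rule pcong_sum)
    fix x
    have "([:\<chi> x:] * e x) ^ q = [:\<chi> x ^ q:] * e x ^ q"
      by (simp add: smult_power)
    then show "pcong (of_nat q) (([:\<chi> x:] * e x) ^ q) ([:\<chi> x ^ q:] * e (int q * x))"
      using pcong_mult_left[OF pcong_e_power] by metis
  qed
  finally show ?thesis .
qed

end

section \<open>The supplementary laws of quartic reciprocity\<close>

lemma gi_power_nat_cong:
  assumes "[a = b] (mod 4)" "0 \<le> a" "0 \<le> b" shows "gi ^ nat a = gi ^ nat b"
proof -
  have "[int (nat a) = int (nat b)] (mod int 4)" using assms by simp
  then show ?thesis unfolding gi_power_eq_iff by (simp only: cong_int_iff)
qed

lemma gi_power_mult_gcnj: "gi ^ k * gcnj (gi ^ k) = 1"
  by (simp flip: power_mult_distrib)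

lemma gi_power_fourth: "(gi ^ k) ^ 4 = 1"
  by (metis gi_power4 mult.commute power_mult power_one)

lemma of_nat_dvd_cancel:
  assumes "(of_nat q :: gint) dvd x * of_int n" "coprime (int q) n" shows "of_nat q dvd x"
proof -
  have "of_int (int q) dvd x * of_int n" using assms(1) by simp
  then have "of_int (int q) dvd x"
    using assms(2) unfolding of_int_dvd_gint_iff by (simp add: coprime_dvd_mult_left_iff)
  then show ?thesis by simp
qed

lemma of_nat_dvd_unit_diff:
  assumes "(of_nat q :: gint) dvd gi ^ j - gi ^ k" "q > 2" shows "[int j = int k] (mod 4)"
proof -
  have m: "gi ^ m \<in> {1, gi, -1, -gi}" for m
    using gint_unit_cases[OF gi_power_unit[of m]] by blast
  have "Nm (gi ^ j - gi ^ k) \<le> 4"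
    using m[of j] m[of k] by (elim insertE emptyE) (simp_all add: Nm_def)
  moreover have "int q ^ 2 dvd Nm (gi ^ j - gi ^ k)" using Nm_dvd[OF assms(1)] by (simp add: Nm_def)
  moreover have "int q ^ 2 > 4" using assms(2) power_strict_mono[of 2 "int q" 2] by simp
  ultimately have "Nm (gi ^ j - gi ^ k) = 0"
    using zdvd_imp_le[of "int q ^ 2" "Nm (gi ^ j - gi ^ k)"] Nm_nonneg[of "gi ^ j - gi ^ k"] by linarith
  then have "[j = k] (mod 4)" using gi_power_eq_iff[of j k] by simp
  then show ?thesis by (metis cong_int_iff of_nat_numeral)
qed

section \<open>Primes of prime norm and the symbols of rational integers\<close>

locale gprime_split = gprime_odd +
  assumes split: "prime (Nm p)"
begin

sublocale cyclotomic "Nm p"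
  using split gint_prime_Nm_mod4(1)[OF prime odd] by unfold_locales presburger+

lemma Nm_mod4: "Nm p mod 4 = 1"
  using gint_prime_Nm_mod4(1)[OF prime odd] .

lemma dvd_of_int_iff: "p dvd of_int n \<longleftrightarrow> Nm p dvd n"
proof
  assume "p dvd of_int n"
  from Nm_dvd[OF this] show "Nm p dvd n" using split by (simp add: prime_dvd_power_iff)
next
  assume "Nm p dvd n"
  then obtain m where "n = Nm p * m" ..
  then have "of_int n = p * (gcnj p * of_int m)" by (simp add: mult_gcnj flip: mult.assoc)
  then show "p dvd of_int n" by simp
qed

text \<open>The quartic residue character of \<open>p\<close> on the prime field; rational integers
  represent all residues because the norm is prime.\<close>

definition chi :: "int \<Rightarrow> gint" where
  "chi x = (if Nm p dvd x then 0 else gi ^ nat (qlog p (of_int x)))"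

lemma qlog_nonneg: "qlog p x \<ge> 0"
  by (simp add: qlog_def)

lemma char_chi: "char chi"
  unfolding char_def
proof (intro conjI allI impI)
  fix x y
  show "chi (x * y) = chi x * chi y"
  proof (cases "Nm p dvd x \<or> Nm p dvd y")
    case True
    then show ?thesis by (auto simp: chi_def)
  next
    case False
    then have "gi ^ nat (qlog p (of_int x * of_int y)) = gi ^ nat (qlog p (of_int x) + qlog p (of_int y))"
      by (intro gi_power_nat_cong qlog_mult) (simp_all add: dvd_of_int_iff qlog_nonneg)
    then show ?thesis using False split
      by (simp add: chi_def prime_dvd_mult_iff nat_add_distrib qlog_nonneg power_add)
  qed
  assume xy: "[x = y] (mod Nm p)"
  then have dvd: "Nm p dvd x \<longleftrightarrow> Nm p dvd y" by (rule cong_dvd_iff)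
  show "chi x = chi y"
  proof (cases "Nm p dvd x")
    case False
    have "p dvd of_int x - of_int y"
      using xy dvd_of_int_iff[of "x - y"] by (simp add: cong_iff_dvd_diff)
    then have "gi ^ nat (qlog p (of_int x)) = gi ^ nat (qlog p (of_int y))"
      using False by (intro gi_power_nat_cong qlog_cong) (simp_all add: dvd_of_int_iff qlog_nonneg)
    then show ?thesis using False dvd by (simp add: chi_def)
  qed (use dvd in \<open>simp add: chi_def\<close>)
next
  fix x assume "\<not> Nm p dvd x"
  then show "chi x * gcnj (chi x) = 1" unfolding chi_def by (simp add: gi_power_mult_gcnj del: gcnj_power)
qed (simp add: chi_def)

lemma chi_residue: "p dvd chi x - of_int x ^ qexp p"
proof (cases "Nm p dvd x")
  case True
  then have "p dvd of_int x" by (simp add: dvd_of_int_iff)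
  then have "p dvd of_int x ^ qexp p" using qexp(2)[OF prime odd] by (meson dvd_power dvd_trans)
  then show ?thesis using True by (simp add: chi_def)
next
  case False
  then obtain k where "qlog p (of_int x) = int k" "p dvd of_int x ^ qexp p - gi ^ k"
    using qlog_spec[of "of_int x"] by (auto simp: dvd_of_int_iff)
  then show ?thesis using False by (simp add: chi_def dvd_diff_commute)
qed

lemma generator:
  obtains a :: int where "\<not> Nm p dvd a" "odd (qlog p (of_int a))"
    "\<And>j. Nm p dvd a ^ j - 1 \<longleftrightarrow> 4 * qexp p dvd j"
proof -
  obtain g where g: "\<And>x. \<not> p dvd x \<Longrightarrow> \<exists>k. p dvd x - g ^ k"
    "\<And>k. p dvd g ^ k - 1 \<longleftrightarrow> nat (Nm p - 1) dvd k"
    using gint_residue_generator[OF prime odd] by blast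
  obtain a where a: "p dvd g - of_int a" using gint_split_residue[OF prime split] .
  have pw: "Nm p dvd a ^ j - 1 \<longleftrightarrow> 4 * qexp p dvd j" for j
  proof -
    have "Nm p dvd a ^ j - 1 \<longleftrightarrow> p dvd of_int a ^ j - 1" using dvd_of_int_iff[of "a ^ j - 1"] by simp
    also have "\<dots> \<longleftrightarrow> p dvd g ^ j - 1"
    proof -
      have "p dvd g ^ j - of_int a ^ j" using a by (rule dvd_power_diff)
      then show ?thesis by (metis dvd_add diff_add_cancel add_diff_eq dvd_diff_commute)
    qed
    finally show ?thesis unfolding g(2) qexp(1)[OF prime odd] .
  qed
  have q0: "qexp p > 0" using qexp(2)[OF prime odd] .
  have na: "\<not> Nm p dvd a"
  proof
    assume "Nm p dvd a"
    then have "Nm p dvd a ^ (4 * qexp p)" using q0 by (meson dvd_power dvd_trans mult_pos_pos zero_less_numeral)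
    moreover have "Nm p dvd a ^ (4 * qexp p) - 1" unfolding pw by simp
    ultimately have "Nm p dvd 1" by (metis dvd_diff diff_diff_eq2 add_diff_cancel_left' add.commute)
    then show False using split by (metis not_prime_unit)
  qed
  have "odd (qlog p (of_int a))"
  proof
    assume "even (qlog p (of_int a))"
    then obtain y where y: "p dvd y ^ 2 - of_int a" using square_iff[of "of_int a"] na by (auto simp: dvd_of_int_iff)
    have "\<not> p dvd y ^ 2"
    proof
      assume "p dvd y ^ 2"
      from dvd_diff[OF this y] have "p dvd of_int a" by simp
      then show False using na by (simp add: dvd_of_int_iff)
    qed
    then have "\<not> p dvd y" by (auto simp: power2_eq_square)
    from gint_fermat[OF prime odd this] have "p dvd (y ^ 2) ^ (2 * qexp p) - 1"
      by (simp flip: power_mult)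
    moreover have "p dvd (y ^ 2) ^ (2 * qexp p) - of_int a ^ (2 * qexp p)" using y by (rule dvd_power_diff)
    ultimately have "p dvd ((y ^ 2) ^ (2 * qexp p) - 1) - ((y ^ 2) ^ (2 * qexp p) - of_int a ^ (2 * qexp p))"
      by (rule dvd_diff)
    then have "p dvd of_int (a ^ (2 * qexp p) - 1)" by simp
    then have "4 * qexp p dvd 2 * qexp p" unfolding dvd_of_int_iff pw .
    then show False using q0 by (auto dest: dvd_imp_le)
  qed
  then show thesis using that na pw by blast
qed

text \<open>The identities for Gauss sums require both \<open>chi\<close> and its square to be
  nontrivial. A primitive root is not a square, so its symbol has odd exponent.\<close>

lemma chi_square_nontrivial: obtains a where "\<not> Nm p dvd a" "chi a ^ 2 \<noteq> 1" "chi a \<noteq> 1"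
proof -
  obtain a where a: "\<not> Nm p dvd a" "odd (qlog p (of_int a))" using generator by blast
  have "chi a ^ 2 = gi ^ (nat (qlog p (of_int a)) * 2)" using a by (simp add: chi_def power_mult)
  moreover have "gi ^ (nat (qlog p (of_int a)) * 2) \<noteq> gi ^ 0"
  proof
    assume "gi ^ (nat (qlog p (of_int a)) * 2) = gi ^ 0"
    then have "4 dvd nat (qlog p (of_int a)) * 2"
      unfolding gi_power_eq_iff by (simp add: unique_euclidean_semiring_class.cong_def mod_eq_0_iff_dvd)
    then have "even (nat (qlog p (of_int a)))" by (auto elim!: dvdE)
    then show False using a(2) qlog_nonneg[of "of_int a"] by (simp add: even_nat_iff)
  qed
  ultimately have a2: "chi a ^ 2 \<noteq> 1" by simp
  then have "chi a \<noteq> 1" by auto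
  with a(1) a2 show thesis by (rule that)
qed

text \<open>Replacing \<open>x\<close> by \<open>a * x\<close> for a primitive root \<open>a\<close>
  multiplies the sum by \<open>a ^ j\<close>, which is not 1 modulo the norm.\<close>

lemma power_sum_dvd:
  assumes "0 < j" "j < 4 * qexp p" shows "Nm p dvd (\<Sum>x\<in>F. x ^ j)"
proof -
  obtain a where a: "\<not> Nm p dvd a" "\<And>j. Nm p dvd a ^ j - 1 \<longleftrightarrow> 4 * qexp p dvd j" using generator by blast
  define S where "S = (\<Sum>x\<in>F. x ^ j)"
  have "S = (\<Sum>x\<in>F. ((a * x + 0) mod Nm p) ^ j)"
    unfolding S_def by (rule sum.reindex_bij_betw[OF bij_betw_F[OF a(1)], symmetric])
  moreover have "[(\<Sum>x\<in>F. ((a * x + 0) mod Nm p) ^ j) = (\<Sum>x\<in>F. (a * x) ^ j)] (mod Nm p)"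
    by (intro cong_sum cong_pow) simp
  moreover have "(\<Sum>x\<in>F. (a * x) ^ j) = a ^ j * S" by (simp add: S_def power_mult_distrib sum_distrib_left)
  ultimately have "[S = a ^ j * S] (mod Nm p)" by simp
  then have "Nm p dvd (a ^ j - 1) * S" by (simp add: cong_iff_dvd_diff algebra_simps dvd_diff_commute)
  moreover have "\<not> Nm p dvd a ^ j - 1" unfolding a(2) using assms by (auto dest: dvd_imp_le)
  ultimately show ?thesis using split by (simp add: prime_dvd_mult_iff S_def)
qed

text \<open>Modulo \<open>p\<close> the character is \<open>x ^ h\<close> with
  \<open>h = qexp p\<close>, so the Jacobi sum becomes the sum of
  \<open>x ^ h * (1 - x) ^ h\<close>. Its monomials have exponents from \<open>h\<close> to
  \<open>2 * h\<close>, strictly between 0 and \<open>4 * h\<close>, where power sums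
  vanish.\<close>

lemma dvd_jsum: "p dvd jsum chi"
proof -
  define h where "h = qexp p"
  have h: "h > 0" using qexp(2)[OF prime odd] by (simp add: h_def)
  have "(\<Sum>x\<in>F. x ^ h * (1 - x) ^ h) = (\<Sum>x\<in>F. \<Sum>k\<le>h. (int (h choose k) * (-1) ^ k) * x ^ (h + k))"
  proof (rule sum.cong[OF refl])
    fix x :: int
    have "(1 - x) ^ h = (- x + 1) ^ h" by simp
    also have "\<dots> = (\<Sum>k\<le>h. int (h choose k) * (- x) ^ k * 1 ^ (h - k))" by (rule binomial_ring)
    finally show "x ^ h * (1 - x) ^ h = (\<Sum>k\<le>h. (int (h choose k) * (-1) ^ k) * x ^ (h + k))"
      by (simp add: sum_distrib_left power_add power_minus[of x] algebra_simps)
  qed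
  also have "\<dots> = (\<Sum>k\<le>h. (int (h choose k) * (-1) ^ k) * (\<Sum>x\<in>F. x ^ (h + k)))"
    by (subst sum.swap) (simp add: sum_distrib_left)
  also have "Nm p dvd \<dots>" using h by (intro dvd_sum dvd_mult power_sum_dvd) (auto simp: h_def)
  finally have "p dvd of_int (\<Sum>x\<in>F. x ^ h * (1 - x) ^ h)" unfolding dvd_of_int_iff .
  then have 1: "p dvd (\<Sum>x\<in>F. of_int x ^ h * of_int (1 - x) ^ h)" by simp
  have "p dvd (\<Sum>x\<in>F. chi x * chi (1 - x) - of_int x ^ h * of_int (1 - x) ^ h)"
  proof (rule dvd_sum)
    fix x
    have "chi x * chi (1 - x) - of_int x ^ h * of_int (1 - x) ^ h =
      chi x * (chi (1 - x) - of_int (1 - x) ^ h) + (chi x - of_int x ^ h) * of_int (1 - x) ^ h"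
      by (simp add: algebra_simps)
    then show "p dvd chi x * chi (1 - x) - of_int x ^ h * of_int (1 - x) ^ h"
      using chi_residue by (simp add: h_def del: of_int_diff)
  qed
  from dvd_add[OF this 1] show ?thesis by (simp add: jsum_def sum_subtractf)
qed

text \<open>The terms at \<open>x\<close> and \<open>1 - x\<close> agree, so they cancel modulo 2
  except at the fixed point \<open>c\<close>, which is 1/2 modulo the norm. There the term is the
  square of a power of \<open>gi\<close>, hence 1 or -1; the terms at 0 and 1 vanish.\<close>

lemma jsum_mod_2: "2 dvd jsum chi - 1"
proof -
  define c where "c = (Nm p + 1) div 2"
  have c: "2 * c = Nm p + 1" using Nm_mod4 unfolding c_def by presburger
  have c1: "2 < c" using c gint_prime_Nm_mod4(2)[OF prime odd] by linarith
  define f where "f x = chi x * chi (1 - x)" for x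
  note cong = char_cong[OF char_chi]
  have refl: "f (Nm p + 1 - x) = f x" for x
  proof -
    have "chi (Nm p + 1 - x) = chi (1 - x)" "chi (1 - (Nm p + 1 - x)) = chi x"
      by (intro cong, simp add: cong_iff_dvd_diff)+
    then show ?thesis by (simp add: f_def)
  qed
  have "{0..<N} = {0, 1} \<union> ({2..<c} \<union> ({c} \<union> {c+1..<N}))" if "2 * c = N + 1" "2 < c" for N c :: int
    using that by auto
  from this[OF c c1] have "F = {0, 1} \<union> ({2..<c} \<union> ({c} \<union> {c+1..<Nm p}))" .
  then have "jsum chi = (\<Sum>x\<in>{0, 1} \<union> ({2..<c} \<union> ({c} \<union> {c+1..<Nm p})). f x)" by (simp add: jsum_def f_def)
  also have "\<dots> = (\<Sum>x\<in>{0, 1}. f x) + ((\<Sum>x\<in>{2..<c}. f x) + ((\<Sum>x\<in>{c}. f x) + (\<Sum>x\<in>{c+1..<Nm p}. f x)))"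
    using c1 by (subst sum.union_disjoint, simp, simp, force)+ simp
  also have "(\<Sum>x\<in>{c+1..<Nm p}. f x) = (\<Sum>x\<in>{2..<c}. f x)"
    by (rule sum.reindex_bij_witness[of _ "\<lambda>x. Nm p + 1 - x" "\<lambda>x. Nm p + 1 - x"]) (use c in \<open>auto simp: refl\<close>)
  also have "(\<Sum>x\<in>{0, 1}. f x) = 0" by (simp add: f_def chi_def)
  finally have J: "jsum chi = 2 * (\<Sum>x\<in>{2..<c}. f x) + f c" by simp
  have "chi (1 - c) = chi c"
  proof (rule cong)
    have "1 - c - c = - Nm p" using c by simp
    then show "[1 - c = c] (mod Nm p)" by (simp add: cong_iff_dvd_diff)
  qed
  moreover have "\<not> Nm p dvd c" using c1 c by (auto dest: zdvd_imp_le)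
  ultimately obtain k where k: "f c = (gi ^ k) ^ 2" by (auto simp: f_def chi_def power2_eq_square)
  have "((gi ^ k) ^ 2 - 1) * ((gi ^ k) ^ 2 + 1) = (gi ^ k) ^ 4 - 1"
    by (simp add: algebra_simps numeral_eq_Suc)
  then have "(gi ^ k) ^ 2 = 1 \<or> (gi ^ k) ^ 2 = - 1"
    unfolding gi_power_fourth by (auto simp: eq_neg_iff_add_eq_0)
  then have "2 dvd f c - 1" unfolding k by auto
  then have "2 dvd 2 * (\<Sum>x\<in>{2..<c}. f x) + (f c - 1)" by simp
  then show ?thesis unfolding J by (simp add: algebra_simps)
qed

lemma jsum_cnj: "jsum (\<lambda>x. gcnj (chi x)) = gcnj (jsum chi)"
  by (simp add: jsum_def gcnj_sum)

text \<open>The square of \<open>chi\<close> is real and takes the value 1 at -1, so the product of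
  its Gauss sum with the conjugate sum is already a square.\<close>

lemma gsum_quadratic: "pcong 0 (gsum (\<lambda>x. chi x ^ 2) ^ 2) [:of_int (Nm p):]"
proof -
  obtain a where a: "\<not> Nm p dvd a" "chi a ^ 2 \<noteq> 1" using chi_square_nontrivial by blast
  have real: "gcnj (chi x ^ 2) = chi x ^ 2" for x
  proof (cases "Nm p dvd x")
    case False
    then obtain k where k: "chi x = gi ^ k" by (auto simp: chi_def)
    have "((gi ^ k) ^ 2 - 1) * ((gi ^ k) ^ 2 + 1) = (gi ^ k) ^ 4 - 1"
      by (simp add: algebra_simps numeral_eq_Suc)
    then have "(gi ^ k) ^ 2 = 1 \<or> (gi ^ k) ^ 2 = - 1"
      unfolding gi_power_fourth by (auto simp: eq_neg_iff_add_eq_0)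
    then show ?thesis unfolding k by (metis gcnj_1 gcnj_minus)
  qed (simp add: chi_def)
  have "chi (-1) ^ 2 = chi ((-1) * (-1))" by (simp only: char_mult[OF char_chi] power2_eq_square)
  then have "chi (-1) ^ 2 = 1" using char_1[OF char_chi] by simp
  then show ?thesis
    using gsum_cnj[OF char_power2[OF char_chi] a] unfolding real by (simp add: power2_eq_square)
qed

text \<open>\<open>(G * Gc) ^ 2\<close> is computed twice: as the square of \<open>Nm p\<close>, and
  from the squares of the two factors as \<open>J * gcnj J\<close> times the square
  \<open>Nm p\<close> of the quadratic Gauss sum. One factor \<open>Nm p\<close> is then
  cancelled.\<close>

lemma jsum_norm: "jsum chi * gcnj (jsum chi) = of_int (Nm p)"
proof -
  obtain a where a: "\<not> Nm p dvd a" "chi a ^ 2 \<noteq> 1" "chi a \<noteq> 1" using chi_square_nontrivial .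
  define G Gc R J where "G = gsum chi" and "Gc = gsum (\<lambda>x. gcnj (chi x))"
    and "R = gsum (\<lambda>x. chi x ^ 2)" and "J = jsum chi"
  have gcc: "gcnj (chi x) ^ 2 = chi x ^ 2" for x
  proof (cases "Nm p dvd x")
    case False
    then obtain k where k: "chi x = gi ^ k" by (auto simp: chi_def)
    have "(- gi) ^ 2 = (gi ^ 2 :: gint)" by simp
    then show ?thesis unfolding k by (simp flip: power_mult)
  qed (simp add: chi_def)
  have a': "gcnj (chi a) ^ 2 \<noteq> 1" using a(2) by (simp add: gcc)
  have 1: "pcong 0 (G ^ 2) ([:J:] * R)" unfolding G_def J_def R_def by (rule gsum_square[OF char_chi a(1,2)])
  have 2: "pcong 0 (Gc ^ 2) ([:gcnj J:] * R)"
    using gsum_square[OF char_cnj[OF char_chi] a(1) a'] unfolding Gc_def J_def R_def gcc jsum_cnj .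
  have "pcong 0 (G ^ 2 * Gc ^ 2) ([:J:] * R * ([:gcnj J:] * R))" using 1 2 by (rule pcong_mult)
  also have "[:J:] * R * ([:gcnj J:] * R) = [:J * gcnj J:] * R ^ 2"
    by (simp add: power2_eq_square mult_smult_left mult_smult_right mult.commute)
  also have "pcong 0 ([:J * gcnj J:] * R ^ 2) ([:J * gcnj J:] * [:of_int (Nm p):])"
    unfolding R_def by (intro pcong_mult_left gsum_quadratic)
  finally have L: "pcong 0 (G ^ 2 * Gc ^ 2) [:J * gcnj J * of_int (Nm p):]" by (simp add: mult.commute)
  have "chi (-1) ^ 2 = chi ((-1) * (-1))" by (simp only: char_mult[OF char_chi] power2_eq_square)
  then have m1: "chi (-1) ^ 2 = 1" using char_1[OF char_chi] by simp
  have "pcong 0 ((G * Gc) ^ 2) ([:chi (-1) * of_int (Nm p):] ^ 2)"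
    unfolding G_def Gc_def by (intro pcong_power gsum_cnj[OF char_chi a(1,3)])
  also have "[:chi (-1) * of_int (Nm p):] ^ 2 = [:of_int (Nm p) * of_int (Nm p):]"
    using m1 by (simp add: poly_const_pow power_mult_distrib) (simp add: power2_eq_square)
  finally have "pcong 0 (G ^ 2 * Gc ^ 2) [:of_int (Nm p) * of_int (Nm p):]" by (simp add: power_mult_distrib)
  from pcong_const_imp_dvd[OF pcong_trans[OF pcong_sym[OF L] this]]
  have "J * gcnj J * of_int (Nm p) = of_int (Nm p) * of_int (Nm p)" by simp
  moreover have "of_int (Nm p) \<noteq> (0 :: gint)" using p_nz by (metis Nm_eq_0_iff gRe_of_int gRe_simps(1))
  ultimately show ?thesis unfolding J_def by simp
qed

text \<open>Both \<open>p\<close> and the Jacobi sum are \<open>1\<close> modulo \<open>2\<close>, and they agree up to a unit.\<close>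

lemma jsum_square: assumes "primary p" shows "jsum chi ^ 2 = p ^ 2"
proof -
  obtain s where s: "jsum chi = p * s" using dvd_jsum ..
  have "Nm (jsum chi) = Nm p"
    using jsum_norm unfolding mult_gcnj by (metis gRe_of_int)
  then have "Nm s = 1" using p_nz by (simp add: s Nm_mult)
  then have "s dvd 1" by (simp add: gint_unit_iff_Nm)
  then have su: "s = 1 \<or> s = -1 \<or> s = gi \<or> s = - gi" by (rule gint_unit_cases)
  have p2: "2 dvd p - 1"
  proof -
    have "even (gIm p)" "(gRe p + gIm p) mod 4 = 1" using assms by (auto simp: primary_iff)
    then have "even (gRe p - 1)" "even (gIm p)" by presburger+
    then show ?thesis using of_int_dvd_gint_iff[of 2 "p - 1"] by simp
  qed
  have eq: "s - 1 = (jsum chi - 1) - (p - 1) * s" by (simp add: s algebra_simps)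
  have "2 dvd s - 1" unfolding eq by (rule dvd_diff[OF jsum_mod_2 dvd_mult2[OF p2]])
  then have "s = 1 \<or> s = -1" using su of_int_dvd_gint_iff[of 2 "s - 1"] by auto
  then show ?thesis unfolding s by auto
qed

lemma gsum_fourth: assumes "primary p" shows "pcong 0 (gsum chi ^ 4) [:p ^ 2 * of_int (Nm p):]"
proof -
  obtain a where a: "\<not> Nm p dvd a" "chi a ^ 2 \<noteq> 1" using chi_square_nontrivial by blast
  have "pcong 0 ((gsum chi ^ 2) ^ 2) (([:jsum chi:] * gsum (\<lambda>x. chi x ^ 2)) ^ 2)"
    by (intro pcong_power gsum_square[OF char_chi a])
  also have "([:jsum chi:] * gsum (\<lambda>x. chi x ^ 2)) ^ 2 = [:jsum chi ^ 2:] * gsum (\<lambda>x. chi x ^ 2) ^ 2"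
    by (simp add: smult_power)
  also have "pcong 0 \<dots> ([:jsum chi ^ 2:] * [:of_int (Nm p):])"
    by (intro pcong_mult_left gsum_quadratic)
  finally show ?thesis by (simp add: jsum_square[OF assms] mult.commute flip: power_mult)
qed

text \<open>The fourth power of the Gauss sum is \<open>p ^ 3 * gcnj p\<close>, which by assumption
  is \<open>gi ^ j * p ^ 4\<close> modulo \<open>q\<close>. The \<open>q\<close>-th power is
  computed in two ways: through the character it brings in the symbol of \<open>q\<close>, through
  the fourth power it gives a power of \<open>gi\<close> times a power of \<open>p\<close>, which
  Frobenius on Z[i] evaluates. The sign of \<open>r\<close> makes it 1 modulo 4.\<close>

lemma reciprocity_prime:
  assumes prim: "primary p" and q: "prime q" "odd q" "\<not> Nm p dvd int q"
    and u: "of_nat q dvd gcnj p - gi ^ j * p"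
  defines "r \<equiv> (if q mod 4 = 1 then int q else - int q)"
  shows "[qlog p (of_int r) = - int j * ((r - 1) div 4)] (mod 4)"
proof -
  obtain a where a: "\<not> Nm p dvd a" "chi a ^ 2 \<noteq> 1" "chi a \<noteq> 1" using chi_square_nontrivial .
  have q2: "q > 2" using q(1,2) prime_ge_2_nat[of q] by (cases "q = 2") auto
  have cop: "coprime (int q) (Nm p)" using split q(3) by (metis coprime_commute prime_imp_coprime)
  define G Gc c where "G = gsum chi" and "Gc = gsum (\<lambda>x. gcnj (chi x))" and "c = p ^ 2 * of_int (Nm p)"
  have GGc: "pcong (of_nat q) (G * Gc) [:chi (-1) * of_int (Nm p):]"
    unfolding G_def Gc_def by (rule pcong_0_imp[OF gsum_cnj[OF char_chi a(1,3)]])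
  have G4: "pcong (of_nat q) (G ^ 4) [:c:]"
    unfolding G_def c_def by (rule pcong_0_imp[OF gsum_fourth[OF prim]])
  have Gq: "pcong (of_nat q) (G ^ q) (\<Sum>x\<in>F. [:chi x ^ q:] * e (int q * x))"
    unfolding G_def by (rule gsum_frobenius[OF q(1)])
  have chi4: "chi x ^ (4 * n + 1) = chi x" for x n
  proof (cases "Nm p dvd x")
    case False
    then obtain k where k: "chi x = gi ^ k" by (auto simp: chi_def)
    have "(gi ^ k) ^ (4 * n + 1) = ((gi ^ k) ^ 4) ^ n * gi ^ k" by (simp only: power_add power_mult power_one_right)
    then show ?thesis unfolding k gi_power_fourth by simp
  qed (simp add: chi_def)
  have chi3: "chi x ^ 3 = gcnj (chi x)" for x
  proof (cases "Nm p dvd x")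
    case False
    then obtain k where k: "chi x = gi ^ k" by (auto simp: chi_def)
    have "chi x ^ 3 = chi x ^ 3 * (chi x * gcnj (chi x))" unfolding k gi_power_mult_gcnj by simp
    also have "\<dots> = chi x ^ 4 * gcnj (chi x)" by (simp add: numeral_eq_Suc)
    finally show ?thesis unfolding k gi_power_fourth by simp
  qed (simp add: chi_def)
  have c_cong: "of_nat q dvd c - gi ^ j * p ^ 4"
  proof -
    have "c - gi ^ j * p ^ 4 = p ^ 3 * (gcnj p - gi ^ j * p)"
      by (simp add: c_def mult_gcnj[symmetric] numeral_eq_Suc algebra_simps)
    then show ?thesis using u by simp
  qed
  have c_pow: "of_nat q dvd c ^ n - gi ^ (j * n) * p ^ (4 * n)" for n
    using dvd_power_diff[OF c_cong, of n] by (simp add: power_mult_distrib flip: power_mult)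
  have nz: "chi n = gi ^ nat (qlog p (of_int n))" if "\<not> Nm p dvd n" for n using that by (simp add: chi_def)
  define s where "s = q div 4"
  have "q mod 4 = 1 \<or> q mod 4 = 3" using q(2) by presburger
  then show ?thesis
  proof
    assume q4: "q mod 4 = 1"
    then have qs: "q = 4 * s + 1" using mult_div_mod_eq[of 4 q] by (simp add: s_def)
    have r: "r = int q" using q4 by (simp add: r_def)
    have "pcong (of_nat q) (G ^ q) ([:gcnj (chi (int q)):] * G)"
      using Gq gsum_scale[OF char_chi q(3)] unfolding G_def[symmetric] qs chi4 by simp
    \<comment> \<open>Multiplication by \<open>Gc\<close> turns both evaluations into constants,
      which can be compared in Z[i].\<close>
    from pcong_mult[OF this pcong_refl[of _ Gc]]
    have "pcong (of_nat q) (G ^ q * Gc) ([:gcnj (chi (int q)):] * (G * Gc))" by (simp add: mult.assoc)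
    also have "pcong (of_nat q) \<dots> ([:gcnj (chi (int q)):] * [:chi (-1) * of_int (Nm p):])"
      by (intro pcong_mult_left GGc)
    finally have L: "pcong (of_nat q) (G ^ q * Gc) [:gcnj (chi (int q)) * chi (-1) * of_int (Nm p):]"
      by (simp add: ac_simps)
    have "G ^ q * Gc = (G ^ 4) ^ s * (G * Gc)" by (simp add: qs power_add power_mult)
    also have "pcong (of_nat q) \<dots> ([:c:] ^ s * [:chi (-1) * of_int (Nm p):])"
      by (intro pcong_mult pcong_power G4 GGc)
    also have "[:c:] ^ s * [:chi (-1) * of_int (Nm p):] = [:c ^ s * chi (-1) * of_int (Nm p):]"
      by (simp add: poly_const_pow mult.assoc)
    finally have "of_nat q dvd c ^ s * chi (-1) * of_int (Nm p) - gcnj (chi (int q)) * chi (-1) * of_int (Nm p)"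
      using pcong_const_imp_dvd pcong_trans pcong_sym L by blast
    then have "of_nat q dvd (c ^ s * chi (-1) - gcnj (chi (int q)) * chi (-1)) * of_int (Nm p)"
      by (simp add: algebra_simps)
    from of_nat_dvd_cancel[OF this cop] have "of_nat q dvd (c ^ s - gcnj (chi (int q))) * chi (-1)"
      by (simp add: algebra_simps)
    then have "of_nat q dvd (c ^ s - gcnj (chi (int q))) * chi (-1) * gcnj (chi (-1))" by simp
    moreover have "chi (-1) * gcnj (chi (-1)) = 1"
      using split by (intro char_unit[OF char_chi]) (metis dvd_minus_iff not_prime_unit)
    ultimately have 1: "of_nat q dvd c ^ s - gcnj (chi (int q))" by (simp add: mult.assoc)
    \<comment> \<open>To cancel \<open>p\<close> modulo \<open>q\<close>, multiply by the conjugate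
      and cancel the norm, which is prime to \<open>q\<close>.\<close>
    have "of_nat q dvd p ^ q - p" using gint_frobenius[OF q(1,2), of p] q4 by simp
    then have "of_nat q dvd gcnj p * (p ^ q - p)" by simp
    also have "gcnj p * (p ^ q - p) = (p ^ (4 * s) - 1) * of_int (Nm p)"
      by (simp add: qs mult_gcnj[symmetric] algebra_simps)
    finally have "of_nat q dvd p ^ (4 * s) - 1" using of_nat_dvd_cancel cop by blast
    then have "of_nat q dvd gi ^ (j * s) * (p ^ (4 * s) - 1)" by simp
    from dvd_add[OF c_pow[of s] this] have "of_nat q dvd c ^ s - gi ^ (j * s)" by (simp add: algebra_simps)
    from dvd_diff[OF 1 this] have 2: "of_nat q dvd gi ^ (j * s) - gcnj (chi (int q))" by simp
    define k where "k = nat (qlog p (of_int (int q)))"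
    have k: "chi (int q) = gi ^ k" using nz[OF q(3)] by (simp add: k_def)
    have "of_nat q dvd (gi ^ (j * s) - gcnj (chi (int q))) * chi (int q)" using 2 by simp
    also have "(gi ^ (j * s) - gcnj (chi (int q))) * chi (int q) = gi ^ (j * s + k) - gi ^ 0"
      unfolding k left_diff_distrib mult.commute[of "gcnj (gi ^ k)"] gi_power_mult_gcnj power_add power_0 ..
    finally have "[int (j * s + k) = int 0] (mod 4)" using q2 by (rule of_nat_dvd_unit_diff)
    then have "[int k = - (int j * int s)] (mod 4)"
      by (simp add: cong_iff_dvd_diff algebra_simps)
    moreover have "int k = qlog p (of_int r)" using qlog_nonneg by (simp add: k_def r)
    moreover have "(r - 1) div 4 = int s" by (simp add: r qs)
    ultimately show ?thesis by simp
  next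
    assume q4: "q mod 4 = 3"
    then have qs: "q = 4 * s + 3" using mult_div_mod_eq[of 4 q] by (simp add: s_def)
    have r: "r = - int q" using q4 by (simp add: r_def)
    have chiq: "chi x ^ q = gcnj (chi x)" for x
    proof -
      have "q = 4 * s + 1 + 2" by (simp add: qs)
      then have "chi x ^ q = chi x ^ (4 * s + 1) * chi x ^ 2" by (simp only: power_add)
      also have "\<dots> = chi x ^ 3" unfolding chi4 by (simp add: numeral_eq_Suc)
      finally show ?thesis by (simp add: chi3)
    qed
    have "(\<Sum>x\<in>F. [:chi x ^ q:] * e (int q * x)) = [:chi (int q):] * Gc"
      using gsum_scale[OF char_cnj[OF char_chi] q(3)] by (simp add: chiq Gc_def)
    with Gq have "pcong (of_nat q) (G ^ q) ([:chi (int q):] * Gc)" by simp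
    \<comment> \<open>Here Frobenius replaces the character by its conjugate, so the missing factor
      is \<open>G\<close>, and \<open>G ^ (q + 1)\<close> is a power of
      \<open>G ^ 4\<close>.\<close>
    from pcong_mult_left[OF this, of G]
    have "pcong (of_nat q) (G * G ^ q) ([:chi (int q):] * (G * Gc))"
      by (simp add: mult.left_commute)
    also have "pcong (of_nat q) \<dots> ([:chi (int q):] * [:chi (-1) * of_int (Nm p):])"
      by (intro pcong_mult_left GGc)
    also have "[:chi (int q):] * [:chi (-1) * of_int (Nm p):] = [:chi r * of_int (Nm p):]"
    proof -
      have "chi r = chi (int q * (-1))" by (simp add: r)
      also have "\<dots> = chi (int q) * chi (-1)" by (rule char_mult[OF char_chi])
      finally show ?thesis by simp
    qed
    finally have L: "pcong (of_nat q) (G * G ^ q) [:chi r * of_int (Nm p):]" .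
    have "G * G ^ q = (G ^ 4) ^ (s + 1)" by (simp add: qs flip: power_mult power_Suc)
    also have "pcong (of_nat q) \<dots> ([:c:] ^ (s + 1))" by (intro pcong_power G4)
    also have "[:c:] ^ (s + 1) = [:c ^ (s + 1):]" by (rule poly_const_pow)
    finally have 1: "of_nat q dvd c ^ (s + 1) - chi r * of_int (Nm p)"
      using pcong_const_imp_dvd pcong_trans pcong_sym L by blast
    have "of_nat q dvd p ^ q - gcnj p" using gint_frobenius[OF q(1,2), of p] q4 by simp
    then have "of_nat q dvd gi ^ (j * (s + 1)) * p * (p ^ q - gcnj p)" by simp
    also have "gi ^ (j * (s + 1)) * p * (p ^ q - gcnj p) =
        gi ^ (j * (s + 1)) * p ^ (4 * (s + 1)) - gi ^ (j * (s + 1)) * of_int (Nm p)"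
      by (simp add: qs mult_gcnj[symmetric] numeral_eq_Suc algebra_simps)
    finally have "of_nat q dvd (c ^ (s + 1) - gi ^ (j * (s + 1)) * p ^ (4 * (s + 1))) +
        (gi ^ (j * (s + 1)) * p ^ (4 * (s + 1)) - gi ^ (j * (s + 1)) * of_int (Nm p))"
      by (intro dvd_add c_pow)
    from dvd_diff[OF this 1] have "of_nat q dvd (chi r - gi ^ (j * (s + 1))) * of_int (Nm p)"
      by (simp add: algebra_simps)
    from of_nat_dvd_cancel[OF this cop] have 2: "of_nat q dvd chi r - gi ^ (j * (s + 1))" .
    have "chi r = gi ^ nat (qlog p (of_int r))" using q(3) by (intro nz) (simp add: r)
    with 2 have "of_nat q dvd gi ^ nat (qlog p (of_int r)) - gi ^ (j * (s + 1))" by simp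
    then have "[int (nat (qlog p (of_int r))) = int (j * (s + 1))] (mod 4)" using q2 by (rule of_nat_dvd_unit_diff)
    then have "[qlog p (of_int r) = int j * (int s + 1)] (mod 4)" using qlog_nonneg by (simp add: algebra_simps)
    moreover have "(r - 1) div 4 = - (int s + 1)" by (simp add: r qs)
    then have "- int j * ((r - 1) div 4) = int j * (int s + 1)" by (simp only: minus_mult_minus)
    ultimately show ?thesis by (simp only:)
  qed
qed

text \<open>Divisors of \<open>n\<close> inherit the congruence for \<open>gcnj p\<close>, and
  \<open>(n - 1) div 4\<close> is additive modulo 4 in products of integers that are 1 modulo 4. So
  primes suffice, each with the sign that makes it 1 modulo 4.\<close>

lemma reciprocity_int:
  assumes prim: "primary p" and "n mod 4 = 1" "\<not> Nm p dvd n" "of_int n dvd gcnj p - gi ^ j * p"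
  shows "[qlog p (of_int n) = - int j * ((n - 1) div 4)] (mod 4)"
  using assms(2-4)
proof (induction "nat \<bar>n\<bar>" arbitrary: n rule: less_induct)
  case less
  show ?case
  proof (cases "\<bar>n\<bar> = 1")
    case True
    then have "n = 1" using less.prems(1) by (auto simp: abs_if split: if_splits)
    then show ?thesis using qlog_1 by simp
  next
    case False
    then have "nat \<bar>n\<bar> \<noteq> 1" by simp
    then obtain q where q: "prime q" "q dvd nat \<bar>n\<bar>" using prime_factor_nat by blast
    have "int q dvd int (nat \<bar>n\<bar>)" using q(2) by (simp only: of_nat_dvd_iff)
    then have qn: "int q dvd n" by simp
    have "odd n" using less.prems(1) by presburger
    then have qo: "odd q" using qn by (meson dvd_trans even_of_nat_iff)
    have nq: "\<not> Nm p dvd int q" using less.prems(2) qn dvd_trans by blast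
    have "(of_int (int q) :: gint) dvd of_int n" using qn by (metis dvd_def of_int_mult)
    then have uq: "of_nat q dvd gcnj p - gi ^ j * p" using less.prems(3) dvd_trans by force
    define r where "r = (if q mod 4 = 1 then int q else - int q)"
    have "q mod 4 = 1 \<or> q mod 4 = 3" using qo by presburger
    then have r4: "r mod 4 = 1" unfolding r_def by presburger
    have "r dvd n" using qn by (simp add: r_def)
    then obtain m where m: "n = r * m" ..
    have m4: "m mod 4 = 1"
    proof -
      have "(r * m) mod 4 = ((r mod 4) * m) mod 4" by (simp add: mod_mult_left_eq)
      then show ?thesis using less.prems(1) r4 m by simp
    qed
    have n0: "n \<noteq> 0" using less.prems(2) by auto
    have "nat \<bar>m\<bar> < nat \<bar>n\<bar>"
    proof -
      have "\<bar>r\<bar> > 1" using prime_gt_1_nat[OF q(1)] by (simp add: r_def)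
      moreover have "\<bar>m\<bar> > 0" using n0 m by auto
      ultimately have "1 * \<bar>m\<bar> < \<bar>r\<bar> * \<bar>m\<bar>" by (rule mult_strict_right_mono)
      then show ?thesis by (simp add: m abs_mult)
    qed
    moreover have "\<not> Nm p dvd m" "\<not> Nm p dvd r" using less.prems(2) m by auto
    moreover have "of_int m dvd gcnj p - gi ^ j * p"
      using less.prems(3) unfolding m of_int_mult by (rule dvd_mult_right)
    ultimately have IH: "[qlog p (of_int m) = - int j * ((m - 1) div 4)] (mod 4)"
      using less.hyps m4 by blast
    have R: "[qlog p (of_int r) = - int j * ((r - 1) div 4)] (mod 4)"
      unfolding r_def by (rule reciprocity_prime[OF prim q(1) qo nq uq])
    have "[qlog p (of_int r * of_int m) = qlog p (of_int r) + qlog p (of_int m)] (mod 4)"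
      using \<open>\<not> Nm p dvd m\<close> \<open>\<not> Nm p dvd r\<close> by (intro qlog_mult) (simp_all add: dvd_of_int_iff)
    also have "[qlog p (of_int r) + qlog p (of_int m) = - int j * ((r - 1) div 4) + - int j * ((m - 1) div 4)] (mod 4)"
      by (intro cong_add R IH)
    also have "- int j * ((r - 1) div 4) + - int j * ((m - 1) div 4) = - int j * ((r - 1) div 4 + (m - 1) div 4)"
      by (simp add: algebra_simps)
    also have "[\<dots> = - int j * ((n - 1) div 4)] (mod 4)"
    proof (intro cong_mult cong_refl)
      obtain x y where "r = 4 * x + 1" "m = 4 * y + 1"
        using r4 m4 by (metis mult_div_mod_eq)
      then have "(r - 1) div 4 = x" "(m - 1) div 4 = y" "(n - 1) div 4 = 4 * (x * y) + x + y"
        using m by (simp_all add: algebra_simps)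
      then show "[(r - 1) div 4 + (m - 1) div 4 = (n - 1) div 4] (mod 4)" by (simp add: cong_iff_dvd_diff)
    qed
    finally show ?thesis by (simp add: m)
  qed
qed

text \<open>Modulo \<open>a + b\<close> the conjugate of \<open>p\<close> is \<open>gi * p\<close>,
  and modulo \<open>a\<close> it is \<open>- p\<close>, so rational reciprocity applies with
  \<open>j\<close> equal to 1 and 2. If 4 does not divide \<open>b\<close>, then \<open>- a\<close>
  is the integer that is 1 modulo 4, and the symbol of -1 enters as well.\<close>

lemma qlog_gt_split:
  assumes prim: "primary p"
  shows "[4 * qlog p gt = gRe p - gIm p - (gIm p)\<^sup>2 - 1] (mod 16)"
proof -
  define a b where "a = gRe p" and "b = gIm p"
  have ab: "even b" "(a + b) mod 4 = 1" using prim by (auto simp: primary_iff a_def b_def)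
  have N: "Nm p = a\<^sup>2 + b\<^sup>2" by (simp add: Nm_def a_def b_def)
  have a_odd: "odd a" using ab by presburger
  have na: "\<not> Nm p dvd a"
  proof
    assume dvd: "Nm p dvd a"
    have "a \<noteq> 0" using a_odd by auto
    have "Nm p \<le> \<bar>a\<bar>" using dvd_imp_le_int[OF \<open>a \<noteq> 0\<close> dvd] by simp
    moreover have "\<bar>a\<bar> \<le> a\<^sup>2" using self_le_power[of "\<bar>a\<bar>" 2] \<open>a \<noteq> 0\<close> by simp
    ultimately have "b\<^sup>2 \<le> 0" "a\<^sup>2 \<le> \<bar>a\<bar>" using N zero_le_power2[of b] by linarith+
    then have "b = 0" by simp
    then have "prime (a\<^sup>2)" using split N by simp
    then show False using prime_power_iff[of a 2] by simp
  qed
  have odd_gt: "\<not> p dvd gt" using odd prime_elem_gt prime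
    by (metis dvd_refl prime_elem_imp_irreducible irreducible_altdef p_nu dvd_trans prime_elem_not_unit)
  have at: "p dvd of_int (a + b) - of_int a * gt"
  proof -
    have "of_int (a + b) - of_int a * gt = p * (- gi)" by (simp add: gint_eq_iff a_def b_def)
    then show ?thesis by simp
  qed
  have nat: "\<not> p dvd of_int a * gt" using na odd_gt by (intro not_dvd_mult) (simp_all add: dvd_of_int_iff)
  have nab: "\<not> Nm p dvd a + b"
  proof
    assume "Nm p dvd a + b"
    then have "p dvd of_int (a + b)" by (simp only: dvd_of_int_iff)
    from dvd_diff[OF this at] show False using nat by simp
  qed
  have 1: "[qlog p (of_int (a + b)) = - int 1 * ((a + b - 1) div 4)] (mod 4)"
  proof (rule reciprocity_int[OF prim ab(2) nab])
    have "gcnj p - gi ^ 1 * p = of_int (a + b) * (1 - gi)" by (simp add: gint_eq_iff a_def b_def)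
    then show "of_int (a + b) dvd gcnj p - gi ^ 1 * p" by simp
  qed
  have "[qlog p (of_int (a + b)) = qlog p (of_int a * gt)] (mod 4)"
    using at nab by (intro qlog_cong) (simp_all only: dvd_of_int_iff not_False_eq_True)
  also have "[qlog p (of_int a * gt) = qlog p (of_int a) + qlog p gt] (mod 4)"
    using na odd_gt by (intro qlog_mult) (simp_all add: dvd_of_int_iff)
  finally have 2: "[qlog p (of_int (a + b)) = qlog p (of_int a) + qlog p gt] (mod 4)" .
  have conj_a: "gcnj p - gi ^ 2 * p = of_int a * 2" by (simp add: gint_eq_iff a_def gi_power2)
  have ab4: "a + b - 1 = 4 * ((a + b - 1) div 4)" using ab(2) by presburger
  show ?thesis
  proof (cases "4 dvd b")
    case True
    then obtain c where c: "b = 4 * c" ..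
    have a4: "a mod 4 = 1" using ab(2) True by presburger
    have "[qlog p (of_int a) = - int 2 * ((a - 1) div 4)] (mod 4)"
      by (rule reciprocity_int[OF prim a4 na]) (simp add: conj_a)
    then obtain k where k: "qlog p (of_int a) = - int 2 * ((a - 1) div 4) + 4 * k"
      by (metis cong_iff_lin cong_sym)
    obtain l where l: "qlog p (of_int (a + b)) = - int 1 * ((a + b - 1) div 4) + 4 * l"
      using 1 by (metis cong_iff_lin cong_sym)
    obtain m where m: "qlog p (of_int (a + b)) = qlog p (of_int a) + qlog p gt + 4 * m"
      using 2 by (metis cong_iff_lin cong_sym)
    have "a - 1 = 4 * ((a - 1) div 4)" using a4 by presburger
    then have "4 * qlog p gt - (a - b - b\<^sup>2 - 1) = 16 * (l - k - m + c\<^sup>2)"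
      using k l m ab4 c by (simp add: power2_eq_square algebra_simps)
    then show ?thesis unfolding a_def[symmetric] b_def[symmetric] cong_iff_dvd_diff by simp
  next
    case False
    have a4: "(- a) mod 4 = 1" using ab False by presburger
    have na': "\<not> Nm p dvd - a" using na by simp
    have "[qlog p (of_int (- a)) = - int 2 * ((- a - 1) div 4)] (mod 4)"
      by (rule reciprocity_int[OF prim a4 na']) (simp add: conj_a)
    then obtain k where k: "qlog p (of_int (- a)) = - int 2 * ((- a - 1) div 4) + 4 * k"
      by (metis cong_iff_lin cong_sym)
    obtain l where l: "qlog p (of_int (a + b)) = - int 1 * ((a + b - 1) div 4) + 4 * l"
      using 1 by (metis cong_iff_lin cong_sym)
    obtain m where m: "qlog p (of_int (a + b)) = qlog p (of_int a) + qlog p gt + 4 * m"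
      using 2 by (metis cong_iff_lin cong_sym)
    have "[qlog p ((-1) * of_int (- a)) = qlog p (-1) + qlog p (of_int (- a))] (mod 4)"
    proof (rule qlog_mult)
      show "\<not> p dvd -1" by (rule not_dvd_unit) simp
      show "\<not> p dvd of_int (- a)" using na' by (simp only: dvd_of_int_iff not_False_eq_True)
    qed
    then obtain i where i: "qlog p (of_int a) = qlog p (-1) + qlog p (of_int (- a)) + 4 * i"
      by simp (metis cong_iff_lin cong_sym)
    obtain i' where i': "qlog p (-1) = 2 * int (qexp p) + 4 * i'"
      using qlog_minus_1 by (metis cong_iff_lin cong_sym)
    have h: "4 * int (qexp p) = a\<^sup>2 + b\<^sup>2 - 1" using qexp(1)[OF prime odd] N Nm_mod4 prime_gt_0_int[OF split] by linarith
    have a4': "- a - 1 = 4 * ((- a - 1) div 4)" using a4 by presburger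
    obtain x where x: "a = 4 * x + 3" using a4 by (intro that[of "a div 4"]) presburger
    obtain y where y: "b = 4 * y + 2" using ab(1) False by (intro that[of "b div 4"]) presburger
    have "4 * qlog p gt = 4 * qlog p (of_int (a + b)) - 4 * qlog p (of_int a) - 16 * m" using m by simp
    also have "\<dots> = - (a + b - 1) + 16 * l - 4 * (qlog p (-1) + qlog p (of_int (- a)) + 4 * i) - 16 * m"
      using l ab4 i by simp
    also have "\<dots> = - (a + b - 1) + 16 * l - (2 * (a\<^sup>2 + b\<^sup>2 - 1) + 16 * i') - (- 2 * (- a - 1) + 16 * k) - 16 * i - 16 * m"
      using i' h k a4' by simp
    finally have "4 * qlog p gt - (a - b - b\<^sup>2 - 1) = 16 * (l - i' - k - i - m) - (4 * a + 2 * a\<^sup>2 + b\<^sup>2 - 2)"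
      by (simp add: algebra_simps)
    also have "4 * a + 2 * a\<^sup>2 + b\<^sup>2 - 2 = 16 * (2 * x\<^sup>2 + 4 * x + y\<^sup>2 + y + 2)"
      unfolding x y by (simp add: power2_eq_square algebra_simps)
    finally have "4 * qlog p gt - (a - b - b\<^sup>2 - 1) =
        16 * ((l - i' - k - i - m) - (2 * x\<^sup>2 + 4 * x + y\<^sup>2 + y + 2))" by (simp only: right_diff_distrib)
    then have "16 dvd 4 * qlog p gt - (a - b - b\<^sup>2 - 1)" by (simp only: dvd_triv_left)
    then show ?thesis unfolding a_def[symmetric] b_def[symmetric] cong_iff_dvd_diff .
  qed
qed

end

context gprime_odd
begin

text \<open>An inert primary prime is -q with q = 3 modulo 4. There \<open>gt ^ q\<close> is the
  conjugate of \<open>gt\<close>, that is \<open>gi ^ 3 * gt\<close>, so \<open>gt ^ (q - 1)\<close>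
  is \<open>gi ^ 3\<close>, and the exponent of the symbol is (q - 1) (q + 1) / 4.\<close>

lemma qlog_gt:
  assumes prim: "primary p"
  shows "[qlog p gt = int (m_exp p)] (mod 4)"
proof -
  have "[4 * qlog p gt = gRe p - gIm p - (gIm p)\<^sup>2 - 1] (mod 16)"
  proof (cases rule: gint_prime_cases[OF prime odd])
    case (1 P)
    then interpret gprime_split p by unfold_locales simp
    show ?thesis by (rule qlog_gt_split[OF prim])
  next
    case (2 q u)
    have q0: "q > 0" using 2(1) by (rule prime_gt_0_int)
    have pr: "even (gIm p)" "(gRe p + gIm p) mod 4 = 1" using prim by (auto simp: primary_iff)
    have p: "p = - of_int q"
      using gint_unit_cases[OF 2(3)] pr 2(2,4) by (auto simp: gint_eq_iff) presburger+
    define k where "k = nat q"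
    have k: "q = int k" using q0 by (simp add: k_def)
    have "prime k" using 2(1) q0 by (simp add: k_def)
    have "k mod 4 = 3" using 2(2) unfolding k by presburger
    then have "odd k" by presburger
    note k = k \<open>prime k\<close> \<open>odd k\<close> \<open>k mod 4 = 3\<close>
    define s where "s = k div 4"
    have ks: "k = 4 * s + 3" using k(4) mult_div_mod_eq[of 4 k] by (simp add: s_def)
    have pk: "p dvd x \<longleftrightarrow> of_nat k dvd x" for x by (simp add: p k(1))
    have "p dvd gt ^ k - gcnj gt" using gint_frobenius[OF k(2,3), of gt] k(4) by (simp add: pk)
    also have "gt ^ k - gcnj gt = gt * (gt ^ (4 * s + 2) - gi ^ 3)"
    proof -
      have "gcnj gt = gt * gi ^ 3" by (simp add: gint_eq_iff numeral_eq_Suc)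
      then show ?thesis by (simp add: ks power_add algebra_simps numeral_eq_Suc)
    qed
    finally have "p dvd gt ^ (4 * s + 2) - gi ^ 3"
      using prime odd prime_elem_dvd_mult_iff[OF prime]
      by (metis prime_elem_gt dvd_refl prime_elem_imp_irreducible irreducible_altdef p_nu dvd_trans prime_elem_not_unit)
    then have "p dvd (gt ^ (4 * s + 2)) ^ (s + 1) - (gi ^ 3) ^ (s + 1)" by (rule dvd_power_diff)
    moreover have "qexp p = (4 * s + 2) * (s + 1)"
    proof -
      have "Nm p = q\<^sup>2" by (simp add: p Nm_def)
      then have "4 * int (qexp p) = q\<^sup>2 - 1"
        using qexp(1)[OF prime odd] gint_prime_Nm_mod4(2)[OF prime odd] by linarith
      also have "\<dots> = 4 * int ((4 * s + 2) * (s + 1))" by (simp add: k(1) ks power2_eq_square algebra_simps)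
      finally show ?thesis by linarith
    qed
    ultimately have "p dvd gt ^ qexp p - gi ^ (3 * (s + 1))" by (simp only: power_mult)
    from qlog_eqI[OF this] obtain l where "qlog p gt = 3 * (int s + 1) + 4 * l"
      by (metis (no_types, lifting) cong_iff_lin cong_sym of_nat_1 of_nat_add of_nat_mult of_nat_numeral)
    then have "4 * qlog p gt - (gRe p - gIm p - (gIm p)\<^sup>2 - 1) = 16 * (int s + 1 + l)"
      by (simp add: p k(1) ks)
    then show ?thesis unfolding cong_iff_dvd_diff by (simp only: dvd_triv_left)
  qed
  then have "[4 * qlog p gt = 4 * int (m_exp p mod 4)] (mod 16)"
    using mn_exponents(1)[OF prim] by (simp add: unique_euclidean_semiring_class.cong_def)
  then have "4 * 4 dvd 4 * (qlog p gt - int (m_exp p mod 4))" by (simp add: cong_iff_dvd_diff algebra_simps)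
  then have "4 dvd qlog p gt - int (m_exp p mod 4)" by (metis dvd_mult_cancel_left zero_neq_numeral)
  then show ?thesis by (simp add: cong_iff_dvd_diff zmod_int mod_eq_dvd_iff[symmetric] unique_euclidean_semiring_class.cong_def)
qed

lemma qlog_gi_primary:
  assumes prim: "primary p"
  shows "[qlog p gi = int (n_exp p)] (mod 4)"
proof -
  have "(Nm p - 1) mod 16 = 4 * int (n_exp p mod 4)" by (rule mn_exponents(2)[OF prim])
  then obtain c where "Nm p - 1 = 16 * c + 4 * int (n_exp p mod 4)" by (metis mult_div_mod_eq)
  moreover have "Nm p - 1 = 4 * int (qexp p)" using qexp(1)[OF prime odd] gint_prime_Nm_mod4(2)[OF prime odd] by linarith
  ultimately have "int (qexp p) = 4 * c + int (n_exp p mod 4)" by linarith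
  then have "[int (qexp p) = int (n_exp p)] (mod 4)"
    by (simp add: unique_euclidean_semiring_class.cong_def zmod_int)
  then show ?thesis using qlog_gi cong_trans by blast
qed

end

section \<open>The Selmer group\<close>

lemma primary_odd: "primary x \<Longrightarrow> \<not> gt dvd x"
  unfolding primary_iff gt_dvd_iff by (metis even_mod_4_div_2 mod2_eq_if dvd_mod_iff odd_one even_numeral dvd_mod)

text \<open>Associated elements differ by a unit, and 1 is the only unit that is 1 modulo
  \<open>gt ^ 3\<close>.\<close>

lemma primary_dvd_imp_eq:
  assumes "prime_elem v" "prime_elem w" "primary v" "primary w" "v dvd w"
  shows "v = w"
proof -
  obtain u where u: "w = v * u" using assms(5) ..
  have "irreducible w" using assms(2) by (rule prime_elem_imp_irreducible)
  then have "v dvd 1 \<or> u dvd 1" using u by (rule irreducibleD)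
  then have "u dvd 1" using assms(1) by auto
  then have "u = 1 \<or> u = -1 \<or> u = gi \<or> u = - gi" by (rule gint_unit_cases)
  moreover have "even (gIm v)" "odd (gRe v)" "(gRe v + gIm v) mod 4 = 1" "even (gIm w)" "(gRe w + gIm w) mod 4 = 1"
    using assms(3,4) unfolding primary_iff by presburger+
  ultimately have "u = 1 \<or> u = -1" using u by auto
  then show ?thesis
  proof
    assume "u = -1"
    then have "gRe w + gIm w = - (gRe v + gIm v)" using u by simp
    then have "(- (gRe v + gIm v)) mod 4 = 1" using \<open>(gRe w + gIm w) mod 4 = 1\<close> by simp
    then show ?thesis using \<open>(gRe v + gIm v) mod 4 = 1\<close> by presburger
  qed (use u in simp)
qed

context gprime
begin

lemma pabs_less_1_iff: "pabs p x < 1 \<longleftrightarrow> ple p 1 x"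
proof
  assume "ple p 1 x"
  then have "pabs p x \<le> v powi (- 1)" by (simp only: pabs_le_iff)
  also have "\<dots> < 1" using v_gt_1 by (simp add: power_int_minus inverse_less_1_iff)
  finally show "pabs p x < 1" .
next
  assume x: "pabs p x < 1"
  show "ple p 1 x"
  proof (rule ccontr)
    assume *: "\<not> ple p 1 x"
    then have "x \<noteq> 0" "0 \<le> - pval p x" by (auto simp: ple_def)
    then have "v powi 0 \<le> pabs p x"
      unfolding pabs_eq[OF \<open>x \<noteq> 0\<close>] using v_gt_1 by (intro power_int_increasing) auto
    then show False using x by simp
  qed
qed

text \<open>\<open>selmer_phi\<close> ranges over all prime elements dividing \<open>2 * b\<close>,
  among them the associates of \<open>gt\<close> and of the vertices.\<close>

lemma unit_solvable_associated:
  assumes "u dvd 1" "unit_solvable p b d" shows "unit_solvable (u * p) b d"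
proof -
  have *: "(u * p) ^ n dvd x \<longleftrightarrow> p ^ n dvd x" for n x
  proof -
    have "u ^ n dvd 1" using assms(1) by (simp add: is_unit_power_iff)
    then show ?thesis by (simp add: power_mult_distrib mult_unit_dvd_iff')
  qed
  show ?thesis using assms(2) unfolding unit_solvable_def by (simp only: * multiplicity_times_unit_left[OF assms(1)])
qed

end

context gprime_odd
begin

lemma quartic_eq:
  assumes w: "\<not> p dvd w" and k: "p dvd w ^ qexp p - gi ^ k"
  shows "quartic p (to_fract w) = gi ^ k"
proof -
  have w0: "w \<noteq> 0" using w by auto
  have pv: "pval p (to_fract w) = 0" using w by (simp add: pval_to_fract[OF w0] not_dvd_imp_multiplicity_0)
  have iff: "pabs p ((to_fract w * to_fract p powi (- pval p (to_fract w))) ^ nat ((Nm p - 1) div 4) - to_fract \<zeta>) < 1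
     \<longleftrightarrow> p dvd w ^ qexp p - \<zeta>" for \<zeta>
  proof -
    have "(to_fract w * to_fract p powi (- pval p (to_fract w))) ^ nat ((Nm p - 1) div 4) - to_fract \<zeta>
        = to_fract (w ^ qexp p - \<zeta>)" by (simp add: pv qexp_def)
    then show ?thesis using ple_to_fract[of 1 "w ^ qexp p - \<zeta>"] by (simp only: pabs_less_1_iff) simp
  qed
  show ?thesis unfolding quartic_def iff
  proof (rule the_equality)
    show "gi ^ k \<in> {1, gi, - 1, - gi} \<and> p dvd w ^ qexp p - gi ^ k"
      using gint_unit_cases[OF gi_power_unit[of k]] k by blast
    fix \<zeta> assume z: "\<zeta> \<in> {1, gi, - 1, - gi} \<and> p dvd w ^ qexp p - \<zeta>"
    then have "\<zeta> dvd 1" by auto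
    then obtain j :: nat where j: "\<zeta> = gi ^ j" by (rule gint_unit_power)
    have "p dvd (w ^ qexp p - gi ^ k) - (w ^ qexp p - \<zeta>)" using k z by (blast intro: dvd_diff)
    then have "p dvd gi ^ j - gi ^ k" by (simp add: j)
    then have "[int j = int k] (mod 4)" by (simp only: dvd_gi_power_diff_iff)
    then have "[j = k] (mod 4)" by (metis cong_int_iff of_nat_numeral)
    then show "\<zeta> = gi ^ k" unfolding j gi_power_eq_iff .
  qed
qed

lemma log_gi_power: "log_gi (gi ^ k) = int (k mod 4)"
proof -
  have "(THE j. j < 4 \<and> gi ^ j = gi ^ k) = k mod 4"
  proof (rule the_equality)
    show "k mod 4 < 4 \<and> gi ^ (k mod 4) = gi ^ k" using gi_power_mod[of k] by simp
    fix j :: nat assume j: "j < 4 \<and> gi ^ j = gi ^ k"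
    then have "j mod 4 = k mod 4" by (simp add: gi_power_eq_iff unique_euclidean_semiring_class.cong_def)
    then show "j = k mod 4" using j by simp
  qed
  then show ?thesis by (simp add: log_gi_def)
qed

lemma weight_cong_qlog:
  assumes "\<not> p dvd w" "p \<noteq> w" shows "[qlog p w = weight p w] (mod 4)"
proof -
  obtain k where k: "qlog p w = int k" "p dvd w ^ qexp p - gi ^ k" using qlog_spec[OF assms(1)] .
  have "weight p w = int (k mod 4)"
    using assms(2) by (simp add: weight_def quartic_eq[OF assms(1) k(2)] log_gi_power)
  then show ?thesis by (simp add: k(1) zmod_int unique_euclidean_semiring_class.cong_def)
qed

text \<open>Serves for the prime-to-\<open>p\<close> parts of both \<open>b\<close> and
  \<open>d\<close>; the supplementary laws enter the linear system here, through the exponents of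
  \<open>gi\<close> and \<open>gt\<close>.\<close>

lemma qlog_vertex_product:
  assumes prim: "primary p" and A: "\<And>w. w \<in> A \<Longrightarrow> \<not> p dvd w \<and> p \<noteq> w"
  shows "\<not> p dvd gi ^ s * gt ^ t * (\<Prod>w\<in>A. w ^ f w)"
    and "[qlog p (gi ^ s * gt ^ t * (\<Prod>w\<in>A. w ^ f w)) =
      int (m_exp p * t + n_exp p * s) + (\<Sum>w\<in>A. int (f w) * weight p w)] (mod 4)"
proof -
  have gi: "\<not> p dvd gi" by (rule not_dvd_unit) simp
  have gt: "\<not> p dvd gt"
    using odd prime_elem_gt prime p_nu
    by (metis dvd_refl prime_elem_imp_irreducible irreducible_altdef dvd_trans prime_elem_not_unit)
  have Af: "\<not> p dvd w ^ f w" if "w \<in> A" for w using A[OF that] by (intro not_dvd_power) blast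
  have 1: "\<not> p dvd gi ^ s * gt ^ t" using gi gt by (intro not_dvd_mult not_dvd_power)
  show "\<not> p dvd gi ^ s * gt ^ t * (\<Prod>w\<in>A. w ^ f w)" by (intro not_dvd_mult[OF 1] qlog_prod(2) Af)
  have a: "[qlog p (gi ^ s) = int s * int (n_exp p)] (mod 4)"
    by (rule cong_trans[OF qlog_power[OF gi] cong_mult[OF cong_refl qlog_gi_primary[OF prim]]])
  have b: "[qlog p (gt ^ t) = int t * int (m_exp p)] (mod 4)"
    by (rule cong_trans[OF qlog_power[OF gt] cong_mult[OF cong_refl qlog_gt[OF prim]]])
  have c: "[(\<Sum>w\<in>A. qlog p (w ^ f w)) = (\<Sum>w\<in>A. int (f w) * weight p w)] (mod 4)"
  proof (rule cong_sum)
    fix w assume w: "w \<in> A"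
    have "[qlog p (w ^ f w) = int (f w) * qlog p w] (mod 4)" using A[OF w] by (intro qlog_power) blast
    also have "[int (f w) * qlog p w = int (f w) * weight p w] (mod 4)"
      using A[OF w] by (intro cong_mult cong_refl weight_cong_qlog) blast+
    finally show "[qlog p (w ^ f w) = int (f w) * weight p w] (mod 4)" .
  qed
  have "[qlog p (gi ^ s * gt ^ t * (\<Prod>w\<in>A. w ^ f w)) = qlog p (gi ^ s * gt ^ t) + qlog p (\<Prod>w\<in>A. w ^ f w)] (mod 4)"
    by (intro qlog_mult 1 qlog_prod(2) Af)
  also have "[qlog p (gi ^ s * gt ^ t) + qlog p (\<Prod>w\<in>A. w ^ f w) =
      (int s * int (n_exp p) + int t * int (m_exp p)) + (\<Sum>w\<in>A. int (f w) * weight p w)] (mod 4)"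
    by (intro cong_add cong_trans[OF qlog_mult[OF not_dvd_power[OF gi] not_dvd_power[OF gt]] cong_add[OF a b]]
        cong_trans[OF qlog_prod(1) c] Af)
  finally show "[qlog p (gi ^ s * gt ^ t * (\<Prod>w\<in>A. w ^ f w)) =
      int (m_exp p * t + n_exp p * s) + (\<Sum>w\<in>A. int (f w) * weight p w)] (mod 4)"
    by (simp add: algebra_simps)
qed

lemma qlog_minus_1_primary:
  assumes "primary p" shows "[qlog p (-1) = 2 * int (n_exp p)] (mod 4)"
proof -
  have "[int (qexp p) = int (n_exp p)] (mod 4)"
    by (rule cong_trans[OF cong_sym[OF qlog_gi] qlog_gi_primary[OF assms]])
  then have "[2 * int (qexp p) = 2 * int (n_exp p)] (mod 4)" by (rule cong_mult[OF cong_refl])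
  then show ?thesis using qlog_minus_1 cong_trans by blast
qed

end

section \<open>The linear system and the theorem\<close>

lemma bit_of_int_eq_iff: "(of_int x :: bit) = of_int y \<longleftrightarrow> even (x - y)"
proof -
  have "(of_int z :: bit) = (if even z then 0 else 1)" for z
    by (cases "even z") (auto elim!: evenE oddE)
  then show ?thesis by auto
qed

lemma prime_elem_dvd_prodD:
  assumes "prime_elem (p :: gint)" "p dvd (\<Prod>x\<in>A. f x)" obtains x where "x \<in> A" "p dvd f x"
proof -
  have "p dvd (\<Prod>x\<in>A. f x) \<Longrightarrow> \<exists>x\<in>A. p dvd f x"
    by (induction A rule: infinite_finite_induct)
      (use assms(1) in \<open>auto simp: prime_elem_dvd_mult_iff\<close>)
  then show thesis using assms(2) that by blast
qed

text \<open>The row of \<open>L'\<close> at a vertex of \<open>Q\<close>, with \<open>Y\<close> and \<open>Z\<close> the contributions of the units and of \<open>gt\<close>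
  in \<open>b\<close> and \<open>d\<close>; the assumption says that the vertex is not deleted.\<close>

lemma q_row_arith:
  fixes D1 D2 D3 W Y Z n :: int
  assumes "even (D1 + D3 - Y)"
  shows "[2 * n + (Y + (D1 + 2 * D2 + 3 * D3)) + 2 * (Z + W) = 0] (mod 4) \<longleftrightarrow>
    even (D1 + D2 + D3 + (if [D1 + 3 * D3 = Y + 2 * (n + 1)] (mod 4) then 1 else 0) - W - Z)"
proof -
  \<comment> \<open>On a row that is kept, both congruences modulo 4 compare integers with even
    difference; halving turns them into parities.\<close>
  have "even (D1 + 3 * D3 - Y)" using assms by simp
  then obtain j where j: "D1 + 3 * D3 - Y = 2 * j" ..
  have m4: "4 dvd 2 * i \<longleftrightarrow> even i" for i :: int
    using dvd_mult_cancel_left[of 2 2 i] by simp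
  have "2 * n + (Y + (D1 + 2 * D2 + 3 * D3)) + 2 * (Z + W) - 0 = 2 * (n + Y + j + D2 + Z + W)"
    using j by simp
  then have 1: "[2 * n + (Y + (D1 + 2 * D2 + 3 * D3)) + 2 * (Z + W) = 0] (mod 4) \<longleftrightarrow> even (n + Y + j + D2 + Z + W)"
    unfolding cong_iff_dvd_diff by (simp only: m4)
  have "D1 + 3 * D3 - (Y + 2 * (n + 1)) = 2 * (j - n - 1)" using j by simp
  then have 2: "[D1 + 3 * D3 = Y + 2 * (n + 1)] (mod 4) \<longleftrightarrow> even (j - n - 1)"
    unfolding cong_iff_dvd_diff by (simp only: m4)
  have 3: "D1 = Y + 2 * j - 3 * D3" using j by simp
  show ?thesis unfolding 1 2 unfolding 3 by auto
qed

theorem theorem5p6: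
  fixes b d :: gint and P Q Vd :: "gint set" and r :: "gint \<Rightarrow> nat"
    and sb tb sd td :: nat
  assumes "b \<noteq> 0" and "\<And>x. x ^ 4 dvd b \<Longrightarrow> x dvd 1"
    and "sb \<in> {0, 1, 2, 3}" and "tb \<in> {0, 1, 2, 3}"
    and "finite P" and "finite Q" and "P \<inter> Q = {}"
    and "\<And>v. v \<in> P \<union> Q \<Longrightarrow> prime_elem v \<and> primary v"
    and "\<And>p. p \<in> P \<Longrightarrow> r p \<in> {1, 3}"
    and "b = gi ^ sb * gt ^ tb * (\<Prod>p\<in>P. p ^ r p) * (\<Prod>q\<in>Q. q ^ 2)"
    and "squarefree d" and "d dvd b"
    and "sd \<in> {0, 1}" and "td \<in> {0, 1}" and "Vd \<subseteq> P \<union> Q"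
    and "d = gi ^ sd * (1 + gi) ^ td * (\<Prod>v\<in>Vd. v)"
  defines "V' \<equiv> index2 P Q b sb tb"
    and "b0 \<equiv> b div gt ^ tb" and "d0 \<equiv> d div gt ^ td"
    and "R \<equiv> completion_ints gt"
  shows "square_class (to_fract d) \<in> selmer_phi b \<longleftrightarrow>
    Vd \<subseteq> V' \<and>
    (\<forall>v\<in>V'. (\<Sum>w\<in>V'. L' P Q b sb tb v w * (if w dvd d then 1 else 0)) =
        of_nat (m_exp v * td + n_exp v * sd)) \<and>
    (([tb = td] (mod 2) \<and>
        (\<exists>k::nat. \<exists>e\<in>{1, -1}. gcong (gt ^ 5) b0 (d0 * (e - d0 * gt ^ (4 * k + tb))))) \<or>
     (td = 0 \<and>
        (\<exists>k::nat. \<exists>e\<in>{1, -1}. gcong (gt ^ 5) (b0 * gt ^ (4 * k + tb)) (d0 * (e - d0)))) \<or>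
     (tb = 2 * td \<and>
        (\<exists>k::nat. k \<ge> 1 \<and> (\<exists>\<alpha>\<^sub>0 \<in> Units R.
           ring_cong R (loc gt (gt ^ 7)) (loc gt b0)
             (\<ominus>\<^bsub>R\<^esub> loc gt d0 \<otimes>\<^bsub>R\<^esub>
                (loc gt d0 \<ominus>\<^bsub>R\<^esub> \<alpha>\<^sub>0 [^]\<^bsub>R\<^esub> (2::nat) \<otimes>\<^bsub>R\<^esub> loc gt (gt ^ (2 * k - td))))))))"
proof -
  define V where "V = P \<union> Q"
  define \<rho> where "\<rho> w = (if w \<in> P then r w else 2)" for w
  have finV: "finite V" using assms(5,6) by (simp add: V_def)
  have vert: "prime_elem v" "primary v" "gprime_odd v" if "v \<in> V" for v
  proof -
    show "prime_elem v" "primary v" using assms(8) that by (simp_all add: V_def)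
    then show "gprime_odd v" using primary_odd by unfold_locales auto
  qed
  have ndvd: "\<not> v dvd w \<and> v \<noteq> w" if "v \<in> V" "w \<in> V - {v}" for v w
    using primary_dvd_imp_eq[of v w] vert that by auto
  have \<rho>: "\<rho> w \<in> {1, 2, 3}" for w using assms(9) by (auto simp: \<rho>_def)
  have b_prod: "b = gi ^ sb * gt ^ tb * (\<Prod>w\<in>V. w ^ \<rho> w)"
  proof -
    have "(\<Prod>w\<in>V. w ^ \<rho> w) = (\<Prod>w\<in>P. w ^ \<rho> w) * (\<Prod>w\<in>Q. w ^ \<rho> w)"
      unfolding V_def using assms(5-7) by (rule prod.union_disjoint)
    also have "(\<Prod>w\<in>P. w ^ \<rho> w) = (\<Prod>p\<in>P. p ^ r p)" by (simp add: \<rho>_def)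
    also have "(\<Prod>w\<in>Q. w ^ \<rho> w) = (\<Prod>q\<in>Q. q ^ 2)"
      using assms(7) by (intro prod.cong) (auto simp: \<rho>_def)
    finally show ?thesis using assms(10) by (simp add: mult.assoc)
  qed
  have VdV: "Vd \<subseteq> V" using assms(15) by (simp add: V_def)
  have finVd: "finite Vd" using VdV finV by (rule finite_subset)
  have d_prod: "d = gi ^ sd * gt ^ td * (\<Prod>w\<in>Vd. w ^ 1)" using assms(16) by (simp add: gt_def)
  define b1 d1 where "b1 v = gi ^ sb * gt ^ tb * (\<Prod>w\<in>V - {v}. w ^ \<rho> w)"
    and "d1 v = gi ^ sd * gt ^ td * (\<Prod>w\<in>Vd - {v}. w ^ 1)" for v
  define ex where "ex v = (if v \<in> Vd then 1 else 0 :: nat)" for v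
  have b_dec: "b = v ^ \<rho> v * b1 v" if "v \<in> V" for v
    unfolding b_prod b1_def using prod.remove[OF finV that, of "\<lambda>w. w ^ \<rho> w"] by (simp add: ac_simps)
  have d_dec: "d = v ^ ex v * d1 v" for v
  proof (cases "v \<in> Vd")
    case True
    then show ?thesis unfolding d_prod d1_def
      using prod.remove[OF finVd True, of "\<lambda>w. w ^ 1"] by (simp add: ex_def ac_simps)
  next
    case False
    then show ?thesis by (simp add: d_prod d1_def ex_def)
  qed
  define W Y Z where "W v = (\<Sum>w\<in>Vd. weight v w)" and "Y v = int (m_exp v * tb + n_exp v * sb)"
    and "Z v = int (m_exp v * td + n_exp v * sd)" for v
  define D where "D k v = deg_exp V b k v" for k v
  have b1: "\<not> v dvd b1 v" "[qlog v (b1 v) = Y v + (\<Sum>w\<in>V - {v}. int (\<rho> w) * weight v w)] (mod 4)"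
    and d1: "\<not> v dvd d1 v" "[qlog v (d1 v) = Z v + W v] (mod 4)" if v: "v \<in> V" for v
  proof -
    interpret gprime_odd v using vert(3)[OF v] .
    show "\<not> v dvd b1 v" "[qlog v (b1 v) = Y v + (\<Sum>w\<in>V - {v}. int (\<rho> w) * weight v w)] (mod 4)"
      unfolding b1_def Y_def using qlog_vertex_product[OF vert(2)[OF v] ndvd[OF v]] by blast+
    have A: "\<not> v dvd w \<and> v \<noteq> w" if "w \<in> Vd - {v}" for w using ndvd[OF v] that VdV by blast
    show "\<not> v dvd d1 v" unfolding d1_def by (rule qlog_vertex_product(1)[OF vert(2)[OF v] A])
    \<comment> \<open>\<open>weight v v\<close> is 0, so the vertex itself may be put back into the
      sum.\<close>
    have "(\<Sum>w\<in>Vd - {v}. int 1 * weight v w) = W v"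
      unfolding W_def by (intro sum.mono_neutral_cong_left) (auto simp: finVd weight_def)
    then show "[qlog v (d1 v) = Z v + W v] (mod 4)"
      using qlog_vertex_product(2)[OF vert(2)[OF v] A, of "Vd - {v}" sd td "\<lambda>_. 1"] by (simp only: d1_def Z_def)
  qed
  have mult_b: "multiplicity v b = \<rho> v" if v: "v \<in> V" for v
  proof (rule multiplicity_eqI)
    interpret gprime_odd v using vert(3)[OF v] .
    show "v ^ \<rho> v dvd b" using b_dec[OF v] by simp
    show "\<not> v ^ Suc (\<rho> v) dvd b"
      using dvd_power_mult_cancel[OF p_nz, of "\<rho> v" 1 "b1 v"] b1(1)[OF v] b_dec[OF v] by simp
  qed
  have degs: "(\<Sum>w\<in>V - {v}. int (\<rho> w) * weight v w) = D 1 v + 2 * D 2 v + 3 * D 3 v"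
    "Defs.deg V v = D 1 v + D 2 v + D 3 v" for v
  proof -
    have Dk: "D k v = (\<Sum>w\<in>V. if \<rho> w = k then weight v w else 0)" for k
    proof -
      have "D k v = (\<Sum>w\<in>{w \<in> V. \<rho> w = k}. weight v w)"
        unfolding D_def deg_exp_def using mult_b by (intro sum.cong) auto
      then show ?thesis using sum.inter_filter[OF finV] by simp
    qed
    have "(\<Sum>w\<in>V - {v}. int (\<rho> w) * weight v w) = (\<Sum>w\<in>V. int (\<rho> w) * weight v w)"
      by (intro sum.mono_neutral_left) (auto simp: finV weight_def)
    also have "\<dots> = D 1 v + 2 * D 2 v + 3 * D 3 v"
      unfolding Dk sum_distrib_left sum.distrib[symmetric]
    proof (rule sum.cong)
      fix w
      show "int (\<rho> w) * weight v w = (if \<rho> w = 1 then weight v w else 0) +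
          2 * (if \<rho> w = 2 then weight v w else 0) + 3 * (if \<rho> w = 3 then weight v w else 0)"
        using \<rho>[of w] by auto
    qed simp
    finally show "(\<Sum>w\<in>V - {v}. int (\<rho> w) * weight v w) = D 1 v + 2 * D 2 v + 3 * D 3 v" .
    show "Defs.deg V v = D 1 v + D 2 v + D 3 v"
      unfolding Dk Defs.deg_def sum.distrib[symmetric]
    proof (rule sum.cong)
      fix w
      show "weight v w = (if \<rho> w = 1 then weight v w else 0) +
          (if \<rho> w = 2 then weight v w else 0) + (if \<rho> w = 3 then weight v w else 0)"
        using \<rho>[of w] by auto
    qed simp
  qed
  define LC where "LC v = gprime_odd.local_cond v (ex v) (\<rho> v) (b1 v) (d1 v)" for v
  define \<delta>P \<delta>Q where "\<delta>P v = (if v \<in> P \<and> \<not> [D 2 v = Y v] (mod 2) then 1 else 0 :: int)"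
    and "\<delta>Q v = (if v \<in> Q \<and> [D 1 v + 3 * D 3 v = Y v + 2 * (int (n_exp v) + 1)] (mod 4) then 1 else 0 :: int)" for v
  \<comment> \<open>Row \<open>v\<close> of the linear system lifted to the integers, with the
    diagonal entry separated from the adjacency part \<open>W v\<close>.\<close>
  define row where "row v \<longleftrightarrow> even ((if v \<in> Vd then Defs.deg V v + \<delta>P v + \<delta>Q v else 0) - W v - Z v)" for v
  have V': "v \<in> V' \<longleftrightarrow> v \<in> V \<and> (v \<in> Q \<longrightarrow> even (D 1 v + D 3 v - Y v))" for v
    by (auto simp: V'_def index2_def V_def D_def Y_def cong_iff_dvd_diff)
  have L'_eq: "L' P Q b sb tb v w = of_int ((if v = w then Defs.deg V v + \<delta>P v + \<delta>Q v else 0) - weight v w)" for v w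
  proof -
    have e: "of_int (\<delta>P v) = (if v \<in> P \<and> \<not> [D 2 v = Y v] (mod 2) then 1 else 0 :: bit)"
      "of_int (\<delta>Q v) = (if v \<in> Q \<and> [D 1 v + 3 * D 3 v = Y v + 2 * (int (n_exp v) + 1)] (mod 4) then 1 else 0 :: bit)"
      by (simp_all add: \<delta>P_def \<delta>Q_def)
    have y: "int (m_exp v * tb + n_exp v * sb) = Y v"
      "int (m_exp v * tb + n_exp v * sb + 2 * (n_exp v + 1)) = Y v + 2 * (int (n_exp v) + 1)"
      by (simp_all add: Y_def)
    have "L' P Q b sb tb v w = of_int ((if v = w then Defs.deg V v else 0) - weight v w) +
        (if v = w then of_int (\<delta>P v) else 0) + (if v = w then of_int (\<delta>Q v) else 0)"
      unfolding L'_def L3_def L1_def laplacian_def V_def[symmetric] D_def[symmetric] e y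
      by (cases "v = w") (simp_all only: simp_thms if_True if_False)
    then show ?thesis
      by (cases "v = w") (simp_all only: simp_thms if_True if_False of_int_add of_int_diff of_int_0 add_0_right diff_add_eq)
  qed
  have dvd_d: "w dvd d \<longleftrightarrow> w \<in> Vd" if "w \<in> V" for w
  proof -
    interpret gprime_odd w using vert(3)[OF that] .
    show ?thesis using d_dec[of w] d1(1)[OF that] by (auto simp: ex_def)
  qed
  have row_iff: "(\<Sum>w\<in>V'. L' P Q b sb tb v w * (if w dvd d then 1 else 0)) =
        of_nat (m_exp v * td + n_exp v * sd) \<longleftrightarrow> row v" if "Vd \<subseteq> V'" "v \<in> V'" for v
  proof -
    have "(\<Sum>w\<in>V'. L' P Q b sb tb v w * (if w dvd d then 1 else 0)) = (\<Sum>w\<in>Vd. L' P Q b sb tb v w)"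
    proof (rule sum.mono_neutral_cong_right)
      show "finite V'" using finV V' by (meson finite_subset subsetI)
      show "\<forall>w\<in>V' - Vd. L' P Q b sb tb v w * (if w dvd d then 1 else 0) = 0"
        using dvd_d V' by auto
      fix w assume "w \<in> Vd"
      then show "L' P Q b sb tb v w * (if w dvd d then 1 else 0) = L' P Q b sb tb v w"
        using dvd_d VdV by auto
    qed (rule that(1))
    also have "\<dots> = of_int (\<Sum>w\<in>Vd. (if v = w then Defs.deg V v + \<delta>P v + \<delta>Q v else 0) - weight v w)"
      by (simp only: L'_eq of_int_sum)
    also have "(\<Sum>w\<in>Vd. (if v = w then Defs.deg V v + \<delta>P v + \<delta>Q v else 0) - weight v w) =
        (if v \<in> Vd then Defs.deg V v + \<delta>P v + \<delta>Q v else 0) - W v"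
      using finVd by (simp add: sum_subtractf W_def)
    finally have "(\<Sum>w\<in>V'. L' P Q b sb tb v w * (if w dvd d then 1 else 0)) =
        of_int ((if v \<in> Vd then Defs.deg V v + \<delta>P v + \<delta>Q v else 0) - W v)" .
    moreover have "(of_nat (m_exp v * td + n_exp v * sd) :: bit) = of_int (Z v)" by (simp add: Z_def)
    ultimately show ?thesis unfolding row_def by (simp only: bit_of_int_eq_iff)
  qed
  have LC_iff: "LC v \<longleftrightarrow> (if v \<in> V' then row v else v \<notin> Vd)" if v: "v \<in> V" for v
  proof -
    interpret gprime_odd v using vert(3)[OF v] .
    have qb: "[qlog v (b1 v) = Y v + (D 1 v + 2 * D 2 v + 3 * D 3 v)] (mod 4)"
      using b1(2)[OF v] unfolding degs .
    note qd = d1(2)[OF v]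
    have eb: "even (qlog v (b1 v)) \<longleftrightarrow> even (Y v + D 1 v + D 3 v)" using cong4_even[OF qb] by auto
    have ed: "even (qlog v (d1 v)) \<longleftrightarrow> even (Z v + W v)" using cong4_even[OF qd] .
    have q1: "[qlog v (-1) + qlog v (b1 v) + 2 * qlog v (d1 v) = 0] (mod 4) \<longleftrightarrow>
        [2 * int (n_exp v) + (Y v + (D 1 v + 2 * D 2 v + 3 * D 3 v)) + 2 * (Z v + W v) = 0] (mod 4)"
    proof -
      have "[qlog v (-1) + qlog v (b1 v) + 2 * qlog v (d1 v) =
        2 * int (n_exp v) + (Y v + (D 1 v + 2 * D 2 v + 3 * D 3 v)) + 2 * (Z v + W v)] (mod 4)"
        by (intro cong_add cong_mult cong_refl qb qd qlog_minus_1_primary vert(2)[OF v])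
      then show ?thesis using cong_trans cong_sym by blast
    qed
    show ?thesis
    proof (cases "v \<in> P")
      case True
      then have vQ: "v \<notin> Q" and \<rho>v: "\<rho> v \<noteq> 2" and v': "v \<in> V'"
        using assms(7) assms(9)[of v] v by (auto simp: \<rho>_def V')
      \<comment> \<open>Modulo 2 the correction is \<open>D 2 v - Y v\<close>, so the diagonal entry
        becomes \<open>D 1 v + D 3 v + Y v\<close>, the parity of the exponent of
        \<open>b1 v\<close>.\<close>
      have "\<delta>P v = (if odd (D 2 v - Y v) then 1 else 0)" "\<delta>Q v = 0"
        using True vQ by (simp_all add: \<delta>P_def \<delta>Q_def cong_iff_dvd_diff)
      then show ?thesis using v' \<rho>v unfolding LC_def local_cond_def row_def degs
        by (auto simp: ex_def ed eb)
    next
      case False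
      then have vQ: "v \<in> Q" and \<rho>v: "\<rho> v = 2" using v by (auto simp: \<rho>_def V_def)
      have \<delta>: "\<delta>P v = 0" "\<delta>Q v = (if [D 1 v + 3 * D 3 v = Y v + 2 * (int (n_exp v) + 1)] (mod 4) then 1 else 0)"
        using False vQ by (simp_all add: \<delta>P_def \<delta>Q_def)
      show ?thesis
      proof (cases "even (D 1 v + D 3 v - Y v)")
        case ev: True
        then have v': "v \<in> V'" using V' v by blast
        have yb: "even (qlog v (b1 v))" unfolding eb using ev by auto
        show ?thesis
        proof (cases "v \<in> Vd")
          case True
          then show ?thesis using v' unfolding LC_def local_cond_def row_def degs \<delta>
            using q_row_arith[OF ev, of "int (n_exp v)" "D 2 v" "Z v" "W v"] by (simp add: ex_def \<rho>v q1)
        next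
          case False
          then show ?thesis using v' yb unfolding LC_def local_cond_def row_def
            by (simp add: ex_def \<rho>v ed)
        qed
      next
        case od: False
        then have v': "v \<notin> V'" using V' vQ by blast
        \<comment> \<open>As \<open>b1 v\<close> is not a square, one of \<open>d1 v\<close> and
          \<open>b1 v * d1 v\<close> is, which settles the case
          \<open>v \<notin> Vd\<close>.\<close>
        have yb: "odd (qlog v (b1 v))" unfolding eb using od by auto
        show ?thesis
        proof (cases "v \<in> Vd")
          case True
          have "\<not> [qlog v (-1) + qlog v (b1 v) + 2 * qlog v (d1 v) = 0] (mod 4)"
          proof
            assume "[qlog v (-1) + qlog v (b1 v) + 2 * qlog v (d1 v) = 0] (mod 4)"
            from cong4_even[OF this] have "even (qlog v (-1) + qlog v (b1 v))" by simp
            moreover have "even (qlog v (-1))"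
              using cong4_even[OF qlog_minus_1_primary[OF vert(2)[OF v]]] by simp
            ultimately show False using yb by simp
          qed
          then show ?thesis using v' True unfolding LC_def local_cond_def by (simp add: ex_def \<rho>v)
        next
          case False
          then show ?thesis using v' yb unfolding LC_def local_cond_def by (simp add: ex_def \<rho>v)
        qed
      qed
    qed
  qed
  have "(\<forall>v\<in>V. LC v) \<longleftrightarrow> Vd \<subseteq> V' \<and> (\<forall>v\<in>V'. row v)"
    using LC_iff V' VdV by (auto split: if_splits)
  also have "\<dots> \<longleftrightarrow> Vd \<subseteq> V' \<and> (\<forall>v\<in>V'. (\<Sum>w\<in>V'. L' P Q b sb tb v w * (if w dvd d then 1 else 0)) =
        of_nat (m_exp v * td + n_exp v * sd))"
    using row_iff by blast
  finally have odd_places: "(\<forall>v\<in>V. LC v) \<longleftrightarrow> Vd \<subseteq> V' \<and>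
      (\<forall>v\<in>V'. (\<Sum>w\<in>V'. L' P Q b sb tb v w * (if w dvd d then 1 else 0)) = of_nat (m_exp v * td + n_exp v * sd))" .
  have gt_vert: "\<not> gt dvd gi ^ s * (\<Prod>w\<in>A. w ^ f w)" if "A \<subseteq> V" for s f A
  proof
    assume "gt dvd gi ^ s * (\<Prod>w\<in>A. w ^ f w)"
    moreover have "\<not> gt dvd gi ^ s" using gi_power_unit GT.p_nu dvd_trans by blast
    ultimately have "gt dvd (\<Prod>w\<in>A. w ^ f w)" using prime_elem_gt by (simp add: prime_elem_dvd_mult_iff)
    then obtain w where "w \<in> A" "gt dvd w ^ f w" by (rule prime_elem_dvd_prodD[OF prime_elem_gt])
    then show False using prime_elem_dvd_power[OF prime_elem_gt] vert(2) primary_odd that by blast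
  qed
  have b0: "b = gt ^ tb * b0" "\<not> gt dvd b0"
  proof -
    have b: "b = gi ^ sb * (\<Prod>w\<in>V. w ^ \<rho> w) * gt ^ tb" by (simp add: b_prod ac_simps)
    have "b0 = gi ^ sb * (\<Prod>w\<in>V. w ^ \<rho> w)" unfolding b0_def by (subst b) simp
    then show "b = gt ^ tb * b0" "\<not> gt dvd b0" using b gt_vert[of V] by (simp_all add: ac_simps)
  qed
  have d0: "d = gt ^ td * d0" "\<not> gt dvd d0"
  proof -
    have d: "d = gi ^ sd * (\<Prod>w\<in>Vd. w ^ 1) * gt ^ td" by (simp only: d_prod ac_simps)
    have "d0 = gi ^ sd * (\<Prod>w\<in>Vd. w ^ 1)" unfolding d0_def by (subst d) simp
    then show "d = gt ^ td * d0" "\<not> gt dvd d0"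
      using d gt_vert[OF VdV, of sd "\<lambda>_. 1"] by (simp_all only: ac_simps not_False_eq_True)
  qed
  have td: "td \<le> 1" and tb: "tb \<le> 3" using assms(4,14) by auto
  have d_nz: "d \<noteq> 0" using d0 by auto
  have ex1: "ex v \<le> 1" for v by (simp add: ex_def)
  have selmer: "square_class (to_fract d) \<in> selmer_phi b \<longleftrightarrow> (\<forall>v\<in>V. LC v) \<and> gt_cond b0 d0 tb td"
  proof
    assume "square_class (to_fract d) \<in> selmer_phi b"
    \<comment> \<open>The class may be witnessed by a divisor \<open>d'\<close> of
      \<open>2 * b\<close> other than \<open>d\<close>; approximate solvability is then carried over
      along the square factor.\<close>
    then obtain d' where d': "square_class (to_fract d) = square_class (to_fract d')" "d' dvd 2 * b"
      and C: "\<And>p. prime_elem p \<Longrightarrow> p dvd 2 * b \<Longrightarrow> C_points b d' p \<noteq> {}"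
      unfolding selmer_phi_def by blast
    have "2 * b \<noteq> 0" using assms(1) by (simp add: gint_eq_iff)
    then have d'_nz: "d' \<noteq> 0" using d'(2) by auto
    have "to_fract d \<in> square_class (to_fract d)" unfolding square_class_def by (auto intro: exI[of _ 1])
    then have "to_fract d \<in> square_class (to_fract d')" by (simp only: d'(1))
    then obtain y where y: "to_fract d = to_fract d' * y ^ 2" "y \<noteq> 0" unfolding square_class_def by blast
    obtain e c where ec: "y = Fraction_Field.Fract e c" "c \<noteq> 0" "e \<noteq> 0"
      using y(2) by (metis Fract_cases_nonzero)
    have "to_fract (d * c ^ 2) = to_fract (d' * e ^ 2)"
      using y(1) ec by (simp add: Fract_conv_to_fract power_divide)
    then have eq: "d' * e ^ 2 = d * c ^ 2" by (simp only: to_fract_eq_iff)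
    have approx: "approx_solvable p b d" if "prime_elem p" "p dvd 2 * b" for p
    proof -
      interpret gprime p by unfold_locales (rule that(1))
      show ?thesis
        by (rule approx_solvable_square_class[OF ec(3,2) eq C_points_imp_approx[OF d'_nz C[OF that]]])
    qed
    show "(\<forall>v\<in>V. LC v) \<and> gt_cond b0 d0 tb td"
    proof
      show "\<forall>v\<in>V. LC v"
      proof
        fix v assume v: "v \<in> V"
        interpret gprime_odd v using vert(3)[OF v] .
        have "v ^ 1 dvd v ^ \<rho> v" using \<rho>[of v] by (intro le_imp_power_dvd) auto
        then have "v dvd 2 * b" using b_dec[OF v] by simp
        then have "approx_solvable v b d" using approx vert(1)[OF v] by blast
        then show "LC v" unfolding LC_def
          using local_cond_of_approx_solvable[OF d_dec d1(1)[OF v] b_dec[OF v] b1(1)[OF v] ex1] \<rho>[of v] by blast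
      qed
      have "approx_solvable gt b d" using gt_dvd_2 by (intro approx prime_elem_gt dvd_mult2)
      then show "gt_cond b0 d0 tb td" by (rule gt_cond_of_approx_solvable[OF d0 b0 td tb])
    qed
  next
    assume *: "(\<forall>v\<in>V. LC v) \<and> gt_cond b0 d0 tb td"
    have "C_points b d p \<noteq> {}" if p: "prime_elem p" "p dvd 2 * b" for p
    proof -
      interpret gprime p by unfold_locales (rule p(1))
      have "p dvd (- gi * gt ^ 2) * (gi ^ sb * gt ^ tb * (\<Prod>w\<in>V. w ^ \<rho> w))"
        using p(2) unfolding b_prod[symmetric] two_eq_gt by (simp only: mult_minus_left)
      moreover have "\<not> p dvd gi ^ n" "\<not> p dvd - gi" for n
        using p_nu gi_power_unit dvd_trans by (blast, metis dvd_minus_iff gi_dvd_1)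
      ultimately have "p dvd gt ^ 2 \<or> p dvd gt ^ tb \<or> p dvd (\<Prod>w\<in>V. w ^ \<rho> w)"
        using prime by (simp add: prime_elem_dvd_mult_iff)
      \<comment> \<open>\<open>p\<close> is only associated to \<open>gt\<close> or to a vertex;
        solvability is shown for that prime and transferred to \<open>p\<close> by a unit.\<close>
      then have "\<exists>w. p dvd w \<and> prime_elem w \<and> (w = gt \<or> w \<in> V)"
      proof (elim disjE)
        assume "p dvd (\<Prod>w\<in>V. w ^ \<rho> w)"
        then obtain w where "w \<in> V" "p dvd w ^ \<rho> w" by (rule prime_elem_dvd_prodD[OF prime])
        then show ?thesis using prime_elem_dvd_power[OF prime] vert(1) by blast
      qed (use prime_elem_dvd_power[OF prime] prime_elem_gt in blast)+
      then obtain w where w: "p dvd w" "prime_elem w" "w = gt \<or> w \<in> V" by blast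
      have US: "unit_solvable w b d"
      proof (cases "w = gt")
        case True
        then show ?thesis using gt_cond_imp_unit_solvable[OF d0 b0 td tb] * by simp
      next
        case False
        then have wV: "w \<in> V" using w(3) by blast
        interpret w: gprime_odd w using vert(3)[OF wV] .
        have "LC w" using * wV by blast
        then show ?thesis unfolding LC_def
          using w.local_cond_imp_unit_solvable[OF d_dec d1(1)[OF wV] b_dec[OF wV] b1(1)[OF wV] ex1] \<rho>[of w] by blast
      qed
      obtain u where u: "w = p * u" using w(1) ..
      have "irreducible w" using w(2) by (rule prime_elem_imp_irreducible)
      then have "u dvd 1" using irreducibleD[OF _ u] p_nu by blast
      then obtain u' where u': "1 = u * u'" by blast
      then have "p = u' * w" by (simp add: u ac_simps)
      moreover have "u' dvd 1" using u' by (metis dvd_triv_right)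
      ultimately have "unit_solvable p b d"
        using gprime.unit_solvable_associated[OF gprime.intro[OF w(2)] _ US] by blast
      then show ?thesis by (rule unit_solvable_imp_C_points)
    qed
    moreover have "d dvd 2 * b" using assms(12) by simp
    ultimately show "square_class (to_fract d) \<in> selmer_phi b" unfolding selmer_phi_def by blast
  qed
  show ?thesis unfolding selmer odd_places gt_cond_def R_def unit_square_cong_iff by blast
qed

end
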